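(* Let $h_n^*$ be the data-driven bandwidth defined in the context and $$\lambda_n=\min_{h\in\mathbb{H}_n}\left[h^{2\beta}+\frac{\log n}{n\phi(\mathbf{x},h)}\right].$$ Assume: (1) $l\le K(u)\le L$ for $0\le u\le1$ with constants $0<l\le L$, and $K(u)=0$ for $u>1$; (2) $\beta>0$ and for some $b_F>0$, $\|F(\mathbf{z})-F(\mathbf{x})\|\le b_F\,d(\mathbf{x},\mathbf{z})^\beta$ for all $\mathbf{z}$ in a neighborhood of $\mathbf{x}$; (3) there is a constant $\sigma>0$ such that for all $\mathbf{z}$ in a certain neighborhood of $\mathbf{x}$ and every integer $k\ge2$, $$\mathbb{E}\big[\|\mathbb{L}_{\mathbf{x}}(G(\mathbf{Y})-\mathbb{E}[G(\mathbf{Y})\mid\mathbf{X}=\mathbf{z}])\|^k\,\big|\,\mathbf{X}=\mathbf{z}\big]\le\frac{k!}{2}\sigma^k;$$ (4) there are constants $\epsilon_1>0$, $\epsilon_2>0$, $M>0$ such that whenever $h\le\epsilon_1$ and $\|V_n(\mathbf{x},h)\|\le\epsilon_2$, we have $\|R_n(\mathbf{x},h)\|^2\le Mh^{2\beta}+\|V_n(\mathbf{x},h)\|^2$. Then $$\big\|\widehat{\Theta}_n(\mathbf{x},h_n^* )-\Theta(\mathbf{x})\big\|^2=O_{\mathbb{P}}(\lambda_n)\quad\text{as }n\to\infty.$$ Further, in the conditional-mean case, i.e. $\Theta(\mathbf{x})=\mathbb{E}[\Psi(\mathbf{Y})\mid\mathbf{X}=\mathbf{x}]$ with $\Psi:\mathcal{R}\to\mathcal{B}$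 and $$\widehat{\Theta}_n(\mathbf{x},h)=\frac{\sum_{i=1}^{n}\Psi(\mathbf{Y}_i)K(h^{-1}d(\mathbf{x},\mathbf{X}_i))}{\sum_{i=1}^{n}K(h^{-1}d(\mathbf{x},\mathbf{X}_i))}$$ (so that $\mathcal{G}=\mathcal{B}$, $\mathbb{L}_{\mathbf{x}}$ is the identity, $G=\Psi$, $F(\mathbf{z})=\mathbb{E}[\Psi(\mathbf{Y})\mid\mathbf{X}=\mathbf{z}]$ and $R_n=\mathbf{0}$), we have $$\mathbb{E}\big\|\widehat{\Theta}_n(\mathbf{x},h_n^* )-\Theta(\mathbf{x})\big\|^2=O(\lambda_n)\quad\text{as }n\to\infty.$$
   Context: $(\mathcal{C},d)$ is a complete separable metric space, $\mathcal{R}$ is a measurable space, $(\mathbf{X},\mathbf{Y})$ is a random element of $\mathcal{C}\times\mathcal{R}$, and $(\mathbf{X}_i,\mathbf{Y}_i)$, $i\ge1$, are i.i.d. copies. A regular conditional distribution of $\mathbf{Y}$ given $\mathbf{X}=\mathbf{z}$ is fixed and $\mathbb{E}[\,\cdot\mid\mathbf{X}=\mathbf{z}]$ is taken with respect to it; Banach-space-valued expectations are in the Bochner sense. $\mathbf{x}\in\mathcal{C}$ is fixed and $\phi(\mathbf{x},h)=\mathbb{P}[d(\mathbf{x},\mathbf{X})\le h]$, with $\phi(\mathbf{x},h)>0$ for all $h>0$. $K:[0,\infty)\to[0,\infty)$ is a measurable kernel. $\mathcal{B}$ is a separable Banach space of type 2 with a Schauder basis (type 2: there is $c_0>0$ with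 $\mathbb{E}\|\sum_{i\le n}\mathbf{Z}_i\|^2\le c_0\sum_{i\le n}\mathbb{E}\|\mathbf{Z}_i\|^2$ for all $n$ and all independent zero-mean $\mathbf{Z}_i$ with finite second moments), $\mathcal{G}$ is a separable Banach space, $F:\mathcal{C}\to\mathcal{G}$, $G:\mathcal{R}\to\mathcal{G}$ are measurable, $\mathbb{L}_{\mathbf{x}}:\mathcal{G}\to\mathcal{B}$ is continuous linear. The parameter $\Theta(\mathbf{x})\in\mathcal{B}$ is a functional of the conditional distribution of $\mathbf{Y}$ given $\mathbf{X}=\mathbf{x}$, and $\widehat{\Theta}_n(\mathbf{x},h)$, its kernel estimate with bandwidth $h$, is the same functional of the weighted empirical measure putting mass $K(h^{-1}d(\mathbf{x},\mathbf{X}_i))/\sum_jK(h^{-1}d(\mathbf{x},\mathbf{X}_j))$ at $\mathbf{Y}_i$. One writes $\widehat{\Theta}_n(\mathbf{x},h)-\Theta(\mathbf{x})=B_n(\mathbf{x},h)+V_n(\mathbf{x},h)+R_n(\mathbf{x},h)$ with $$B_n(\mathbf{x},h)=\mathbb{L}_{\mathbf{x}}\left(\frac{\sum_{i=1}^{n}F(\mathbf{X}_i)K(h^{-1}d(\mathbf{x},\mathbf{X}_i))}{\sum_{i=1}^{n}K(h^{-1}d(\mathbf{x},\mathbf{X}_i))}-F(\mathbf{x})\right),$$ $$V_n(\mathbf{x},h)=\mathbb{L}_{\mathbf{x}}\left(\frac{\sum_{i=1}^{n}\big[G(\mathbf{Y}_i)-\mathbb{E}[G(\mathbf{Y}_i)\mid\mathbf{X}_i]\big]K(h^{-1}d(\mathbf{x},\mathbf{X}_i))}{\sum_{i=1}^{n}K(h^{-1}d(\mathbf{x},\mathbf{X}_i))}\right);$$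 quotients with zero denominator are read as $0$. Adaptive bandwidth: $\mathbb{H}_n$ is a (nonempty) finite collection of bandwidths of cardinality at most $n$ such that $n^{-1}(\log n)^2\le\phi(\mathbf{x},h)\le2(\log n)^{-1}$ for all $h\in\mathbb{H}_n$. Let $\widehat{\phi}(\mathbf{x},h)=\frac1n\sum_{i=1}^{n}\mathbb{I}(d(\mathbf{x},\mathbf{X}_i)\le h)$ and $$D_n(\mathbf{x},h)=\sigma^2\zeta_n\frac{\log n}{n\widehat{\phi}(\mathbf{x},h)}\mathbb{I}(\widehat{\phi}(\mathbf{x},h)>0)+\sigma^2\zeta_n\,n\,\mathbb{I}(\widehat{\phi}(\mathbf{x},h)=0),$$ where $\sigma$ is the constant in hypothesis (3) and $\{\zeta_n\}$ is a sequence of positive constants not depending on $h$ with $\zeta_n\to\zeta_0$, the constant $\zeta_0>0$ being such that $\zeta_0\ge768\frac{(1+\epsilon_0)^2}{(1-\epsilon_0)^4}\frac{L^2}{l^2}$ for some fixed $0<\epsilon_0<0.5$. With $(u)_+=\max\{u,0\}$, let $$C_n(\mathbf{x},h)=\max_{h'\in\mathbb{H}_n}\Big(\big\|\widehat{\Theta}_n(\mathbf{x},h')-\widehat{\Theta}_n(\mathbf{x},\max\{h,h'\})\big\|^2-D_n(\mathbf{x},h')\Big)_+,\qquad h_n^*=\arg\min_{h\in\mathbb{H}_n}\big[C_n(\mathbf{x},h)+D_n(\mathbf{x},h)\big].$$ *)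

theory Defs
  imports "HOL-Probability.Probability" "HOL-Library.Landau_Symbols"
begin

text \<open>
  The quantifier over all probability spaces is rendered by the sample space type
  \<^typ>\<open>nat \<Rightarrow> 'b\<close>. This loses nothing: the condition only concerns the joint law of finitely
  many \<open>'b\<close>-valued random variables, and every such law lives on this type.
\<close>
definition type_two :: "'b::{banach,second_countable_topology} itself \<Rightarrow> bool" where
  "type_two _ \<longleftrightarrow> (\<exists>c0>0. \<forall>(n::nat) (P :: (nat \<Rightarrow> 'b) measure) (Z :: nat \<Rightarrow> (nat \<Rightarrow> 'b) \<Rightarrow> 'b).
     prob_space P \<longrightarrow>
     prob_space.indep_vars P (\<lambda>_. borel) Z {1..n} \<longrightarrow>
     (\<forall>i\<in>{1..n}. integrable P (\<lambda>\<omega>. (norm (Z i \<omega>))\<^sup>2) \<and> (\<integral>\<omega>. Z i \<omega> \<partial>P) = 0) \<longrightarrow>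
     (\<integral>\<omega>. (norm (\<Sum>i=1..n. Z i \<omega>))\<^sup>2 \<partial>P) \<le> c0 * (\<Sum>i=1..n. (\<integral>\<omega>. (norm (Z i \<omega>))\<^sup>2 \<partial>P)))"

text \<open>
  In infinite dimensions \<open>I\<close> is infinite and may be taken to be \<^term>\<open>UNIV :: nat set\<close>;
  allowing finite \<open>I\<close> includes the finite-dimensional spaces.
\<close>
definition has_schauder_basis :: "'b::real_normed_vector itself \<Rightarrow> bool" where
  "has_schauder_basis _ \<longleftrightarrow> (\<exists>(e :: nat \<Rightarrow> 'b) (I :: nat set). \<forall>v :: 'b.
     \<exists>!a :: nat \<Rightarrow> real. (\<forall>i. i \<notin> I \<longrightarrow> a i = 0) \<and> (\<lambda>i. a i *\<^sub>R e i) sums v)"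

definition regular_cond_distr ::
  "'w measure \<Rightarrow> ('w \<Rightarrow> 'c::topological_space) \<Rightarrow> 'r measure \<Rightarrow> ('w \<Rightarrow> 'r) \<Rightarrow> ('c \<Rightarrow> 'r measure) \<Rightarrow> bool"
where
  "regular_cond_distr M X R Y \<kappa> \<longleftrightarrow>
     \<kappa> \<in> borel \<rightarrow>\<^sub>M prob_algebra R \<and>
     (\<forall>A\<in>sets borel. \<forall>B\<in>sets R.
        emeasure M {\<omega> \<in> space M. X \<omega> \<in> A \<and> Y \<omega> \<in> B} =
        (\<integral>\<^sup>+ z \<in> A. emeasure (\<kappa> z) B \<partial>distr M borel X))"

definition bigO_in_prob :: "'w measure \<Rightarrow> (nat \<Rightarrow> 'w \<Rightarrow> real) \<Rightarrow> (nat \<Rightarrow> real) \<Rightarrow> bool" where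
  "bigO_in_prob M Z a \<longleftrightarrow>
     (\<forall>\<epsilon>>0. \<exists>C>0. \<forall>\<^sub>F n in sequentially. measure M {\<omega> \<in> space M. \<bar>Z n \<omega>\<bar> > C * \<bar>a n\<bar>} \<le> \<epsilon>)"

definition small_ball_prob ::
  "'w measure \<Rightarrow> ('w \<Rightarrow> 'c::metric_space) \<Rightarrow> 'c \<Rightarrow> real \<Rightarrow> real" where
  "small_ball_prob M X x h = measure M {\<omega> \<in> space M. dist x (X \<omega>) \<le> h}"

text \<open>
  The following quantities are functions of a realised sample \<open>xs 1, \<dots>, xs n\<close>,
  \<open>ys 1, \<dots>, ys n\<close>. Quotients with denominator zero are zero, as always in HOL.
\<close>

definition kernel_mass ::
  "(real \<Rightarrow> real) \<Rightarrow> 'c::metric_space \<Rightarrow> (nat \<Rightarrow> 'c) \<Rightarrow> nat \<Rightarrow> real \<Rightarrow> real" where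
  "kernel_mass K x xs n h = (\<Sum>i=1..n. K (inverse h * dist x (xs i)))"

definition kernel_average ::
  "(real \<Rightarrow> real) \<Rightarrow> 'c::metric_space \<Rightarrow> (nat \<Rightarrow> 'c) \<Rightarrow> nat \<Rightarrow> real \<Rightarrow>
   (nat \<Rightarrow> 'v::real_normed_vector) \<Rightarrow> 'v" where
  "kernel_average K x xs n h v =
     (\<Sum>i=1..n. K (inverse h * dist x (xs i)) *\<^sub>R v i) /\<^sub>R kernel_mass K x xs n h"

text \<open>If the kernel mass vanishes, this is the null measure.\<close>
definition weighted_empirical ::
  "'r measure \<Rightarrow> (real \<Rightarrow> real) \<Rightarrow> 'c::metric_space \<Rightarrow> (nat \<Rightarrow> 'c) \<Rightarrow> (nat \<Rightarrow> 'r) \<Rightarrow> nat \<Rightarrow> real \<Rightarrow>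
   'r measure" where
  "weighted_empirical R K x xs ys n h =
     distr (point_measure {1..n}
       (\<lambda>i. ennreal (K (inverse h * dist x (xs i)) / kernel_mass K x xs n h))) R ys"

definition bias_term ::
  "(real \<Rightarrow> real) \<Rightarrow> ('g::real_normed_vector \<Rightarrow> 'b::real_normed_vector) \<Rightarrow> ('c \<Rightarrow> 'g) \<Rightarrow>
   'c::metric_space \<Rightarrow> (nat \<Rightarrow> 'c) \<Rightarrow> nat \<Rightarrow> real \<Rightarrow> 'b" where
  "bias_term K \<L> F x xs n h =
     \<L> (kernel_average K x xs n h (\<lambda>i. F (xs i)) - F x)"

definition stochastic_term ::
  "(real \<Rightarrow> real) \<Rightarrow> ('c \<Rightarrow> 'r measure) \<Rightarrow>
   ('g::{banach,second_countable_topology} \<Rightarrow> 'b) \<Rightarrow> ('r \<Rightarrow> 'g) \<Rightarrow> 'c::metric_space \<Rightarrow>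
   (nat \<Rightarrow> 'c) \<Rightarrow> (nat \<Rightarrow> 'r) \<Rightarrow> nat \<Rightarrow> real \<Rightarrow> 'b::real_normed_vector" where
  "stochastic_term K \<kappa> \<L> G x xs ys n h =
     \<L> (kernel_average K x xs n h (\<lambda>i. G (ys i) - (\<integral>y. G y \<partial>\<kappa> (xs i))))"

definition remainder_term ::
  "'r measure \<Rightarrow> (real \<Rightarrow> real) \<Rightarrow> ('c \<Rightarrow> 'r measure) \<Rightarrow> ('r measure \<Rightarrow> 'b) \<Rightarrow>
   ('g::{banach,second_countable_topology} \<Rightarrow> 'b) \<Rightarrow>
   ('c \<Rightarrow> 'g) \<Rightarrow> ('r \<Rightarrow> 'g) \<Rightarrow> 'c::metric_space \<Rightarrow> (nat \<Rightarrow> 'c) \<Rightarrow> (nat \<Rightarrow> 'r) \<Rightarrow> nat \<Rightarrow> real \<Rightarrow>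
   'b::real_normed_vector" where
  "remainder_term R K \<kappa> T \<L> F G x xs ys n h =
     T (weighted_empirical R K x xs ys n h) - T (\<kappa> x)
       - bias_term K \<L> F x xs n h - stochastic_term K \<kappa> \<L> G x xs ys n h"

text \<open>
  For the mean functional, plugging in the weighted empirical measure gives the kernel average,
  also when the kernel mass vanishes.
\<close>
lemma integral_weighted_empirical:
  fixes \<Psi> :: "'r \<Rightarrow> 'b::{banach,second_countable_topology}"
  assumes K: "\<And>u. 0 \<le> u \<Longrightarrow> 0 \<le> K u" and h: "0 < h"
    and \<Psi>: "\<Psi> \<in> borel_measurable R" and ys: "\<And>i. i \<in> {1..n} \<Longrightarrow> ys i \<in> space R"
  shows "(\<integral>y. \<Psi> y \<partial>weighted_empirical R K x xs ys n h) =
    kernel_average K x xs n h (\<lambda>i. \<Psi> (ys i))"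
proof -
  have nonneg: "0 \<le> K (inverse h * dist x (xs i))" for i
    using h by (intro K) simp
  have mass: "0 \<le> kernel_mass K x xs n h"
    unfolding kernel_mass_def by (intro sum_nonneg nonneg)
  have meas: "ys \<in> point_measure {1..n} w \<rightarrow>\<^sub>M R" for w
    using ys by (auto simp: measurable_def point_measure_def)
  show ?thesis
    unfolding weighted_empirical_def kernel_average_def
    using nonneg mass
    by (subst integral_distr[OF meas \<Psi>])
       (simp add: lebesgue_integral_point_measure_finite scaleR_sum_right
         divide_inverse mult.commute)
qed

definition holder_at :: "('c::metric_space \<Rightarrow> 'g::real_normed_vector) \<Rightarrow> 'c \<Rightarrow> real \<Rightarrow> bool" where
  "holder_at F x \<beta> \<longleftrightarrow>
     (\<exists>b>0. \<forall>\<^sub>F z in nhds x. norm (F z - F x) \<le> b * dist x z powr \<beta>)"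

text \<open>
  Integrability makes the conditional expectation of \<open>G\<close> meaningful (a Bochner integral that
  does not exist is 0 in HOL).
\<close>
definition conditional_moment_bound ::
  "('c::topological_space \<Rightarrow> 'r measure) \<Rightarrow>
   ('g::{banach,second_countable_topology} \<Rightarrow> 'b::real_normed_vector) \<Rightarrow> ('r \<Rightarrow> 'g) \<Rightarrow> 'c \<Rightarrow>
   real \<Rightarrow> bool" where
  "conditional_moment_bound \<kappa> \<L> G x \<sigma> \<longleftrightarrow>
     (\<forall>\<^sub>F z in nhds x. integrable (\<kappa> z) G \<and>
       (\<forall>k\<ge>2. (\<integral>\<^sup>+ y. ennreal (norm (\<L> (G y - (\<integral>y'. G y' \<partial>\<kappa> z))) ^ k) \<partial>\<kappa> z)
                \<le> ennreal (fact k / 2 * \<sigma> ^ k)))"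

definition empirical_small_ball :: "'c::metric_space \<Rightarrow> (nat \<Rightarrow> 'c) \<Rightarrow> nat \<Rightarrow> real \<Rightarrow> real" where
  "empirical_small_ball x xs n h = (1 / real n) * (\<Sum>i=1..n. of_bool (dist x (xs i) \<le> h))"

definition penalty ::
  "real \<Rightarrow> (nat \<Rightarrow> real) \<Rightarrow> 'c::metric_space \<Rightarrow> (nat \<Rightarrow> 'c) \<Rightarrow> nat \<Rightarrow> real \<Rightarrow> real" where
  "penalty \<sigma> \<zeta> x xs n h =
     \<sigma>\<^sup>2 * \<zeta> n * (ln (real n) / (real n * empirical_small_ball x xs n h))
         * of_bool (empirical_small_ball x xs n h > 0)
     + \<sigma>\<^sup>2 * \<zeta> n * real n * of_bool (empirical_small_ball x xs n h = 0)"

definition comparison ::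
  "real set \<Rightarrow> (real \<Rightarrow> 'b::real_normed_vector) \<Rightarrow> (real \<Rightarrow> real) \<Rightarrow> real \<Rightarrow> real" where
  "comparison H est D h =
     Max ((\<lambda>h'. max ((norm (est h' - est (max h h')))\<^sup>2 - D h') 0) ` H)"

definition is_selected_bandwidth ::
  "real set \<Rightarrow> (real \<Rightarrow> 'b::real_normed_vector) \<Rightarrow> (real \<Rightarrow> real) \<Rightarrow> real \<Rightarrow> bool" where
  "is_selected_bandwidth H est D h \<longleftrightarrow>
     is_arg_min (\<lambda>h. comparison H est D h + D h) (\<lambda>h. h \<in> H) h"

definition oracle_rate :: "real set \<Rightarrow> (real \<Rightarrow> real) \<Rightarrow> real \<Rightarrow> nat \<Rightarrow> real" where
  "oracle_rate H \<phi> \<beta> n = Min ((\<lambda>h. h powr (2 * \<beta>) + ln (real n) / (real n * \<phi> h)) ` H)"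

end

theory Submission
  imports Defs
begin

text \<open>
  The stochastic term is \<open>S / W\<close>, where \<open>W\<close> is the kernel mass and \<open>S\<close> is a sum of i.i.d.
  mean-zero variables whose moments of order \<open>k\<close> are at most \<open>\<phi>(h) k! (L \<sigma>) ^ k / 2\<close>. Type 2 bounds
  the mean of \<open>\<parallel>S\<parallel>\<close>, and Yurinskii's exponential inequality bounds the deviation from it, so no
  conditioning on the covariates is needed: \<open>S\<close> is normalised by the deterministic \<open>n \<phi>(h)\<close>, to
  which \<open>W\<close> is comparable by the same inequality applied to indicators. As \<open>n \<phi>(h) \<ge> (ln n)\<^sup>2\<close>,
  outside an event of probability at most \<open>2 / n ^ 4\<close> the squared stochastic term is at most a fifth
  of the penalty for all bandwidths at once. On that good event the Goldenshluger--Lepski comparison is a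
  deterministic argument. For the second moment, the bad event is controlled by
  \<open>\<parallel>V\<parallel>\<^sup>2 \<le> \<Sum>\<^sub>i \<parallel>\<xi>\<^sub>i\<parallel>\<^sup>2\<close> and fourth moments of the noise \<open>\<xi>\<^sub>i\<close>, because the rate is at least \<open>1 / n\<close>.
\<close>

section \<open>An exponential inequality for sums in Banach spaces\<close>

text \<open>Why a fifth of the penalty: the remainder hypothesis lets \<open>R\<close> be as large
  as \<open>V\<close> up to a bias term, so an estimate errs by its bias plus up to
  \<open>2 \<parallel>V\<parallel>\<close>. When the selection rule compares a small bandwidth with
  a larger one, the noise of the small one must be cancelled completely by its own penalty, since
  the risk at the larger one says nothing about it; the noise of the larger one may be paid for with
  a constant. The two bounds on the small ball probability do different work. The lower one makes
  the Bernstein parameter \<open>2 sqrt (ln n / (n \<phi>))\<close> tend to zero and drives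
  \<open>V\<close> to zero uniformly over the grid, as the remainder hypothesis demands. The upper
  one forces all bandwidths of the grid to shrink to zero, so that the local hypotheses at
  \<open>x\<close> apply to each of them. The selected bandwidth depends on the same data as the
  estimates, so every bound must hold on one event for the whole grid. At most \<open>n\<close>
  bandwidths, each failing with probability of order \<open>1 / n ^ 5\<close>, allow this, and the
  resulting \<open>1 / n ^ 4\<close> is small enough to absorb a growth of order
  \<open>n ^ 3\<close> on the bad event.\<close>

definition exp_rem :: "real \<Rightarrow> real" where
  "exp_rem t = exp t - 1 - t"

lemma borel_measurable_exp_rem[measurable]: "exp_rem \<in> borel_measurable borel"
  unfolding exp_rem_def[abs_def] by measurable

text \<open>\<open>exp_rem\<close> is what is left of the exponential once the constant and the
  linear term are split off; the linear term has mean zero after centring. Convexity is used both to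
  halve a sum of two arguments and for Jensen's inequality.\<close>

lemma convex_on_exp_rem: "convex_on UNIV exp_rem"
  unfolding exp_rem_def[abs_def]
proof (rule f''_ge0_imp_convex[where f' = "\<lambda>t. exp t - 1" and f'' = exp])
  show "((\<lambda>t. exp t - 1 - t) has_real_derivative exp x - 1) (at x)" for x :: real
    by (auto intro!: derivative_eq_intros)
  show "((\<lambda>t. exp t - 1) has_real_derivative exp x) (at x)" for x :: real
    by (auto intro!: derivative_eq_intros)
qed auto

lemma exp_rem_nonneg: "0 \<le> exp_rem t"
  unfolding exp_rem_def using exp_ge_add_one_self[of t] by linarith

lemma exp_rem_mono:
  fixes s t :: real
  assumes "0 \<le> s" "s \<le> t"
  shows "exp_rem s \<le> exp_rem t"
  unfolding exp_rem_def
proof (rule DERIV_nonneg_imp_nondecreasing[OF assms(2)])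
  fix u :: real assume "s \<le> u" "u \<le> t"
  with assms show "\<exists>y. ((\<lambda>t. exp t - 1 - t) has_real_derivative y) (at u) \<and> 0 \<le> y"
    by (intro exI[of _ "exp u - 1"]) (auto intro!: derivative_eq_intros)
qed

text \<open>The odd part of \<open>exp_rem\<close> is \<open>sinh t - t\<close>, which has the sign
  of \<open>t\<close>, so the negative side is the smaller one.\<close>

lemma exp_rem_abs: "exp_rem t \<le> exp_rem \<bar>t\<bar>"
proof (cases "t \<ge> 0")
  case False
  then have t: "0 \<le> - t" by simp
  have "exp 0 - exp (-0) - 2 * 0 \<le> exp (-t) - exp (-(-t)) - 2 * (- t)"
  proof (rule DERIV_nonneg_imp_nondecreasing[OF t])
    fix u :: real
    have "exp u + exp (-u) - 2 \<ge> 0"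
      using exp_ge_add_one_self[of u] exp_ge_add_one_self[of "-u"] by linarith
    then show "\<exists>y. ((\<lambda>t. exp t - exp (-t) - 2 * t) has_real_derivative y) (at u) \<and> 0 \<le> y"
      by (intro exI[of _ "exp u + exp (-u) - 2"]) (auto intro!: derivative_eq_intros)
  qed
  with False show ?thesis by (simp add: exp_rem_def)
qed simp

lemma lipschitz_borel_measurable:
  fixes f :: "'b::real_normed_vector \<Rightarrow> real"
  assumes "\<And>s t. \<bar>f s - f t\<bar> \<le> norm (s - t)"
  shows "f \<in> borel_measurable borel"
proof (intro borel_measurable_continuous_onI)
  have "1-lipschitz_on UNIV f"
    by (rule lipschitz_onI) (simp_all add: dist_norm assms)
  then show "continuous_on UNIV f" by (rule lipschitz_on_continuous_on)
qed

section \<open>Exponential moments of a single summand\<close>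

context prob_space
begin

lemma integrable_norm_of_exp:
  fixes Z :: "'a \<Rightarrow> 'b::{banach,second_countable_topology}"
  assumes [measurable]: "Z \<in> borel_measurable M" and a: "0 < a"
    and ex: "integrable M (\<lambda>\<omega>. exp (a * norm (Z \<omega>)))"
  shows "integrable M Z"
proof (rule Bochner_Integration.integrable_bound)
  show "integrable M (\<lambda>\<omega>. exp (a * norm (Z \<omega>)) / a)" using ex by simp
  have "norm (Z \<omega>) \<le> exp (a * norm (Z \<omega>)) / a" for \<omega>
  proof -
    have "a * norm (Z \<omega>) \<le> exp (a * norm (Z \<omega>))"
      using exp_ge_add_one_self[of "a * norm (Z \<omega>)"] by linarith
    with a show ?thesis by (simp add: field_simps)
  qed
  then show "AE \<omega> in M. norm (Z \<omega>) \<le> norm (exp (a * norm (Z \<omega>)) / a)"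
    using a by auto
qed simp

lemma integrable_lipschitz:
  fixes Z :: "'a \<Rightarrow> 'b::{banach,second_countable_topology}" and f :: "'b \<Rightarrow> real"
  assumes "integrable M Z" and lip: "\<And>s t. \<bar>f s - f t\<bar> \<le> norm (s - t)"
  shows "integrable M (\<lambda>\<omega>. f (Z \<omega>))"
proof (rule Bochner_Integration.integrable_bound)
  have [measurable]: "f \<in> borel_measurable borel" "Z \<in> borel_measurable M"
    using lipschitz_borel_measurable[OF lip] assms(1) by auto
  show "integrable M (\<lambda>\<omega>. \<bar>f 0\<bar> + norm (Z \<omega>))"
    using assms(1) by auto
  show "(\<lambda>\<omega>. f (Z \<omega>)) \<in> borel_measurable M" by simp
  have "\<bar>f z\<bar> \<le> \<bar>f 0\<bar> + norm z" for z using lip[of z 0] by simp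
  then show "AE \<omega> in M. norm (f (Z \<omega>)) \<le> norm (\<bar>f 0\<bar> + norm (Z \<omega>))" by auto
qed

text \<open>One step of Yurinskii's method: only \<open>\<bar>f (u + Z) - E f (u + Z)\<bar> \<le> \<parallel>Z\<parallel> + E \<parallel>Z\<parallel>\<close> enters, and
  convexity with Jensen's inequality replaces \<open>E \<parallel>Z\<parallel>\<close> by a second copy of \<open>\<parallel>Z\<parallel>\<close>.\<close>
lemma nn_integral_exp_lipschitz:
  fixes Z :: "'a \<Rightarrow> 'b::{banach,second_countable_topology}" and f :: "'b \<Rightarrow> real"
  assumes Z[measurable]: "Z \<in> borel_measurable M" and lam: "0 < lam"
    and ex: "integrable M (\<lambda>\<omega>. exp (2 * lam * norm (Z \<omega>)))"
    and lip: "\<And>s t. \<bar>f s - f t\<bar> \<le> norm (s - t)"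
  defines "q \<equiv> expectation (\<lambda>\<omega>. exp_rem (2 * lam * norm (Z \<omega>)))"
  shows "(\<integral>\<^sup>+\<omega>. ennreal (exp (lam * f (u + Z \<omega>))) \<partial>M)
           \<le> ennreal (exp (lam * expectation (\<lambda>\<omega>. f (u + Z \<omega>)) + q))"
proof -
  have f[measurable]: "f \<in> borel_measurable borel" using lip by (rule lipschitz_borel_measurable)
  have iZ: "integrable M Z" using integrable_norm_of_exp[OF Z _ ex] lam by simp
  then have inZ: "integrable M (\<lambda>\<omega>. norm (Z \<omega>))" by simp
  have if1: "integrable M (\<lambda>\<omega>. f (u + Z \<omega>))"
    by (rule integrable_lipschitz[OF _ lip]) (use iZ in simp)
  define g where "g = expectation (\<lambda>\<omega>. f (u + Z \<omega>))"
  define m where "m = expectation (\<lambda>\<omega>. norm (Z \<omega>))"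
  have dev: "\<bar>f (u + Z \<omega>) - g\<bar> \<le> norm (Z \<omega>) + m" for \<omega>
  proof -
    have "f (u + Z \<omega>) - g = expectation (\<lambda>\<omega>'. f (u + Z \<omega>) - f (u + Z \<omega>'))"
      unfolding g_def using if1 by (simp add: prob_space)
    also have "\<bar>\<dots>\<bar> \<le> expectation (\<lambda>\<omega>'. \<bar>f (u + Z \<omega>) - f (u + Z \<omega>')\<bar>)"
      by (rule integral_abs_bound)
    also have "\<dots> \<le> expectation (\<lambda>\<omega>'. norm (Z \<omega>) + norm (Z \<omega>'))"
    proof (rule integral_mono)
      show "integrable M (\<lambda>\<omega>'. \<bar>f (u + Z \<omega>) - f (u + Z \<omega>')\<bar>)" using if1 by simp
      show "integrable M (\<lambda>\<omega>'. norm (Z \<omega>) + norm (Z \<omega>'))" using inZ by simp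
      show "\<bar>f (u + Z \<omega>) - f (u + Z \<omega>')\<bar> \<le> norm (Z \<omega>) + norm (Z \<omega>')" for \<omega>'
        using lip[of "u + Z \<omega>" "u + Z \<omega>'"] norm_triangle_ineq4[of "Z \<omega>" "Z \<omega>'"] by simp
    qed
    also have "\<dots> = norm (Z \<omega>) + m"
      unfolding m_def using inZ by (simp add: prob_space)
    finally show ?thesis .
  qed
  have ipsi: "integrable M (\<lambda>\<omega>. exp_rem (2 * lam * norm (Z \<omega>)))"
    using ex inZ by (simp add: exp_rem_def)
  have jensen: "exp_rem (2 * lam * m) \<le> q"
  proof -
    have "exp_rem (expectation (\<lambda>\<omega>. 2 * lam * norm (Z \<omega>))) \<le> q"
      unfolding q_def
      by (rule jensens_inequality[where I = UNIV and q = exp_rem])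
        (use inZ ipsi convex_on_exp_rem in auto)
    then show ?thesis unfolding m_def by simp
  qed
  \<comment> \<open>This is \<open>exp t = 1 + t + exp_rem t\<close> with the remainder split by
    convexity. The linear term has mean zero and each half of the last term integrates to
    \<open>q / 2\<close>, so the right-hand side integrates to
    \<open>1 + q \<le> exp q\<close>.\<close>
  have step: "exp (lam * (f (u + Z \<omega>) - g))
      \<le> 1 + lam * (f (u + Z \<omega>) - g) + (exp_rem (2 * lam * norm (Z \<omega>)) + q) / 2" (is "?l \<le> _") for \<omega>
  proof -
    let ?t = "lam * (f (u + Z \<omega>) - g)"
    have "exp_rem ?t \<le> exp_rem \<bar>?t\<bar>" by (rule exp_rem_abs)
    also have "\<dots> \<le> exp_rem (lam * (norm (Z \<omega>) + m))"
      using dev[of \<omega>] lam by (intro exp_rem_mono) (auto simp: abs_mult)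
    also have "lam * (norm (Z \<omega>) + m) = (1/2) * (2 * lam * norm (Z \<omega>)) + (1/2) * (2 * lam * m)"
      by (simp add: algebra_simps)
    also have "exp_rem \<dots> \<le> (1/2) * exp_rem (2 * lam * norm (Z \<omega>)) + (1/2) * exp_rem (2 * lam * m)"
      using convex_onD[OF convex_on_exp_rem, of "1/2" "2 * lam * norm (Z \<omega>)" "2 * lam * m"]
      by simp
    finally have "exp_rem ?t \<le> (1/2) * exp_rem (2 * lam * norm (Z \<omega>)) + (1/2) * exp_rem (2 * lam * m)" .
    with jensen show ?thesis unfolding exp_rem_def[of ?t] by argo
  qed
  have "(\<integral>\<^sup>+\<omega>. ennreal (exp (lam * (f (u + Z \<omega>) - g))) \<partial>M)
      \<le> (\<integral>\<^sup>+\<omega>. ennreal (1 + lam * (f (u + Z \<omega>) - g) + (exp_rem (2 * lam * norm (Z \<omega>)) + q) / 2) \<partial>M)"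
    by (intro nn_integral_mono ennreal_leI step)
  also have "\<dots> = ennreal (expectation
      (\<lambda>\<omega>. 1 + lam * (f (u + Z \<omega>) - g) + (exp_rem (2 * lam * norm (Z \<omega>)) + q) / 2))"
  proof (rule nn_integral_eq_integral)
    show "integrable M (\<lambda>\<omega>. 1 + lam * (f (u + Z \<omega>) - g) + (exp_rem (2 * lam * norm (Z \<omega>)) + q) / 2)"
      using if1 ipsi by (intro Bochner_Integration.integrable_add integrable_mult_right
          integrable_divide Bochner_Integration.integrable_diff) auto
    show "AE \<omega> in M. 0 \<le> 1 + lam * (f (u + Z \<omega>) - g) + (exp_rem (2 * lam * norm (Z \<omega>)) + q) / 2"
      by (intro AE_I2 order_trans[OF less_imp_le[OF exp_gt_zero] step])
  qed
  also have "expectation (\<lambda>\<omega>. 1 + lam * (f (u + Z \<omega>) - g) + (exp_rem (2 * lam * norm (Z \<omega>)) + q) / 2)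
      = 1 + lam * (g - g) + (q + q) / 2"
  proof -
    have 1: "integrable M (\<lambda>\<omega>. lam * (f (u + Z \<omega>) - g))"
      using if1 by simp
    have 2: "integrable M (\<lambda>\<omega>. (exp_rem (2 * lam * norm (Z \<omega>)) + q) / 2)"
      using ipsi by (intro integrable_divide Bochner_Integration.integrable_add) auto
    have "expectation (\<lambda>\<omega>. (exp_rem (2 * lam * norm (Z \<omega>)) + q) / 2) = (q + q) / 2"
      using ipsi unfolding q_def
      by (subst integral_divide_zero, subst Bochner_Integration.integral_add) (auto simp: prob_space)
    moreover have "expectation (\<lambda>\<omega>. lam * (f (u + Z \<omega>) - g)) = lam * (g - g)"
      using if1 unfolding g_def by (simp add: prob_space)
    ultimately show ?thesis using 1 2 by (simp add: prob_space)
  qed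
  also have "ennreal (1 + lam * (g - g) + (q + q) / 2) \<le> ennreal (exp q)"
    using exp_ge_add_one_self[of q] by (intro ennreal_leI) simp
  finally have main: "(\<integral>\<^sup>+\<omega>. ennreal (exp (lam * (f (u + Z \<omega>) - g))) \<partial>M) \<le> ennreal (exp q)" .
  have "(\<integral>\<^sup>+\<omega>. ennreal (exp (lam * f (u + Z \<omega>))) \<partial>M)
      = (\<integral>\<^sup>+\<omega>. ennreal (exp (lam * g)) * ennreal (exp (lam * (f (u + Z \<omega>) - g))) \<partial>M)"
    by (intro nn_integral_cong) (simp add: ennreal_mult[symmetric] exp_add[symmetric] algebra_simps)
  also have "\<dots> = ennreal (exp (lam * g)) * (\<integral>\<^sup>+\<omega>. ennreal (exp (lam * (f (u + Z \<omega>) - g))) \<partial>M)"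
    by (rule nn_integral_cmult) simp
  also have "\<dots> \<le> ennreal (exp (lam * g)) * ennreal (exp q)"
    by (rule mult_left_mono[OF main]) simp
  finally show ?thesis
    by (simp add: g_def ennreal_mult[symmetric] exp_add)
qed

text \<open>Term by term in the power series, the factorial in the moment bound cancels the one in
  the series and leaves a geometric series of ratio \<open>2 * lam * s\<close>. The separate factor
  \<open>p\<close> matters: it will be the small ball probability, and it makes the exponent scale
  with \<open>n \<phi>(h)\<close> instead of \<open>n\<close>.\<close>

lemma bernstein_exp_rem:
  fixes Z :: "'a \<Rightarrow> 'b::{banach,second_countable_topology}"
  assumes [measurable]: "Z \<in> borel_measurable M"
    and p: "0 \<le> p" and s: "0 \<le> s" and lam: "0 < lam" "2 * lam * s < 1"
    and mom: "\<And>k. k \<ge> 2 \<Longrightarrow> (\<integral>\<^sup>+\<omega>. ennreal (norm (Z \<omega>) ^ k) \<partial>M) \<le> ennreal (p * (fact k / 2 * s ^ k))"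
  shows "integrable M (\<lambda>\<omega>. exp (2 * lam * norm (Z \<omega>)))"
    and "expectation (\<lambda>\<omega>. exp_rem (2 * lam * norm (Z \<omega>)))
      \<le> 2 * p * (lam * s)\<^sup>2 / (1 - 2 * lam * s)"
proof -
  let ?a = "2 * lam"
  have ser: "ennreal (exp_rem t) = (\<Sum>k. ennreal (t ^ (k + 2) / fact (k + 2)))" if "0 \<le> t" for t :: real
  proof -
    have "(\<lambda>k. t ^ k / fact k) sums exp t"
      using exp_converges[of t] by (simp add: divide_inverse mult.commute)
    from sums_split_initial_segment[OF this, of 2]
    have "(\<lambda>k. t ^ (k + 2) / fact (k + 2)) sums exp_rem t"
      by (simp add: eval_nat_numeral diff_diff_eq exp_rem_def)
    then show ?thesis
      using that by (subst suminf_ennreal2) (auto simp: sums_iff)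
  qed
  have "(\<integral>\<^sup>+\<omega>. ennreal (exp_rem (?a * norm (Z \<omega>))) \<partial>M)
      = (\<integral>\<^sup>+\<omega>. (\<Sum>k. ennreal ((?a * norm (Z \<omega>)) ^ (k + 2) / fact (k + 2))) \<partial>M)"
    using lam by (intro nn_integral_cong ser) auto
  also have "\<dots> = (\<Sum>k. \<integral>\<^sup>+\<omega>. ennreal ((?a * norm (Z \<omega>)) ^ (k + 2) / fact (k + 2)) \<partial>M)"
    by (intro nn_integral_suminf) simp
  also have "\<dots> \<le> (\<Sum>k. ennreal (p / 2 * (?a * s) ^ 2 * (?a * s) ^ k))"
  proof (intro suminf_le)
    fix k :: nat
    have "(\<integral>\<^sup>+\<omega>. ennreal ((?a * norm (Z \<omega>)) ^ (k + 2) / fact (k + 2)) \<partial>M)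
       = (\<integral>\<^sup>+\<omega>. ennreal (?a ^ (k + 2) / fact (k + 2)) * ennreal (norm (Z \<omega>) ^ (k + 2)) \<partial>M)"
      using lam
      by (intro nn_integral_cong) (simp add: ennreal_mult[symmetric] power_mult_distrib del: power_Suc)
    also have "\<dots> = ennreal (?a ^ (k + 2) / fact (k + 2)) * (\<integral>\<^sup>+\<omega>. ennreal (norm (Z \<omega>) ^ (k + 2)) \<partial>M)"
      by (intro nn_integral_cmult) simp
    also have "\<dots> \<le> ennreal (?a ^ (k + 2) / fact (k + 2)) * ennreal (p * (fact (k + 2) / 2 * s ^ (k + 2)))"
      by (intro mult_left_mono mom) auto
    also have "\<dots> = ennreal ((?a ^ (k + 2) / fact (k + 2)) * (p * (fact (k + 2) / 2 * s ^ (k + 2))))"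
      using lam p s by (intro ennreal_mult[symmetric] mult_nonneg_nonneg divide_nonneg_nonneg) auto
    also have "(?a ^ (k + 2) / fact (k + 2)) * (p * (fact (k + 2) / 2 * s ^ (k + 2)))
        = p / 2 * (?a * s) ^ 2 * (?a * s) ^ k"
    proof -
      have "(fact (k + 2) :: real) \<noteq> 0" by simp
      then show ?thesis
        by (simp add: power_add power_mult_distrib del: fact_Suc power_Suc add_2_eq_Suc')
    qed
    finally show "(\<integral>\<^sup>+\<omega>. ennreal ((?a * norm (Z \<omega>)) ^ (k + 2) / fact (k + 2)) \<partial>M)
        \<le> ennreal (p / 2 * (?a * s) ^ 2 * (?a * s) ^ k)" .
  qed auto
  also have "\<dots> = ennreal (p / 2 * (?a * s) ^ 2 * (1 / (1 - ?a * s)))"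
  proof (subst suminf_ennreal2)
    have "norm (?a * s) < 1" using lam s by simp
    then have g: "(\<lambda>k. (?a * s) ^ k) sums (1 / (1 - ?a * s))" by (rule geometric_sums)
    from sums_mult[OF this, of "p / 2 * (?a * s) ^ 2"]
    have h: "(\<lambda>k. p / 2 * (?a * s) ^ 2 * (?a * s) ^ k) sums (p / 2 * (?a * s) ^ 2 * (1 / (1 - ?a * s)))" .
    show "summable (\<lambda>k. p / 2 * (?a * s) ^ 2 * (?a * s) ^ k)" using h by (rule sums_summable)
    show "0 \<le> p / 2 * (?a * s) ^ 2 * (?a * s) ^ k" for k using p s lam by simp
    show "ennreal (\<Sum>k. p / 2 * (?a * s) ^ 2 * (?a * s) ^ k) = ennreal (p / 2 * (?a * s) ^ 2 * (1 / (1 - ?a * s)))"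
      using h by (simp add: sums_iff)
  qed
  also have "p / 2 * (?a * s) ^ 2 * (1 / (1 - ?a * s)) = 2 * p * (lam * s)\<^sup>2 / (1 - 2 * lam * s)"
    by (simp add: power_mult_distrib)
  finally have bound: "(\<integral>\<^sup>+\<omega>. ennreal (exp_rem (?a * norm (Z \<omega>))) \<partial>M)
      \<le> ennreal (2 * p * (lam * s)\<^sup>2 / (1 - 2 * lam * s))" .
  have ipsi: "integrable M (\<lambda>\<omega>. exp_rem (?a * norm (Z \<omega>)))"
    by (intro integrableI_nonneg AE_I2 exp_rem_nonneg le_less_trans[OF bound]) simp_all
  show "expectation (\<lambda>\<omega>. exp_rem (?a * norm (Z \<omega>))) \<le> 2 * p * (lam * s)\<^sup>2 / (1 - 2 * lam * s)"
  proof -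
    have "ennreal (expectation (\<lambda>\<omega>. exp_rem (?a * norm (Z \<omega>)))) \<le> ennreal (2 * p * (lam * s)\<^sup>2 / (1 - 2 * lam * s))"
      using bound by (subst (asm) nn_integral_eq_integral[OF ipsi AE_I2[OF exp_rem_nonneg]])
    moreover have "0 \<le> 2 * p * (lam * s)\<^sup>2 / (1 - 2 * lam * s)"
      using p s lam by (intro divide_nonneg_nonneg mult_nonneg_nonneg) auto
    ultimately show ?thesis by (simp only: ennreal_le_iff)
  qed
  show "integrable M (\<lambda>\<omega>. exp (?a * norm (Z \<omega>)))"
  proof (rule Bochner_Integration.integrable_bound)
    show "integrable M (\<lambda>\<omega>. 3 * exp_rem (?a * norm (Z \<omega>)) + exp 2)"
      by (intro Bochner_Integration.integrable_add integrable_mult_right ipsi) simp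
    \<comment> \<open>Beyond \<open>t = 2\<close> the remainder is a fixed fraction of the
      exponential, because \<open>exp t \<ge> (1 + t/2)\<^sup>2 \<ge> 1 + 3 t / 2\<close>. Hence
      integrability of \<open>exp_rem\<close> gives that of the exponential itself.\<close>
    have "exp t \<le> 3 * exp_rem t + exp 2" if "0 \<le> t" for t :: real
    proof (cases "t \<le> 2")
      case True
      then have "exp t \<le> exp 2" by simp
      then have "exp t + 0 \<le> exp 2 + 3 * exp_rem t"
        by (intro add_mono mult_nonneg_nonneg exp_rem_nonneg) auto
      then show ?thesis by simp
    next
      case False
      have "1 + t/2 \<le> exp (t/2)" by (rule exp_ge_add_one_self)
      then have "(1 + t/2)\<^sup>2 \<le> (exp (t/2))\<^sup>2" using that by (intro power_mono) auto
      also have "(exp (t/2))\<^sup>2 = exp t" by (simp add: exp_double[symmetric])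
      finally have "1 + t + t\<^sup>2/4 \<le> exp t" by (simp add: power2_eq_square algebra_simps)
      moreover have "t * 2 \<le> t\<^sup>2" using False by (simp add: power2_eq_square)
      moreover have "(3::real) \<le> exp 2" using exp_ge_add_one_self[of "2::real"] by simp
      ultimately show ?thesis unfolding exp_rem_def by argo
    qed
    from this[of "?a * norm (Z \<omega>)" for \<omega>] lam
    have "exp (?a * norm (Z \<omega>)) \<le> \<bar>3 * exp_rem (?a * norm (Z \<omega>)) + exp 2\<bar>" for \<omega>
      by (meson abs_ge_self less_imp_le mult_nonneg_nonneg norm_ge_zero order_trans zero_le_numeral)
    then have "norm (exp (?a * norm (Z \<omega>))) \<le> norm (3 * exp_rem (?a * norm (Z \<omega>)) + exp 2)" for \<omega>
      by simp
    then show "AE \<omega> in M. norm (exp (?a * norm (Z \<omega>))) \<le> norm (3 * exp_rem (?a * norm (Z \<omega>)) + exp 2)"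
      by simp
  qed simp
qed

end

section \<open>From one summand to sums of independent variables\<close>

lemma integrable_sum_PiM:
  fixes N :: "'b::{banach,second_countable_topology} measure"
  assumes "prob_space N" "finite I" and int: "integrable N (\<lambda>z. z)"
  shows "integrable (PiM I (\<lambda>_. N)) (\<lambda>\<omega>. \<Sum>i\<in>I. \<omega> i)"
proof (rule Bochner_Integration.integrable_sum)
  interpret N: prob_space N by fact
  interpret product_prob_space "\<lambda>_. N" I ..
  fix i assume i: "i \<in> I"
  have "integrable (distr (PiM I (\<lambda>_. N)) N (\<lambda>\<omega>. \<omega> i)) (\<lambda>z. z)"
    using int by (subst PiM_component[OF i])
  then show "integrable (PiM I (\<lambda>_. N)) (\<lambda>\<omega>. \<omega> i)"
    using i by (subst (asm) integrable_distr_eq) (auto intro: borel_measurable_integrable[OF int])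
qed

text \<open>Induction on the number of summands. Integrating out one coordinate replaces
  \<open>f\<close> by \<open>g s = E f (s + z)\<close>, the conditional expectation given the other
  summands, and \<open>g\<close> is 1-Lipschitz again; each step costs the same \<open>q\<close>.
  The claim is made for all Lipschitz \<open>f\<close> because a norm does not stay a norm under
  this averaging. On a product space the conditional expectations are plain integrals.\<close>

lemma nn_integral_exp_lipschitz_PiM:
  fixes N :: "'b::{banach,second_countable_topology} measure" and f :: "'b \<Rightarrow> real"
    and I :: "'i set" and q :: real
  assumes N: "prob_space N" "sets N = sets borel" and I: "finite I" and lam: "0 < lam"
    and ex: "integrable N (\<lambda>z. exp (2 * lam * norm z))"
    and lip: "\<And>s t. \<bar>f s - f t\<bar> \<le> norm (s - t)"
  defines "q \<equiv> \<integral>z. exp_rem (2 * lam * norm z) \<partial>N"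
  shows "(\<integral>\<^sup>+\<omega>. ennreal (exp (lam * f (\<Sum>i\<in>I. \<omega> i))) \<partial>PiM I (\<lambda>_. N))
      \<le> ennreal (exp (lam * (\<integral>\<omega>. f (\<Sum>i\<in>I. \<omega> i) \<partial>PiM I (\<lambda>_. N)) + card I * q))"
  using I lip
proof (induction I arbitrary: f rule: finite_induct)
  case empty
  interpret P: prob_space "PiM {} (\<lambda>_::'i. N)"
    by (intro prob_space_PiM N)
  show ?case by (simp add: P.prob_space P.emeasure_space_1)
next
  case (insert i I)
  interpret N: prob_space N by fact
  interpret product_prob_space "\<lambda>_::'i. N" I ..
  note [measurable_cong] = N(2)
  have [measurable]: "f \<in> borel_measurable borel"
    by (rule lipschitz_borel_measurable[OF insert.prems])
  have iN: "integrable N (\<lambda>z. z)"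
    using lam by (intro N.integrable_norm_of_exp[OF _ _ ex]) auto
  define g where "g s = (\<integral>z. f (s + z) \<partial>N)" for s
  have iNf: "integrable N (\<lambda>z. f (s + z))" for s
    by (rule N.integrable_lipschitz[OF _ insert.prems]) (use iN in simp)
  have lipg: "\<bar>g s - g t\<bar> \<le> norm (s - t)" for s t
  proof -
    have "g s - g t = (\<integral>z. f (s + z) - f (t + z) \<partial>N)"
      unfolding g_def by (simp add: iNf)
    also have "\<bar>\<dots>\<bar> \<le> (\<integral>z. \<bar>f (s + z) - f (t + z)\<bar> \<partial>N)" by (rule integral_abs_bound)
    also have "\<dots> \<le> (\<integral>z. norm (s - t) \<partial>N)"
    proof (rule integral_mono)
      show "integrable N (\<lambda>z. \<bar>f (s + z) - f (t + z)\<bar>)" using iNf by simp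
      show "\<bar>f (s + z) - f (t + z)\<bar> \<le> norm (s - t)" for z
        using insert.prems[of "s + z" "t + z"] by simp
    qed simp
    finally show ?thesis by (simp add: N.prob_space)
  qed
  have [measurable]: "g \<in> borel_measurable borel"
    by (rule lipschitz_borel_measurable[OF lipg])
  have sum_upd: "(\<Sum>j\<in>insert i I. (fun_upd \<omega> i z) j) = (\<Sum>j\<in>I. \<omega> j) + z" for \<omega> z
  proof -
    have "(\<Sum>j\<in>I. (fun_upd \<omega> i z) j) = (\<Sum>j\<in>I. \<omega> j)"
      using insert.hyps by (intro sum.cong) auto
    then show ?thesis using insert.hyps by (simp add: add.commute)
  qed
  have "(\<integral>\<^sup>+\<omega>. ennreal (exp (lam * f (\<Sum>j\<in>insert i I. \<omega> j))) \<partial>PiM (insert i I) (\<lambda>_. N))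
     = (\<integral>\<^sup>+\<omega>. (\<integral>\<^sup>+z. ennreal (exp (lam * f ((\<Sum>j\<in>I. \<omega> j) + z))) \<partial>N) \<partial>PiM I (\<lambda>_. N))"
    by (subst product_nn_integral_insert[OF insert.hyps]) (simp_all only: sum_upd, measurable)
  also have "\<dots> \<le> (\<integral>\<^sup>+\<omega>. ennreal (exp (lam * g (\<Sum>j\<in>I. \<omega> j) + q)) \<partial>PiM I (\<lambda>_. N))"
    unfolding g_def q_def
    by (intro nn_integral_mono N.nn_integral_exp_lipschitz insert.prems lam ex) simp
  also have "\<dots> = (\<integral>\<^sup>+\<omega>. ennreal (exp q) * ennreal (exp (lam * g (\<Sum>j\<in>I. \<omega> j))) \<partial>PiM I (\<lambda>_. N))"
    by (intro nn_integral_cong) (simp add: ennreal_mult[symmetric] exp_add)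
  also have "\<dots> = ennreal (exp q) * (\<integral>\<^sup>+\<omega>. ennreal (exp (lam * g (\<Sum>j\<in>I. \<omega> j))) \<partial>PiM I (\<lambda>_. N))"
    by (intro nn_integral_cmult) measurable
  also have "\<dots> \<le> ennreal (exp q) * ennreal (exp (lam * (\<integral>\<omega>. g (\<Sum>j\<in>I. \<omega> j) \<partial>PiM I (\<lambda>_. N)) + card I * q))"
    by (intro mult_left_mono insert.IH lipg) simp
  also have "(\<integral>\<omega>. g (\<Sum>j\<in>I. \<omega> j) \<partial>PiM I (\<lambda>_. N))
      = (\<integral>\<omega>. f (\<Sum>j\<in>insert i I. \<omega> j) \<partial>PiM (insert i I) (\<lambda>_. N))"
  proof -
    interpret J: product_prob_space "\<lambda>_::'i. N" "insert i I" ..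
    have "integrable (PiM (insert i I) (\<lambda>_. N)) (\<lambda>\<omega>. f (\<Sum>j\<in>insert i I. \<omega> j))"
      using insert.hyps iN N
      by (intro J.P.integrable_lipschitz[OF _ insert.prems] integrable_sum_PiM) auto
    from product_integral_insert[OF insert.hyps this] show ?thesis
      by (simp only: sum_upd g_def)
  qed
  finally show ?case
    using insert.hyps by (simp add: ennreal_mult[symmetric] exp_add[symmetric] algebra_simps)
qed

text \<open>Chernoff's bound, after carrying the joint law of the summands over to a product
  measure. The function \<open>f\<close> is kept general because two cases are needed:
  \<open>norm\<close> for the score sum, and \<open>uminus\<close> on the reals for the lower tail
  of the number of observations in a ball. The parameter \<open>lam\<close> is left to be tuned in
  each case.\<close>

lemma (in prob_space) bernstein_lipschitz_tail:
  fixes Z :: "'i \<Rightarrow> 'a \<Rightarrow> 'b::{banach,second_countable_topology}" and f :: "'b \<Rightarrow> real"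
  assumes I: "finite I" "I \<noteq> {}" and indep: "indep_vars (\<lambda>_. borel) Z I"
    and law: "\<And>i. i \<in> I \<Longrightarrow> distr M borel (Z i) = N"
    and p: "0 \<le> p" and s: "0 \<le> s" and lam: "0 < lam" "2 * lam * s < 1"
    and mom: "\<And>k. k \<ge> 2 \<Longrightarrow> (\<integral>\<^sup>+z. ennreal (norm z ^ k) \<partial>N) \<le> ennreal (p * (fact k / 2 * s ^ k))"
    and lip: "\<And>s t. \<bar>f s - f t\<bar> \<le> norm (s - t)"
  shows "integrable M (\<lambda>\<omega>. f (\<Sum>i\<in>I. Z i \<omega>))"
    and "prob {\<omega> \<in> space M. f (\<Sum>i\<in>I. Z i \<omega>) \<ge> expectation (\<lambda>\<omega>. f (\<Sum>i\<in>I. Z i \<omega>)) + t}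
      \<le> exp (- lam * t + card I * (2 * p * (lam * s)\<^sup>2 / (1 - 2 * lam * s)))"
proof -
  have Z[measurable]: "i \<in> I \<Longrightarrow> Z i \<in> borel_measurable M" for i
    using indep by (auto simp: indep_vars_def)
  obtain j where j: "j \<in> I" using I by auto
  have N: "prob_space N" "sets N = sets borel"
    using law[OF j] prob_space_distr[OF Z[OF j]] by auto
  interpret N: prob_space N by fact
  interpret J: product_prob_space "\<lambda>_. N" I ..
  note [measurable_cong] = N(2)
  have [measurable]: "f \<in> borel_measurable borel"
    by (rule lipschitz_borel_measurable[OF lip])
  let ?Q = "2 * p * (lam * s)\<^sup>2 / (1 - 2 * lam * s)"
  note B = N.bernstein_exp_rem[of "\<lambda>z. z", OF _ p s lam mom]
  have ex: "integrable N (\<lambda>z. exp (2 * lam * norm z))" by (rule B(1)) simp_all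
  have q: "(\<integral>z. exp_rem (2 * lam * norm z) \<partial>N) \<le> ?Q" by (rule B(2)) simp_all
  have iN: "integrable N (\<lambda>z. z)"
    using lam by (intro N.integrable_norm_of_exp[OF _ _ ex]) auto
  have joint: "distr M (PiM I (\<lambda>_. borel)) (\<lambda>\<omega>. \<lambda>i\<in>I. Z i \<omega>) = PiM I (\<lambda>_. N)"
    using indep_vars_iff_distr_eq_PiM'[THEN iffD1, OF I(2) Z indep]
    by (simp add: law cong: PiM_cong)
  have [measurable]: "(\<lambda>\<omega>. \<lambda>i\<in>I. Z i \<omega>) \<in> M \<rightarrow>\<^sub>M PiM I (\<lambda>_. borel)"
    by (intro measurable_restrict Z)
  have iP: "integrable (PiM I (\<lambda>_. N)) (\<lambda>\<omega>. f (\<Sum>i\<in>I. \<omega> i))"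
    using I iN N by (intro J.P.integrable_lipschitz[OF _ lip] integrable_sum_PiM) auto
  then show iM: "integrable M (\<lambda>\<omega>. f (\<Sum>i\<in>I. Z i \<omega>))"
    unfolding joint[symmetric] by (subst (asm) integrable_distr_eq) simp_all
  let ?E = "expectation (\<lambda>\<omega>. f (\<Sum>i\<in>I. Z i \<omega>))"
  have E: "(\<integral>\<omega>. f (\<Sum>i\<in>I. \<omega> i) \<partial>PiM I (\<lambda>_. N)) = ?E"
    unfolding joint[symmetric] by (subst integral_distr) simp_all
  have "(\<integral>\<^sup>+\<omega>. ennreal (exp (lam * f (\<Sum>i\<in>I. Z i \<omega>))) \<partial>M)
      = (\<integral>\<^sup>+\<omega>. ennreal (exp (lam * f (\<Sum>i\<in>I. \<omega> i))) \<partial>PiM I (\<lambda>_. N))"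
    unfolding joint[symmetric] by (subst nn_integral_distr) simp_all
  also have "\<dots> \<le> ennreal (exp (lam * ?E + card I * (\<integral>z. exp_rem (2 * lam * norm z) \<partial>N)))"
    unfolding E[symmetric] by (rule nn_integral_exp_lipschitz_PiM[OF N I(1) lam(1) ex lip])
  also have "\<dots> \<le> ennreal (exp (lam * ?E + card I * ?Q))"
    using mult_left_mono[OF q, of "real (card I)"] by (intro ennreal_leI) simp
  finally have mgf: "(\<integral>\<^sup>+\<omega>. ennreal (exp (lam * f (\<Sum>i\<in>I. Z i \<omega>))) \<partial>M)
      \<le> ennreal (exp (lam * ?E + card I * ?Q))" .
  let ?A = "{\<omega> \<in> space M. f (\<Sum>i\<in>I. Z i \<omega>) \<ge> ?E + t}"
  let ?c = "exp (- lam * (?E + t))"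
  have "emeasure M ?A \<le> (\<integral>\<^sup>+\<omega>. ennreal ?c * ennreal (exp (lam * f (\<Sum>i\<in>I. Z i \<omega>))) \<partial>M)"
  proof -
    have "emeasure M ?A = (\<integral>\<^sup>+\<omega>. indicator ?A \<omega> \<partial>M)" by simp
    also have "\<dots> \<le> (\<integral>\<^sup>+\<omega>. ennreal ?c * ennreal (exp (lam * f (\<Sum>i\<in>I. Z i \<omega>))) \<partial>M)"
    proof (rule nn_integral_mono)
      fix \<omega>
      have "1 \<le> ?c * exp (lam * f (\<Sum>i\<in>I. Z i \<omega>))" if "\<omega> \<in> ?A"
        using that lam by (simp add: exp_add[symmetric] mult_left_mono)
      then show "indicator ?A \<omega> \<le> ennreal ?c * ennreal (exp (lam * f (\<Sum>i\<in>I. Z i \<omega>)))"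
        by (auto simp: ennreal_mult[symmetric] indicator_def simp flip: ennreal_1 intro!: ennreal_leI)
    qed
    finally show ?thesis .
  qed
  also have "\<dots> = ennreal ?c * (\<integral>\<^sup>+\<omega>. ennreal (exp (lam * f (\<Sum>i\<in>I. Z i \<omega>))) \<partial>M)"
    by (intro nn_integral_cmult) simp
  also have "\<dots> \<le> ennreal ?c * ennreal (exp (lam * ?E + card I * ?Q))"
    by (rule mult_left_mono[OF mgf]) simp
  also have "\<dots> = ennreal (exp (- lam * t + card I * ?Q))"
    by (simp add: ennreal_mult[symmetric] exp_add[symmetric] algebra_simps)
  finally show "prob ?A \<le> exp (- lam * t + card I * ?Q)"
    by (simp add: emeasure_eq_measure)
qed

section \<open>Type 2 and disintegration\<close>

text \<open>\<open>type_two\<close> speaks of measures on \<open>nat \<Rightarrow> 'b\<close>, the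
  sample lives on \<open>'w\<close>. The tuple of summands pushes the measure forward to that space,
  where the coordinates have the same joint law, and all quantities involved depend on this law
  alone. The constant is fixed before the probability space.\<close>

lemma type_two_sum:
  assumes "type_two TYPE('b::{banach,second_countable_topology})"
  obtains c0 where "c0 > 0"
    "\<And>(M :: 'w measure) (Z :: nat \<Rightarrow> 'w \<Rightarrow> 'b) n. prob_space M \<Longrightarrow>
      prob_space.indep_vars M (\<lambda>_. borel) Z {1..n} \<Longrightarrow>
      (\<And>i. i \<in> {1..n} \<Longrightarrow> integrable M (\<lambda>\<omega>. (norm (Z i \<omega>))\<^sup>2)) \<Longrightarrow>
      (\<And>i. i \<in> {1..n} \<Longrightarrow> (\<integral>\<omega>. Z i \<omega> \<partial>M) = 0) \<Longrightarrow>
      (\<integral>\<omega>. (norm (\<Sum>i=1..n. Z i \<omega>))\<^sup>2 \<partial>M) \<le> c0 * (\<Sum>i=1..n. (\<integral>\<omega>. (norm (Z i \<omega>))\<^sup>2 \<partial>M))"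
proof -
  obtain c0 where c0: "c0 > 0" and T: "\<And>(n::nat) (P :: (nat \<Rightarrow> 'b) measure) (Z :: nat \<Rightarrow> (nat \<Rightarrow> 'b) \<Rightarrow> 'b).
     prob_space P \<Longrightarrow> prob_space.indep_vars P (\<lambda>_. borel) Z {1..n} \<Longrightarrow>
     (\<forall>i\<in>{1..n}. integrable P (\<lambda>\<omega>. (norm (Z i \<omega>))\<^sup>2) \<and> (\<integral>\<omega>. Z i \<omega> \<partial>P) = 0) \<Longrightarrow>
     (\<integral>\<omega>. (norm (\<Sum>i=1..n. Z i \<omega>))\<^sup>2 \<partial>P) \<le> c0 * (\<Sum>i=1..n. (\<integral>\<omega>. (norm (Z i \<omega>))\<^sup>2 \<partial>P))"
    using assms unfolding type_two_def by blast
  show thesis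
  proof (rule that[OF c0])
    fix M :: "'w measure" and Z :: "nat \<Rightarrow> 'w \<Rightarrow> 'b" and n :: nat
    assume M: "prob_space M" and indep: "prob_space.indep_vars M (\<lambda>_. borel) Z {1..n}"
      and int: "\<And>i. i \<in> {1..n} \<Longrightarrow> integrable M (\<lambda>\<omega>. (norm (Z i \<omega>))\<^sup>2)"
      and mean: "\<And>i. i \<in> {1..n} \<Longrightarrow> (\<integral>\<omega>. Z i \<omega> \<partial>M) = 0"
    interpret prob_space M by fact
    show "(\<integral>\<omega>. (norm (\<Sum>i=1..n. Z i \<omega>))\<^sup>2 \<partial>M) \<le> c0 * (\<Sum>i=1..n. (\<integral>\<omega>. (norm (Z i \<omega>))\<^sup>2 \<partial>M))"
    proof (cases "n = 0")
      case False
      define I where "I = {1..n}"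
      have I: "I \<noteq> {}" "finite I" using False by (auto simp: I_def)
      have Z[measurable]: "i \<in> I \<Longrightarrow> Z i \<in> borel_measurable M" for i
        using indep by (auto simp: indep_vars_def I_def)
      have tup[measurable]: "(\<lambda>\<omega>. \<lambda>i\<in>I. Z i \<omega>) \<in> M \<rightarrow>\<^sub>M PiM I (\<lambda>_. borel)"
        by (intro measurable_restrict Z)
      define P where "P = distr M (PiM I (\<lambda>_. borel :: 'b measure)) (\<lambda>\<omega>. \<lambda>i\<in>I. Z i \<omega>)"
      have [measurable_cong]: "sets P = sets (PiM I (\<lambda>_. borel))" by (simp add: P_def)
      interpret P: prob_space P unfolding P_def by (rule prob_space_distr) simp
      have coord: "distr P borel (\<lambda>\<omega>. \<omega> i) = distr M borel (Z i)" if "i \<in> I" for i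
        unfolding P_def using that
        by (subst distr_distr) (auto intro!: distr_cong simp: comp_def)
      have "P.indep_vars (\<lambda>_. borel) (\<lambda>i \<omega>. \<omega> i) I"
      proof (subst P.indep_vars_iff_distr_eq_PiM'[OF I(1)])
        show "(\<lambda>\<omega>. \<omega> i) \<in> borel_measurable P" if "i \<in> I" for i using that by simp
        \<comment> \<open>Points of the product space are already \<open>undefined\<close> outside
          \<open>I\<close>, so restricting them to \<open>I\<close> changes nothing.\<close>
        have "distr P (PiM I (\<lambda>_. borel)) (\<lambda>\<omega>. \<lambda>i\<in>I. \<omega> i) = P"
        proof -
          have "distr P (PiM I (\<lambda>_. borel)) (\<lambda>\<omega>. \<lambda>i\<in>I. \<omega> i) = distr P P (\<lambda>\<omega>. \<omega>)"
            by (rule distr_cong) (auto simp: P_def space_PiM)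
          then show ?thesis by simp
        qed
        also have "P = PiM I (\<lambda>i. distr M borel (Z i))"
          using indep_vars_iff_distr_eq_PiM'[THEN iffD1, OF I(1) Z indep[folded I_def]]
          by (simp add: P_def)
        also have "\<dots> = PiM I (\<lambda>i. distr P borel (\<lambda>\<omega>. \<omega> i))"
          by (rule PiM_cong) (simp_all add: coord)
        finally show "distr P (PiM I (\<lambda>_. borel)) (\<lambda>\<omega>. \<lambda>i\<in>I. \<omega> i) = PiM I (\<lambda>i. distr P borel (\<lambda>\<omega>. \<omega> i))" .
      qed
      moreover have "integrable P (\<lambda>\<omega>. (norm (\<omega> i))\<^sup>2) \<and> (\<integral>\<omega>. \<omega> i \<partial>P) = 0" if "i \<in> I" for i
        using that int[of i] mean[of i] unfolding P_def
        by (auto simp: integrable_distr_eq integral_distr I_def)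
      ultimately have "(\<integral>\<omega>. (norm (\<Sum>i\<in>I. \<omega> i))\<^sup>2 \<partial>P) \<le> c0 * (\<Sum>i\<in>I. (\<integral>\<omega>. (norm (\<omega> i))\<^sup>2 \<partial>P))"
        using T[OF P.prob_space_axioms, of "\<lambda>i \<omega>. \<omega> i" n] by (simp add: I_def)
      also have "(\<integral>\<omega>. (norm (\<Sum>i\<in>I. \<omega> i))\<^sup>2 \<partial>P) = (\<integral>\<omega>. (norm (\<Sum>i\<in>I. Z i \<omega>))\<^sup>2 \<partial>M)"
        unfolding P_def by (subst integral_distr) simp_all
      also have "(\<Sum>i\<in>I. (\<integral>\<omega>. (norm (\<omega> i))\<^sup>2 \<partial>P)) = (\<Sum>i\<in>I. (\<integral>\<omega>. (norm (Z i \<omega>))\<^sup>2 \<partial>M))"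
        unfolding P_def by (intro sum.cong) (auto simp: integral_distr)
      finally show ?thesis by (simp add: I_def)
    qed simp
  qed
qed

text \<open>The tower property for Banach-valued integrands, by approximation with simple functions.
  An integrand that is integrable for the mixture is integrable for almost every \<open>N x\<close>
  only; elsewhere the inner integral has the value 0, which is harmless on a null set. Hence the
  additive and the limit case argue almost everywhere.\<close>

lemma (in prob_space) integral_bind:
  fixes f :: "'b \<Rightarrow> 'e::{banach,second_countable_topology}"
  assumes N[measurable]: "N \<in> M \<rightarrow>\<^sub>M subprob_algebra B" and f: "integrable (M \<bind> N) f"
  shows "(\<integral>y. f y \<partial>(M \<bind> N)) = (\<integral>x. \<integral>y. f y \<partial>N x \<partial>M)"
proof -
  have sp: "subprob_space (N x)" and sN: "sets (N x) = sets B" if "x \<in> space M" for x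
    using measurable_space[OF N that] by (auto simp: space_subprob_algebra)
  have sB: "sets (M \<bind> N) = sets B" by (rule sets_bind[OF sN not_empty])
  note [measurable_cong] = sB
  have AEint: "AE x in M. integrable (N x) g" if g: "integrable (M \<bind> N) g"
    for g :: "'b \<Rightarrow> 'e"
  proof -
    have [measurable]: "g \<in> borel_measurable B" using g sB by (simp cong: measurable_cong_sets)
    have "(\<integral>\<^sup>+x. \<integral>\<^sup>+y. norm (g y) \<partial>N x \<partial>M) < \<infinity>"
      using g by (subst nn_integral_bind[where B = B, symmetric]) (auto simp: integrable_iff_bounded)
    then have "AE x in M. (\<integral>\<^sup>+y. norm (g y) \<partial>N x) \<noteq> \<infinity>"
      by (intro nn_integral_PInf_AE) (auto intro: measurable_compose[OF N])
    moreover have "AE x in M. g \<in> borel_measurable (N x)"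
      by (rule AE_I2) (simp add: sN cong: measurable_cong_sets)
    ultimately show ?thesis
      by eventually_elim (auto simp: integrable_iff_bounded top.not_eq_extremum)
  qed
  \<comment> \<open>Twice this function of \<open>x\<close> is the dominating function for the outer
    integral in the limit case.\<close>
  have outer: "integrable M (\<lambda>x. \<integral>y. norm (g y) \<partial>N x)" if g: "integrable (M \<bind> N) g"
    for g :: "'b \<Rightarrow> 'e"
  proof (rule integrableI_bounded)
    have [measurable]: "g \<in> borel_measurable B" using g sB by (simp cong: measurable_cong_sets)
    show "(\<lambda>x. \<integral>y. norm (g y) \<partial>N x) \<in> borel_measurable M"
      by (rule measurable_compose[OF N]) measurable
    have "(\<integral>\<^sup>+x. norm (\<integral>y. norm (g y) \<partial>N x) \<partial>M) \<le> (\<integral>\<^sup>+x. \<integral>\<^sup>+y. norm (g y) \<partial>N x \<partial>M)"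
      using AEint[OF g]
      by (intro nn_integral_mono_AE) (auto elim!: eventually_mono simp: nn_integral_eq_integral)
    also have "\<dots> < \<infinity>"
      using g by (subst nn_integral_bind[where B = B, symmetric]) (auto simp: integrable_iff_bounded)
    finally show "(\<integral>\<^sup>+x. norm (\<integral>y. norm (g y) \<partial>N x) \<partial>M) < \<infinity>" .
  qed
  have meas: "(\<lambda>x. \<integral>y. g y \<partial>N x) \<in> borel_measurable M" if "integrable (M \<bind> N) g" for g :: "'b \<Rightarrow> 'e"
  proof -
    have [measurable]: "g \<in> borel_measurable B" using that sB by (simp cong: measurable_cong_sets)
    show ?thesis by (rule measurable_compose[OF N]) measurable
  qed
  have inner: "integrable M (\<lambda>x. \<integral>y. g y \<partial>N x)" if "integrable (M \<bind> N) g" for g :: "'b \<Rightarrow> 'e"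
    by (rule Bochner_Integration.integrable_bound[OF outer[OF that] meas[OF that]]) simp
  show ?thesis
    using f
  proof (induct rule: integrable_induct)
    case (base A c)
    then have A: "A \<in> sets B" by (simp add: sB)
    have m: "measure (M \<bind> N) A = (\<integral>x. measure (N x) A \<partial>M)"
      by (rule measure_bind[OF N A])
    have b: "integrable M (\<lambda>x. measure (N x) A)"
      using A sp
      by (intro integrable_const_bound[where B=1] AE_I2) (auto intro: subprob_space.subprob_measure_le_1)
    have "(\<integral>y. indicator A y *\<^sub>R c \<partial>N x) = measure (N x) A *\<^sub>R c" if "x \<in> space M" for x
    proof -
      interpret subprob_space "N x" by (rule sp[OF that])
      show ?thesis using A sN[OF that] sets.sets_into_space[of A "N x"]
        by (simp add: emeasure_eq_measure Int_absorb2)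
    qed
    then have "(\<integral>x. (\<integral>y. indicator A y *\<^sub>R c \<partial>N x) \<partial>M) = (\<integral>x. measure (N x) A *\<^sub>R c \<partial>M)"
      by (intro Bochner_Integration.integral_cong) auto
    then show ?case
      using base b A m sets.sets_into_space[OF base(1)] by (simp add: Int_absorb2)
  next
    case (add f g)
    have "AE x in M. (\<integral>y. f y + g y \<partial>N x) = (\<integral>y. f y \<partial>N x) + (\<integral>y. g y \<partial>N x)"
      using AEint[OF add(1)] AEint[OF add(3)] by eventually_elim simp
    then have "(\<integral>x. (\<integral>y. f y + g y \<partial>N x) \<partial>M) = (\<integral>x. (\<integral>y. f y \<partial>N x) + (\<integral>y. g y \<partial>N x) \<partial>M)"
      using meas[OF add(1)] meas[OF add(3)] meas[OF Bochner_Integration.integrable_add[OF add(1,3)]]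
      by (intro integral_cong_AE) auto
    then show ?case using add inner by simp
  next
    case (lim f s)
    have [measurable]: "f \<in> borel_measurable B" "\<And>i. s i \<in> borel_measurable B"
      using lim(1,5) sB by (auto cong: measurable_cong_sets)
    have spB: "space (M \<bind> N) = space B" using sB by (rule sets_eq_imp_space_eq)
    have "(\<lambda>i. \<integral>y. s i y \<partial>(M \<bind> N)) \<longlonglongrightarrow> (\<integral>y. f y \<partial>(M \<bind> N))"
    proof (rule integral_dominated_convergence)
      show "integrable (M \<bind> N) (\<lambda>y. 2 * norm (f y))" using lim by simp
      show "AE y in M \<bind> N. (\<lambda>i. s i y) \<longlonglongrightarrow> f y" using lim by auto
      show "AE y in M \<bind> N. norm (s i y) \<le> 2 * norm (f y)" for i using lim by auto
    qed auto
    moreover have "(\<lambda>i. \<integral>x. (\<integral>y. s i y \<partial>N x) \<partial>M) \<longlonglongrightarrow> (\<integral>x. (\<integral>y. f y \<partial>N x) \<partial>M)"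
    proof (rule integral_dominated_convergence)
      show "(\<lambda>x. \<integral>y. f y \<partial>N x) \<in> borel_measurable M" by (rule meas[OF lim(5)])
      show "(\<lambda>x. \<integral>y. s i y \<partial>N x) \<in> borel_measurable M" for i by (rule meas[OF lim(1)])
      show "integrable M (\<lambda>x. 2 * (\<integral>y. norm (f y) \<partial>N x))" using outer[OF lim(5)] by simp
      show "AE x in M. (\<lambda>i. \<integral>y. s i y \<partial>N x) \<longlonglongrightarrow> (\<integral>y. f y \<partial>N x)"
        using AEint[OF lim(5)] AE_space
      proof eventually_elim
        case (elim x)
        have sx: "space (N x) = space B" using sN[OF elim(2)] by (rule sets_eq_imp_space_eq)
        note [measurable_cong] = sN[OF elim(2)]
        show ?case
        proof (rule integral_dominated_convergence)
          show "integrable (N x) (\<lambda>y. 2 * norm (f y))" using elim by simp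
          show "AE y in N x. (\<lambda>i. s i y) \<longlonglongrightarrow> f y" using lim sx spB by auto
          show "AE y in N x. norm (s i y) \<le> 2 * norm (f y)" for i using lim sx spB by auto
          show "f \<in> borel_measurable (N x)" "s i \<in> borel_measurable (N x)" for i
            by (simp_all add: measurable_cong_sets[OF sN[OF elim(2)] refl])
        qed
      qed
      show "AE x in M. norm (\<integral>y. s i y \<partial>N x) \<le> 2 * (\<integral>y. norm (f y) \<partial>N x)" for i
        using AEint[OF lim(5)] AEint[OF lim(1)[of i]] AE_space
      proof eventually_elim
        case (elim x)
        have sx: "space (N x) = space B" using sN[OF elim(3)] by (rule sets_eq_imp_space_eq)
        have "norm (\<integral>y. s i y \<partial>N x) \<le> (\<integral>y. 2 * norm (f y) \<partial>N x)"
          using elim lim(4) sx spB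
          by (intro order_trans[OF integral_norm_bound] integral_mono) auto
        then show ?case by simp
      qed
    qed
    ultimately show ?case
      using lim(2) by (simp add: LIMSEQ_unique)
  qed
qed

text \<open>The product of the point mass at \<open>z\<close> with \<open>\<kappa> z\<close>. As a
  kernel into the pairs it turns the joint law of covariate and response into a \<open>bind\<close>,
  so that iterated integration becomes available.\<close>

definition joint_kernel :: "'r measure \<Rightarrow> ('c::topological_space \<Rightarrow> 'r measure) \<Rightarrow> 'c \<Rightarrow> ('c \<times> 'r) measure" where
  "joint_kernel R \<kappa> z = distr (\<kappa> z) (borel \<Otimes>\<^sub>M R) (Pair z)"

lemma measurable_joint_kernel:
  assumes \<kappa>: "\<kappa> \<in> borel \<rightarrow>\<^sub>M prob_algebra R"
  shows "joint_kernel R \<kappa> \<in> borel \<rightarrow>\<^sub>M subprob_algebra (borel \<Otimes>\<^sub>M R)"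
  unfolding joint_kernel_def[abs_def]
  by (rule measurable_distr2[OF _ measurable_prob_algebraD[OF \<kappa>]]) simp

text \<open>On measurable rectangles the identity is the defining property of a regular conditional
  distribution, and rectangles are an intersection-stable generator of the product algebra.\<close>

lemma (in prob_space) distr_pair_eq_bind:
  fixes X :: "'a \<Rightarrow> 'c::topological_space"
  assumes XY: "(\<lambda>\<omega>. (X \<omega>, Y \<omega>)) \<in> M \<rightarrow>\<^sub>M borel \<Otimes>\<^sub>M R" and rcd: "regular_cond_distr M X R Y \<kappa>"
  shows "distr M (borel \<Otimes>\<^sub>M R) (\<lambda>\<omega>. (X \<omega>, Y \<omega>)) = distr M borel X \<bind> joint_kernel R \<kappa>"
proof -
  have X[measurable]: "X \<in> borel_measurable M"
    using measurable_compose[OF XY measurable_fst] by simp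
  have Y[measurable]: "Y \<in> M \<rightarrow>\<^sub>M R"
    using measurable_compose[OF XY measurable_snd] by simp
  have \<kappa>: "\<kappa> \<in> borel \<rightarrow>\<^sub>M prob_algebra R" using rcd by (simp add: regular_cond_distr_def)
  have \<kappa>z: "prob_space (\<kappa> z)" "sets (\<kappa> z) = sets R" for z
    using measurable_space[OF \<kappa>, of z] by (auto simp: space_prob_algebra)
  let ?\<mu> = "distr M borel X"
  interpret \<mu>: prob_space ?\<mu> by (rule prob_space_distr) simp
  have J: "joint_kernel R \<kappa> \<in> ?\<mu> \<rightarrow>\<^sub>M subprob_algebra (borel \<Otimes>\<^sub>M R)"
    using measurable_joint_kernel[OF \<kappa>] by simp
  let ?E = "{A \<times> B | A B. A \<in> sets (borel :: 'c measure) \<and> B \<in> sets R}"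
  let ?D = "distr M (borel \<Otimes>\<^sub>M R) (\<lambda>\<omega>. (X \<omega>, Y \<omega>))"
  interpret D: prob_space ?D by (rule prob_space_distr[OF XY])
  show ?thesis
  proof (rule measure_eqI_generator_eq[where E = ?E and \<Omega> = "UNIV \<times> space R" and A = "\<lambda>_. UNIV \<times> space R"])
    show "Int_stable ?E" by (rule Int_stable_pair_measure_generator)
    show "?E \<subseteq> Pow (UNIV \<times> space R)" using sets.sets_into_space by blast
    show "sets ?D = sigma_sets (UNIV \<times> space R) ?E"
      by (simp add: sets_pair_measure)
    show "sets (?\<mu> \<bind> joint_kernel R \<kappa>) = sigma_sets (UNIV \<times> space R) ?E"
      by (subst sets_bind_measurable[OF J]) (simp_all add: sets_pair_measure)
    show "range (\<lambda>_::nat. UNIV \<times> space R) \<subseteq> ?E"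
      by (intro image_subsetI CollectI exI[of _ "UNIV :: 'c set"] exI[of _ "space R"]) simp
    show "emeasure ?D (UNIV \<times> space R) \<noteq> \<infinity>" for i :: nat by simp
    show "(\<Union>_::nat. UNIV \<times> space R) = UNIV \<times> space R" by auto
    fix C assume "C \<in> ?E"
    then obtain A B where C: "C = A \<times> B" and A[measurable]: "A \<in> sets borel" and B[measurable]: "B \<in> sets R" by blast
    have "emeasure ?D C = emeasure M {\<omega> \<in> space M. X \<omega> \<in> A \<and> Y \<omega> \<in> B}"
      using XY by (subst emeasure_distr) (auto simp: C intro!: arg_cong[where f = "emeasure M"])
    also have "\<dots> = (\<integral>\<^sup>+ z \<in> A. emeasure (\<kappa> z) B \<partial>?\<mu>)"
      using rcd by (simp add: regular_cond_distr_def)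
    also have "\<dots> = (\<integral>\<^sup>+ z. emeasure (joint_kernel R \<kappa> z) C \<partial>?\<mu>)"
    proof (rule nn_integral_cong)
      fix z
      have [measurable_cong]: "sets (\<kappa> z) = sets R" by (rule \<kappa>z)
      have "emeasure (joint_kernel R \<kappa> z) C = emeasure (\<kappa> z) (Pair z -` C \<inter> space (\<kappa> z))"
        unfolding joint_kernel_def by (rule emeasure_distr) (simp_all add: C)
      also have "Pair z -` C \<inter> space (\<kappa> z) = (if z \<in> A then B else {})"
        using sets.sets_into_space[OF B] sets_eq_imp_space_eq[OF \<kappa>z(2)] by (auto simp: C)
      finally show "emeasure (\<kappa> z) B * indicator A z = emeasure (joint_kernel R \<kappa> z) C"
        by (simp split: split_indicator)
    qed
    also have "\<dots> = emeasure (?\<mu> \<bind> joint_kernel R \<kappa>) C"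
      by (rule emeasure_bind[OF _ J, symmetric]) (simp_all add: C)
    finally show "emeasure ?D C = emeasure (?\<mu> \<bind> joint_kernel R \<kappa>) C" .
  qed
qed

section \<open>Concentration of the kernel sums\<close>

text \<open>The unspecified neighbourhood of the moment hypothesis is replaced by a closed ball of
  radius \<open>h0\<close>, so that \<open>h \<le> h0\<close> is all a bandwidth has to satisfy. The
  general claim uses the setting with the given \<L> and \<open>G\<close>, the conditional-mean
  claim with the identity and \<Psi>.\<close>

locale local_sample = prob_space M
  for M :: "'w measure" +
  fixes R :: "'r measure"
    and X :: "'w \<Rightarrow> 'c::polish_space" and Y :: "'w \<Rightarrow> 'r"
    and Xs :: "nat \<Rightarrow> 'w \<Rightarrow> 'c" and Ys :: "nat \<Rightarrow> 'w \<Rightarrow> 'r"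
    and \<kappa> :: "'c \<Rightarrow> 'r measure" and x :: 'c
    and K :: "real \<Rightarrow> real" and l L \<sigma> h0 :: real
    and \<L> :: "'g::{banach,second_countable_topology} \<Rightarrow> 'b::{banach,second_countable_topology}"
    and G :: "'r \<Rightarrow> 'g"
  assumes XY: "(\<lambda>\<omega>. (X \<omega>, Y \<omega>)) \<in> M \<rightarrow>\<^sub>M borel \<Otimes>\<^sub>M R"
    and indep: "indep_vars (\<lambda>_. borel \<Otimes>\<^sub>M R) (\<lambda>i \<omega>. (Xs i \<omega>, Ys i \<omega>)) {1..}"
    and copies: "\<And>i. i \<ge> 1 \<Longrightarrow> distr M (borel \<Otimes>\<^sub>M R) (\<lambda>\<omega>. (Xs i \<omega>, Ys i \<omega>)) =
                                    distr M (borel \<Otimes>\<^sub>M R) (\<lambda>\<omega>. (X \<omega>, Y \<omega>))"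
    and rcd: "regular_cond_distr M X R Y \<kappa>"
    and K_meas: "K \<in> borel_measurable (restrict_space borel {0..})"
    and K_nonneg: "\<And>u. u \<ge> 0 \<Longrightarrow> K u \<ge> 0"
    and lL: "0 < l" "l \<le> L"
    and K_bounds: "\<And>u. 0 \<le> u \<Longrightarrow> u \<le> 1 \<Longrightarrow> l \<le> K u \<and> K u \<le> L"
    and K_zero: "\<And>u. u > 1 \<Longrightarrow> K u = 0"
    and \<sigma>: "\<sigma> > 0" and h0: "h0 > 0"
    and lin: "bounded_linear \<L>" and G_meas: "G \<in> borel_measurable R"
    and cond_integrable: "\<And>z. dist x z \<le> h0 \<Longrightarrow> integrable (\<kappa> z) G"
    and cond_moment: "\<And>z k. dist x z \<le> h0 \<Longrightarrow> k \<ge> 2 \<Longrightarrow>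
      (\<integral>\<^sup>+ y. ennreal (norm (\<L> (G y - (\<integral>y'. G y' \<partial>\<kappa> z))) ^ k) \<partial>\<kappa> z) \<le> ennreal (fact k / 2 * \<sigma> ^ k)"
begin

definition phi :: "real \<Rightarrow> real" where "phi = small_ball_prob M X x"

definition noise :: "'c \<Rightarrow> 'r \<Rightarrow> 'b" where
  "noise z y = \<L> (G y - (\<integral>y'. G y' \<partial>\<kappa> z))"

definition weight :: "real \<Rightarrow> 'c \<Rightarrow> real" where
  "weight h z = K (inverse h * dist x z)"

definition score :: "real \<Rightarrow> 'c \<times> 'r \<Rightarrow> 'b" where
  "score h p = weight h (fst p) *\<^sub>R noise (fst p) (snd p)"

definition score_sum :: "nat \<Rightarrow> real \<Rightarrow> 'w \<Rightarrow> 'b" where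
  "score_sum n h \<omega> = (\<Sum>i=1..n. score h (Xs i \<omega>, Ys i \<omega>))"

definition hits :: "nat \<Rightarrow> real \<Rightarrow> 'w \<Rightarrow> real" where
  "hits n h \<omega> = (\<Sum>i=1..n. of_bool (dist x (Xs i \<omega>) \<le> h))"

abbreviation "obs_law \<equiv> distr M (borel \<Otimes>\<^sub>M R) (\<lambda>\<omega>. (X \<omega>, Y \<omega>))"

lemma L_pos: "0 < L" using lL by simp

lemma kernel_meas: "\<kappa> \<in> borel \<rightarrow>\<^sub>M prob_algebra R"
  using rcd by (simp add: regular_cond_distr_def)

lemma prob_kernel: "prob_space (\<kappa> z)" and sets_kernel_eq: "sets (\<kappa> z) = sets R"
  using measurable_space[OF kernel_meas, of z] by (auto simp: space_prob_algebra)

lemma X_meas[measurable]: "X \<in> borel_measurable M"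
  using measurable_compose[OF XY measurable_fst] by simp

lemma sample_meas: "i \<ge> 1 \<Longrightarrow> (\<lambda>\<omega>. (Xs i \<omega>, Ys i \<omega>)) \<in> M \<rightarrow>\<^sub>M borel \<Otimes>\<^sub>M R"
  using indep by (auto simp: indep_vars_def)

lemma Xs_meas: "i \<ge> 1 \<Longrightarrow> Xs i \<in> borel_measurable M"
  using measurable_compose[OF sample_meas measurable_fst] by simp

lemma Ys_meas: "i \<ge> 1 \<Longrightarrow> Ys i \<in> M \<rightarrow>\<^sub>M R"
  using measurable_compose[OF sample_meas measurable_snd] by simp

lemma cond_mean_meas: "(\<lambda>z. \<integral>y. G y \<partial>\<kappa> z) \<in> borel_measurable borel"
  by (rule measurable_compose[OF measurable_prob_algebraD[OF kernel_meas]
        integral_measurable_subprob_algebra[OF G_meas]])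

lemma noise_meas[measurable]: "(\<lambda>p. noise (fst p) (snd p)) \<in> borel_measurable (borel \<Otimes>\<^sub>M R)"
proof -
  note [measurable] = cond_mean_meas G_meas
  have [measurable]: "\<L> \<in> borel_measurable borel"
    by (intro borel_measurable_continuous_onI linear_continuous_on lin)
  show ?thesis unfolding noise_def by measurable
qed

lemma weight_meas[measurable]: "h > 0 \<Longrightarrow> weight h \<in> borel_measurable borel"
  unfolding weight_def[abs_def]
  by (rule measurable_compose[OF _ K_meas]) (rule measurable_restrict_space2; simp)

lemma weight_nonneg: "h > 0 \<Longrightarrow> 0 \<le> weight h z"
  unfolding weight_def by (rule K_nonneg) simp

lemma weight_zero: "h > 0 \<Longrightarrow> h < dist x z \<Longrightarrow> weight h z = 0"
  unfolding weight_def by (rule K_zero) (simp add: field_simps)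

lemma weight_bounds: "h > 0 \<Longrightarrow> dist x z \<le> h \<Longrightarrow> l \<le> weight h z \<and> weight h z \<le> L"
  unfolding weight_def by (rule K_bounds) (simp_all add: field_simps)

lemma score_meas[measurable]: "h > 0 \<Longrightarrow> score h \<in> borel_measurable (borel \<Otimes>\<^sub>M R)"
  unfolding score_def[abs_def] by measurable

lemma score_sum_meas[measurable]: "h > 0 \<Longrightarrow> score_sum n h \<in> borel_measurable M"
  unfolding score_sum_def[abs_def]
  by (intro borel_measurable_sum measurable_compose[OF sample_meas score_meas]) auto

lemma hits_meas[measurable]: "hits n h \<in> borel_measurable M"
  unfolding hits_def[abs_def] using Xs_meas by (intro borel_measurable_sum) auto

section \<open>Moments under the law of one observation\<close>

lemma nn_integral_obs:
  assumes [measurable]: "f \<in> borel_measurable (borel \<Otimes>\<^sub>M R)"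
  shows "(\<integral>\<^sup>+p. f p \<partial>obs_law) = (\<integral>\<^sup>+z. \<integral>\<^sup>+y. f (z, y) \<partial>\<kappa> z \<partial>distr M borel X)"
proof -
  have "(\<integral>\<^sup>+p. f p \<partial>obs_law) = (\<integral>\<^sup>+z. \<integral>\<^sup>+p. f p \<partial>joint_kernel R \<kappa> z \<partial>distr M borel X)"
    unfolding distr_pair_eq_bind[OF XY rcd]
    using measurable_joint_kernel[OF kernel_meas] by (subst nn_integral_bind) simp_all
  also have "\<dots> = (\<integral>\<^sup>+z. \<integral>\<^sup>+y. f (z, y) \<partial>\<kappa> z \<partial>distr M borel X)"
  proof (rule nn_integral_cong)
    fix z
    note [measurable_cong] = sets_kernel_eq
    show "(\<integral>\<^sup>+p. f p \<partial>joint_kernel R \<kappa> z) = (\<integral>\<^sup>+y. f (z, y) \<partial>\<kappa> z)"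
      unfolding joint_kernel_def by (subst nn_integral_distr) simp_all
  qed
  finally show ?thesis .
qed

lemma distr_sample:
  assumes "i \<ge> 1" and [measurable]: "f \<in> borel \<Otimes>\<^sub>M R \<rightarrow>\<^sub>M N"
  shows "distr M N (\<lambda>\<omega>. f (Xs i \<omega>, Ys i \<omega>)) = distr obs_law N f"
  using distr_distr[OF assms(2) sample_meas[OF assms(1)]] copies[OF assms(1)]
  by (simp add: comp_def)

lemma nn_integral_sample:
  assumes "i \<ge> 1" and [measurable]: "f \<in> borel_measurable (borel \<Otimes>\<^sub>M R)"
  shows "(\<integral>\<^sup>+\<omega>. f (Xs i \<omega>, Ys i \<omega>) \<partial>M) = (\<integral>\<^sup>+p. f p \<partial>obs_law)"
  using nn_integral_distr[OF sample_meas[OF assms(1)], of f] copies[OF assms(1)] by simp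

lemma emeasure_small_ball: "emeasure (distr M borel X) {z. dist x z \<le> h} = ennreal (phi h)"
  by (subst emeasure_distr)
    (auto simp: phi_def small_ball_prob_def emeasure_eq_measure intro!: arg_cong[where f = prob])

lemma phi_nonneg: "0 \<le> phi h" and phi_le_1: "phi h \<le> 1"
  by (simp_all add: phi_def small_ball_prob_def)

text \<open>Conditioning on the covariate: inside the ball the moment hypothesis bounds the inner
  integral by a constant; outside, \<open>f\<close> is at most 0 and \<open>ennreal\<close>
  truncates it to 0. Integrating the indicator of the ball then leaves \<open>phi h\<close>. It is
  used with \<open>c = L ^ k\<close> for the score and with \<open>c = 1\<close>,
  \<open>k = 4\<close> for the squared noise.\<close>

lemma moment_bound:
  assumes h: "0 < h" "h \<le> h0" and k: "k \<ge> 2" and c: "0 \<le> c"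
    and f[measurable]: "f \<in> borel_measurable (borel \<Otimes>\<^sub>M R)"
    and le: "\<And>z y. f (z, y) \<le> (if dist x z \<le> h then c * norm (noise z y) ^ k else 0)"
  shows "(\<integral>\<^sup>+p. ennreal (f p) \<partial>obs_law) \<le> ennreal (phi h * (c * (fact k / 2 * \<sigma> ^ k)))"
proof -
  have inner: "(\<integral>\<^sup>+y. ennreal (f (z, y)) \<partial>\<kappa> z)
      \<le> ennreal (c * (fact k / 2 * \<sigma> ^ k)) * indicator {z. dist x z \<le> h} z" for z
  proof (cases "dist x z \<le> h")
    case True
    note [measurable_cong] = sets_kernel_eq
    have [measurable]: "noise z \<in> borel_measurable R"
      using measurable_compose[OF measurable_Pair1' noise_meas, of z] by simp
    have "(\<integral>\<^sup>+y. ennreal (f (z, y)) \<partial>\<kappa> z) \<le> (\<integral>\<^sup>+y. ennreal c * ennreal (norm (noise z y) ^ k) \<partial>\<kappa> z)"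
      using le[of z] True c by (intro nn_integral_mono) (simp add: ennreal_mult[symmetric] ennreal_leI)
    also have "\<dots> = ennreal c * (\<integral>\<^sup>+y. ennreal (norm (noise z y) ^ k) \<partial>\<kappa> z)"
      by (rule nn_integral_cmult) simp
    also have "\<dots> \<le> ennreal c * ennreal (fact k / 2 * \<sigma> ^ k)"
      unfolding noise_def using True h k by (intro mult_left_mono cond_moment) auto
    finally show ?thesis using True c \<sigma> by (simp add: ennreal_mult[symmetric])
  next
    case False
    have "(\<integral>\<^sup>+y. ennreal (f (z, y)) \<partial>\<kappa> z) = (\<integral>\<^sup>+y. 0 \<partial>\<kappa> z)"
      using le[of z] False by (intro nn_integral_cong) (simp add: ennreal_neg)
    then show ?thesis by simp
  qed
  have "(\<integral>\<^sup>+p. ennreal (f p) \<partial>obs_law)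
      \<le> (\<integral>\<^sup>+z. ennreal (c * (fact k / 2 * \<sigma> ^ k)) * indicator {z. dist x z \<le> h} z \<partial>distr M borel X)"
  proof (subst nn_integral_obs)
    show "(\<lambda>p. ennreal (f p)) \<in> borel_measurable (borel \<Otimes>\<^sub>M R)" by measurable
  qed (intro nn_integral_mono inner)
  also have "\<dots> = ennreal (c * (fact k / 2 * \<sigma> ^ k)) * ennreal (phi h)"
    by (subst nn_integral_cmult_indicator) (simp_all add: emeasure_small_ball)
  finally show ?thesis
    using c \<sigma> phi_nonneg by (simp add: ennreal_mult[symmetric] mult.commute)
qed

text \<open>The Bernstein condition with \<open>p = phi h\<close> and
  \<open>s = L * \<sigma>\<close>: the score vanishes outside the ball because the kernel
  does.\<close>

lemma score_moment:
  assumes h: "0 < h" "h \<le> h0" and k: "k \<ge> 2"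
  shows "(\<integral>\<^sup>+p. ennreal (norm (score h p) ^ k) \<partial>obs_law) \<le> ennreal (phi h * (fact k / 2 * (L * \<sigma>) ^ k))"
proof -
  have "norm (score h (z, y)) ^ k \<le> (if dist x z \<le> h then L ^ k * norm (noise z y) ^ k else 0)" for z y
  proof (cases "dist x z \<le> h")
    case True
    then have "norm (score h (z, y)) \<le> L * norm (noise z y)"
      using weight_bounds[OF h(1) True] weight_nonneg[OF h(1), of z]
      by (simp add: score_def mult_right_mono)
    then show ?thesis using True by (simp add: power_mult_distrib[symmetric] power_mono)
  next
    case False
    then show ?thesis using weight_zero[OF h(1), of z] k by (simp add: score_def power_0_left)
  qed
  then have "(\<integral>\<^sup>+p. ennreal (norm (score h p) ^ k) \<partial>obs_law) \<le> ennreal (phi h * (L ^ k * (fact k / 2 * \<sigma> ^ k)))"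
    using h L_pos by (intro moment_bound k) auto
  then show ?thesis by (simp add: power_mult_distrib algebra_simps)
qed

lemma score_norm_sq:
  assumes h: "0 < h" "h \<le> h0"
  shows "integrable obs_law (\<lambda>p. (norm (score h p))\<^sup>2)"
    and "(\<integral>p. (norm (score h p))\<^sup>2 \<partial>obs_law) \<le> phi h * (L * \<sigma>)\<^sup>2"
proof -
  have bd: "(\<integral>\<^sup>+p. ennreal ((norm (score h p))\<^sup>2) \<partial>obs_law) \<le> ennreal (phi h * (L * \<sigma>)\<^sup>2)"
    using score_moment[OF h, of 2] by simp
  show int: "integrable obs_law (\<lambda>p. (norm (score h p))\<^sup>2)"
    using h by (intro integrableI_nonneg le_less_trans[OF bd]) simp_all
  show "(\<integral>p. (norm (score h p))\<^sup>2 \<partial>obs_law) \<le> phi h * (L * \<sigma>)\<^sup>2"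
    using bd int phi_nonneg[of h] by (subst (asm) nn_integral_eq_integral) simp_all
qed

lemma prob_obs_law: "prob_space obs_law"
  by (rule prob_space_distr[OF XY])

text \<open>Given the covariate, the noise is centred wherever \<open>G\<close> is conditionally
  integrable, which is known on the ball of radius \<open>h0\<close>. Outside the ball of radius
  \<open>h \<le> h0\<close> the weight is zero, so the score has mean zero there as well.\<close>

lemma score_mean:
  assumes h: "0 < h" "h \<le> h0"
  shows "(\<integral>p. score h p \<partial>obs_law) = 0"
proof -
  interpret O: prob_space obs_law by (rule prob_obs_law)
  interpret \<mu>: prob_space "distr M borel X" by (rule prob_space_distr) simp
  have J: "joint_kernel R \<kappa> \<in> distr M borel X \<rightarrow>\<^sub>M subprob_algebra (borel \<Otimes>\<^sub>M R)"
    using measurable_joint_kernel[OF kernel_meas] by simp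
  have int: "integrable obs_law (score h)"
  proof (rule Bochner_Integration.integrable_bound)
    show "integrable obs_law (\<lambda>p. 1 + (norm (score h p))\<^sup>2)"
      using score_norm_sq(1)[OF h] by simp
    have "norm (score h p) \<le> 1 + (norm (score h p))\<^sup>2" for p
      using zero_le_power2[of "norm (score h p) - 1"] by (simp add: power2_diff)
        (smt (verit) norm_ge_zero)
    then show "AE p in obs_law. norm (score h p) \<le> norm (1 + (norm (score h p))\<^sup>2)" by simp
  qed (use h in simp)
  have zero: "(\<integral>p. score h p \<partial>joint_kernel R \<kappa> z) = 0" for z
  proof -
    note [measurable_cong] = sets_kernel_eq
    interpret \<kappa>: prob_space "\<kappa> z" by (rule prob_kernel)
    have "(\<integral>p. score h p \<partial>joint_kernel R \<kappa> z) = weight h z *\<^sub>R (\<integral>y. noise z y \<partial>\<kappa> z)"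
      unfolding joint_kernel_def using h by (subst integral_distr) (simp_all add: score_def)
    also have "\<dots> = 0"
    proof (cases "dist x z \<le> h")
      case True
      then have i: "integrable (\<kappa> z) G" using h by (intro cond_integrable) simp
      have "(\<integral>y. noise z y \<partial>\<kappa> z) = \<L> (\<integral>y. G y - (\<integral>y'. G y' \<partial>\<kappa> z) \<partial>\<kappa> z)"
        unfolding noise_def using i by (intro integral_bounded_linear lin) simp
      also have "\<dots> = 0"
        using i by (simp add: \<kappa>.prob_space linear_0[OF bounded_linear.linear[OF lin]])
      finally show ?thesis by simp
    qed (use weight_zero[OF h(1)] in simp)
    finally show ?thesis .
  qed
  have "(\<integral>p. score h p \<partial>obs_law) = (\<integral>z. (\<integral>p. score h p \<partial>joint_kernel R \<kappa> z) \<partial>distr M borel X)"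
    unfolding distr_pair_eq_bind[OF XY rcd]
    by (rule \<mu>.integral_bind[OF J]) (use int in \<open>simp add: distr_pair_eq_bind[OF XY rcd]\<close>)
  then show ?thesis by (simp add: zero)
qed

section \<open>Mean and tail of the score sum, tail of the counts\<close>

lemma indep_fun_sample:
  assumes "f \<in> borel \<Otimes>\<^sub>M R \<rightarrow>\<^sub>M N"
  shows "indep_vars (\<lambda>_. N) (\<lambda>i \<omega>. f (Xs i \<omega>, Ys i \<omega>)) {1..n}"
  by (rule indep_vars_compose2[OF indep_vars_subset[OF indep]]) (use assms in auto)

text \<open>This is where the geometry of the Banach space enters: type 2 bounds the second moment
  of the sum by \<open>c0\<close> times \<open>n * phi h * (L * \<sigma>)\<^sup>2\<close>, and
  nonnegativity of the variance of the norm passes from there to the first moment.\<close>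

lemma expectation_norm_score_sum:
  assumes h: "0 < h" "h \<le> h0" and c0: "0 < c0"
    and type2: "\<And>(Z :: nat \<Rightarrow> 'w \<Rightarrow> 'b) n. indep_vars (\<lambda>_. borel) Z {1..n} \<Longrightarrow>
      (\<And>i. i \<in> {1..n} \<Longrightarrow> integrable M (\<lambda>\<omega>. (norm (Z i \<omega>))\<^sup>2)) \<Longrightarrow>
      (\<And>i. i \<in> {1..n} \<Longrightarrow> (\<integral>\<omega>. Z i \<omega> \<partial>M) = 0) \<Longrightarrow>
      (\<integral>\<omega>. (norm (\<Sum>i=1..n. Z i \<omega>))\<^sup>2 \<partial>M) \<le> c0 * (\<Sum>i=1..n. (\<integral>\<omega>. (norm (Z i \<omega>))\<^sup>2 \<partial>M))"
  shows "expectation (\<lambda>\<omega>. norm (score_sum n h \<omega>)) \<le> L * \<sigma> * sqrt (c0 * (n * phi h))"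
proof -
  let ?Z = "\<lambda>i \<omega>. score h (Xs i \<omega>, Ys i \<omega>)"
  have sq: "integrable M (\<lambda>\<omega>. (norm (?Z i \<omega>))\<^sup>2)"
      "expectation (\<lambda>\<omega>. (norm (?Z i \<omega>))\<^sup>2) \<le> phi h * (L * \<sigma>)\<^sup>2" if "i \<ge> 1" for i
  proof -
    note eq = copies[OF that]
    show "integrable M (\<lambda>\<omega>. (norm (?Z i \<omega>))\<^sup>2)"
      using score_norm_sq(1)[OF h] h unfolding eq[symmetric]
      by (subst (asm) integrable_distr_eq[OF sample_meas[OF that]]) simp_all
    show "expectation (\<lambda>\<omega>. (norm (?Z i \<omega>))\<^sup>2) \<le> phi h * (L * \<sigma>)\<^sup>2"
      using score_norm_sq(2)[OF h] h unfolding eq[symmetric]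
      by (subst (asm) integral_distr[OF sample_meas[OF that]]) simp_all
  qed
  have mean: "expectation (?Z i) = 0" if "i \<ge> 1" for i
    using score_mean[OF h] h unfolding copies[OF that, symmetric]
    by (subst (asm) integral_distr[OF sample_meas[OF that]]) simp_all
  have [measurable]: "?Z i \<in> borel_measurable M" if "i \<ge> 1" for i
    using measurable_compose[OF sample_meas[OF that] score_meas[OF h(1)]] .
  have int2: "integrable M (\<lambda>\<omega>. (norm (score_sum n h \<omega>))\<^sup>2)"
  proof (rule Bochner_Integration.integrable_bound)
    show "integrable M (\<lambda>\<omega>. n * (\<Sum>i=1..n. (norm (?Z i \<omega>))\<^sup>2))"
      using sq(1) by (intro integrable_mult_right Bochner_Integration.integrable_sum) auto
    have "(norm (score_sum n h \<omega>))\<^sup>2 \<le> n * (\<Sum>i=1..n. (norm (?Z i \<omega>))\<^sup>2)" for \<omega>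
    proof -
      have "(norm (score_sum n h \<omega>))\<^sup>2 \<le> (\<Sum>i=1..n. norm (?Z i \<omega>))\<^sup>2"
        unfolding score_sum_def by (intro power_mono norm_sum) simp
      also have "\<dots> \<le> (\<Sum>i=1..n. (norm (?Z i \<omega>))\<^sup>2) * card {1..n}"
        by (rule sum_squared_le_sum_of_squares)
      finally show ?thesis by (simp add: mult.commute)
    qed
    then show "AE \<omega> in M. norm ((norm (score_sum n h \<omega>))\<^sup>2) \<le> norm (n * (\<Sum>i=1..n. (norm (?Z i \<omega>))\<^sup>2))"
      by (intro AE_I2) (simp add: order_trans[OF _ abs_ge_self])
  qed (use h in simp)
  have int1: "integrable M (\<lambda>\<omega>. norm (score_sum n h \<omega>))"
  proof (rule Bochner_Integration.integrable_bound)
    show "integrable M (\<lambda>\<omega>. 1 + (norm (score_sum n h \<omega>))\<^sup>2)" using int2 by simp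
    have "norm (score_sum n h \<omega>) \<le> 1 + (norm (score_sum n h \<omega>))\<^sup>2" for \<omega>
      using zero_le_power2[of "norm (score_sum n h \<omega>) - 1"] by (simp add: power2_diff)
        (smt (verit) norm_ge_zero)
    then show "AE \<omega> in M. norm (norm (score_sum n h \<omega>)) \<le> norm (1 + (norm (score_sum n h \<omega>))\<^sup>2)" by simp
  qed (use h in simp)
  have "(expectation (\<lambda>\<omega>. norm (score_sum n h \<omega>)))\<^sup>2 \<le> expectation (\<lambda>\<omega>. (norm (score_sum n h \<omega>))\<^sup>2)"
    using variance_positive[of "\<lambda>\<omega>. norm (score_sum n h \<omega>)"] variance_eq[OF int1 int2] by simp
  also have "\<dots> \<le> c0 * (\<Sum>i=1..n. expectation (\<lambda>\<omega>. (norm (?Z i \<omega>))\<^sup>2))"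
    unfolding score_sum_def
    by (intro type2 indep_fun_sample) (use sq(1) mean h in auto)
  also have "\<dots> \<le> c0 * (\<Sum>i=1..n. phi h * (L * \<sigma>)\<^sup>2)"
    using c0 sq(2) by (intro mult_left_mono sum_mono) auto
  also have "\<dots> = (L * \<sigma> * sqrt (c0 * (n * phi h)))\<^sup>2"
    using c0 phi_nonneg[of h] by (simp add: power_mult_distrib)
  finally show ?thesis
    by (rule power2_le_imp_le) (use L_pos \<sigma> c0 phi_nonneg[of h] in simp)
qed

lemma score_sum_tail:
  assumes n: "n \<ge> 1" and h: "0 < h" "h \<le> h0" and lam: "0 < lam" "2 * lam * (L * \<sigma>) < 1"
  shows "prob {\<omega> \<in> space M. norm (score_sum n h \<omega>) \<ge> expectation (\<lambda>\<omega>. norm (score_sum n h \<omega>)) + t}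
    \<le> exp (- lam * t + n * (2 * phi h * (lam * (L * \<sigma>))\<^sup>2 / (1 - 2 * lam * (L * \<sigma>))))"
proof -
  let ?N = "distr obs_law borel (score h)"
  have "prob {\<omega> \<in> space M. norm (\<Sum>i=1..n. score h (Xs i \<omega>, Ys i \<omega>))
        \<ge> expectation (\<lambda>\<omega>. norm (\<Sum>i=1..n. score h (Xs i \<omega>, Ys i \<omega>))) + t}
    \<le> exp (- lam * t + card {1..n} * (2 * phi h * (lam * (L * \<sigma>))\<^sup>2 / (1 - 2 * lam * (L * \<sigma>))))"
  proof (rule bernstein_lipschitz_tail(2)[where N = ?N])
    show "indep_vars (\<lambda>_. borel) (\<lambda>i \<omega>. score h (Xs i \<omega>, Ys i \<omega>)) {1..n}"
      using h by (intro indep_fun_sample) simp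
    show "distr M borel (\<lambda>\<omega>. score h (Xs i \<omega>, Ys i \<omega>)) = ?N" if "i \<in> {1..n}" for i
      using that h by (intro distr_sample) auto
    show "(\<integral>\<^sup>+z. ennreal (norm z ^ k) \<partial>?N) \<le> ennreal (phi h * (fact k / 2 * (L * \<sigma>) ^ k))" if "2 \<le> k" for k
      using score_moment[OF h that] h by (subst nn_integral_distr) simp_all
    show "\<bar>norm s - norm t\<bar> \<le> norm (s - t)" for s t :: 'b by (rule norm_triangle_ineq3)
  qed (use n lam phi_nonneg L_pos \<sigma> in auto)
  then show ?thesis by (simp add: score_sum_def)
qed

text \<open>The lower tail is the upper tail of \<open>uminus\<close> applied to a sum of
  indicators. These satisfy the moment condition with \<open>p = phi h\<close> and
  \<open>s = 1\<close>, as \<open>fact k / 2 \<ge> 1\<close>. With \<open>lam = 1/8\<close> and a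
  deviation of half the mean, the exponent is \<open>n * phi h\<close> times
  \<open>- 1/16 + 1/24 = - 1/48\<close>.\<close>

lemma hits_tail:
  assumes n: "n \<ge> 1"
  shows "prob {\<omega> \<in> space M. hits n h \<omega> \<le> n * phi h / 2} \<le> exp (- (n * phi h / 48))"
proof -
  let ?g = "\<lambda>p :: 'c \<times> 'r. of_bool (dist x (fst p) \<le> h) :: real"
  let ?N = "distr obs_law borel ?g"
  have [measurable]: "?g \<in> borel_measurable (borel \<Otimes>\<^sub>M R)" by measurable
  have mom: "(\<integral>\<^sup>+p. ennreal (?g p) \<partial>obs_law) = ennreal (phi h)"
  proof -
    have "(\<integral>\<^sup>+p. ennreal (?g p) \<partial>obs_law) = (\<integral>\<^sup>+\<omega>. ennreal (of_bool (dist x (X \<omega>) \<le> h)) \<partial>M)"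
      by (subst nn_integral_distr[OF XY]) simp_all
    also have "\<dots> = (\<integral>\<^sup>+\<omega>. indicator {\<omega> \<in> space M. dist x (X \<omega>) \<le> h} \<omega> \<partial>M)"
      by (intro nn_integral_cong) (simp add: indicator_def)
    also have "\<dots> = ennreal (phi h)"
      by (subst nn_integral_indicator) (simp_all add: phi_def small_ball_prob_def emeasure_eq_measure)
    finally show ?thesis .
  qed
  have int: "integrable M (\<lambda>\<omega>. ?g (Xs i \<omega>, Ys i \<omega>))" and ex: "expectation (\<lambda>\<omega>. ?g (Xs i \<omega>, Ys i \<omega>)) = phi h"
    if "i \<ge> 1" for i
  proof -
    have m: "(\<lambda>\<omega>. ?g (Xs i \<omega>, Ys i \<omega>)) \<in> borel_measurable M"
      by (rule measurable_compose[OF sample_meas[OF that]]) simp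
    show int: "integrable M (\<lambda>\<omega>. ?g (Xs i \<omega>, Ys i \<omega>))"
      using m by (intro integrable_const_bound[where B = 1]) auto
    have "(\<integral>\<^sup>+\<omega>. ennreal (?g (Xs i \<omega>, Ys i \<omega>)) \<partial>M) = ennreal (phi h)"
      using nn_integral_sample[OF that, of "\<lambda>p. ennreal (?g p)"] mom by simp
    then show "expectation (\<lambda>\<omega>. ?g (Xs i \<omega>, Ys i \<omega>)) = phi h"
      using nn_integral_eq_integral[OF int] phi_nonneg[of h] by simp
  qed
  have exp_hits: "expectation (\<lambda>\<omega>. - (\<Sum>i=1..n. ?g (Xs i \<omega>, Ys i \<omega>))) = - (n * phi h)"
  proof -
    have "expectation (\<lambda>\<omega>. \<Sum>i=1..n. ?g (Xs i \<omega>, Ys i \<omega>)) = (\<Sum>i=1..n. expectation (\<lambda>\<omega>. ?g (Xs i \<omega>, Ys i \<omega>)))"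
      using int by (intro Bochner_Integration.integral_sum) auto
    also have "\<dots> = (\<Sum>i=1..n. phi h)" using ex by (intro sum.cong) auto
    finally show ?thesis by simp
  qed
  have "prob {\<omega> \<in> space M. - (\<Sum>i=1..n. ?g (Xs i \<omega>, Ys i \<omega>))
        \<ge> expectation (\<lambda>\<omega>. - (\<Sum>i=1..n. ?g (Xs i \<omega>, Ys i \<omega>))) + n * phi h / 2}
    \<le> exp (- (1/8) * (n * phi h / 2) + card {1..n} * (2 * phi h * ((1/8) * 1)\<^sup>2 / (1 - 2 * (1/8) * 1)))"
  proof (rule bernstein_lipschitz_tail(2)[where N = ?N and f = uminus])
    show "indep_vars (\<lambda>_. borel) (\<lambda>i \<omega>. ?g (Xs i \<omega>, Ys i \<omega>)) {1..n}"
      by (intro indep_fun_sample) simp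
    show "distr M borel (\<lambda>\<omega>. ?g (Xs i \<omega>, Ys i \<omega>)) = ?N" if "i \<in> {1..n}" for i
      using that by (intro distr_sample) auto
    show "(\<integral>\<^sup>+z. ennreal (norm z ^ k) \<partial>?N) \<le> ennreal (phi h * (fact k / 2 * 1 ^ k))" if "2 \<le> k" for k
    proof -
      have "fact 2 \<le> (fact k :: real)" using that by (rule fact_mono)
      then have "phi h \<le> phi h * (fact k / 2 * 1 ^ k)"
        using mult_left_mono[OF _ phi_nonneg[of h], of 2 "fact k"] by simp
      moreover have "(\<integral>\<^sup>+z. ennreal (norm z ^ k) \<partial>?N) = (\<integral>\<^sup>+p. ennreal (?g p) \<partial>obs_law)"
        using that by (subst nn_integral_distr) (auto intro!: nn_integral_cong)
      ultimately show ?thesis by (simp add: mom ennreal_leI)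
    qed
    show "\<bar>- s - (- t)\<bar> \<le> norm (s - t)" for s t :: real by simp
  qed (use n phi_nonneg in auto)
  also have "- (1/8) * (n * phi h / 2) + card {1..n} * (2 * phi h * ((1/8) * 1)\<^sup>2 / (1 - 2 * (1/8) * 1))
      = - (n * phi h / 48)"
    by (simp add: power2_eq_square field_simps)
  finally show ?thesis unfolding exp_hits by (simp add: hits_def algebra_simps)
qed

end

section \<open>Bandwidth selection on the good event\<close>

text \<open>Both \<open>est hs\<close> and \<open>est h\<close> are compared with the estimate at
  \<open>max h hs\<close>: the first distance is controlled by \<open>C h + D hs\<close>, the second
  by \<open>C hs + D h\<close>, and since \<open>hs\<close> minimises \<open>C + D\<close>, together
  they cost at most \<open>2 * (C h + D h)\<close>. It remains to bound \<open>C h\<close>, where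
  only bandwidths below \<open>h\<close> contribute; their bias is at most that at \<open>h\<close>,
  and their noise is cancelled by their own penalty. In \<open>err\<close>, one \<open>v h\<close>
  stands for the stochastic term and one for the remainder.\<close>

lemma selected_bandwidth_oracle:
  fixes est :: "real \<Rightarrow> 'b::real_normed_vector"
  assumes H: "finite H" "H \<subseteq> {0<..}" and sel: "is_selected_bandwidth H est D hs" and h: "h \<in> H"
    and c: "0 \<le> c" and \<beta>: "0 < \<beta>"
    and v: "\<And>h. 0 \<le> v h" "\<And>h. h \<in> H \<Longrightarrow> (v h)\<^sup>2 \<le> D h / 5"
    and err: "\<And>h. h \<in> H \<Longrightarrow> norm (est h - \<theta>) \<le> c * h powr \<beta> + 2 * v h"
  shows "(norm (est hs - \<theta>))\<^sup>2 \<le> 246 * c\<^sup>2 * h powr (2 * \<beta>) + 60 * D h"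
proof -
  let ?C = "comparison H est D"
  let ?r = "h powr \<beta>"
  \<comment> \<open>The weight \<open>5/4\<close> turns \<open>(2 v)\<^sup>2\<close> into \<open>5 v\<^sup>2\<close>, which the penalty absorbs.\<close>
  have sq_split: "(a + b)\<^sup>2 \<le> 5/4 * a\<^sup>2 + 5 * b\<^sup>2" for a b :: real
    using zero_le_power2[of "a/2 - 2 * b"] by (simp add: power2_eq_square algebra_simps)
  have sq2: "(a + b)\<^sup>2 \<le> 2 * a\<^sup>2 + 2 * b\<^sup>2" for a b :: real
    using zero_le_power2[of "a - b"] by (simp add: power2_eq_square algebra_simps)
  have sq3: "(a + b + d)\<^sup>2 \<le> 3 * (a\<^sup>2 + b\<^sup>2 + d\<^sup>2)" for a b d :: real
    using zero_le_power2[of "a - b"] zero_le_power2[of "a - d"] zero_le_power2[of "b - d"]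
    by (simp add: power2_eq_square algebra_simps)
  have r2: "?r\<^sup>2 = h powr (2 * \<beta>)"
    by (simp add: power2_eq_square powr_add[symmetric])
  have D0: "0 \<le> D k" if "k \<in> H" for k
    using order_trans[OF zero_le_power2 v(2)[OF that]] by simp
  have hs: "hs \<in> H" and min: "?C hs + D hs \<le> ?C k + D k" if "k \<in> H" for k
    using sel that by (auto simp: is_selected_bandwidth_def is_arg_min_linorder)
  note hs = hs[OF h]
  have comp: "(norm (est k' - est (max k k')))\<^sup>2 - D k' \<le> ?C k" if "k' \<in> H" for k k'
  proof -
    have "max ((norm (est k' - est (max k k')))\<^sup>2 - D k') 0 \<le> ?C k"
      unfolding comparison_def using H that by (intro Max_ge) auto
    then show ?thesis by simp
  qed
  have Ch: "?C h \<le> 40 * c\<^sup>2 * ?r\<^sup>2 + 8 * D h"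
    unfolding comparison_def
  proof (intro Max.boundedI)
    show "finite ((\<lambda>h'. max ((norm (est h' - est (max h h')))\<^sup>2 - D h') 0) ` H)" using H by simp
    show "(\<lambda>h'. max ((norm (est h' - est (max h h')))\<^sup>2 - D h') 0) ` H \<noteq> {}" using h by auto
    fix a assume "a \<in> (\<lambda>h'. max ((norm (est h' - est (max h h')))\<^sup>2 - D h') 0) ` H"
    then obtain k where k: "k \<in> H" and a: "a = max ((norm (est k - est (max h k)))\<^sup>2 - D k) 0" by auto
    have rhs: "0 \<le> 40 * c\<^sup>2 * ?r\<^sup>2 + 8 * D h" using D0[OF h] by simp
    show "a \<le> 40 * c\<^sup>2 * ?r\<^sup>2 + 8 * D h"
    proof (cases "k < h")
      \<comment> \<open>For \<open>k \<ge> h\<close> the maximum is \<open>k\<close> itself: the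
        difference vanishes and minus the penalty is truncated to 0.\<close>
      case False
      then have "a = 0" using D0[OF k] by (simp add: a max_def)
      with rhs show ?thesis by simp
    next
      case True
      have mono: "k powr \<beta> \<le> ?r"
        using True k H \<beta> by (intro powr_mono2) auto
      let ?w = "2 * (c * ?r) + 2 * v h"
      have "norm (est k - est h) \<le> norm (est k - \<theta>) + norm (est h - \<theta>)"
        using norm_triangle_ineq4[of "est k - \<theta>" "est h - \<theta>"] by simp
      also have "\<dots> \<le> (c * k powr \<beta> + 2 * v k) + (c * ?r + 2 * v h)"
        by (intro add_mono err k h)
      also have "\<dots> \<le> 2 * v k + ?w"
        using mult_left_mono[OF mono c] by simp
      finally have "(norm (est k - est h))\<^sup>2 \<le> (2 * v k + ?w)\<^sup>2" by (rule power_mono) simp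
      also have "\<dots> \<le> 5/4 * (2 * v k)\<^sup>2 + 5 * ?w\<^sup>2" by (rule sq_split)
      also have "5/4 * (2 * v k)\<^sup>2 \<le> D k" using v(2)[OF k] by (simp add: power_mult_distrib)
      also have "5 * ?w\<^sup>2 \<le> 5 * (2 * (2 * (c * ?r))\<^sup>2 + 2 * (2 * v h)\<^sup>2)"
        by (intro mult_left_mono sq2) simp
      also have "\<dots> \<le> 40 * c\<^sup>2 * ?r\<^sup>2 + 8 * D h"
        using v(2)[OF h] by (simp add: power_mult_distrib)
      finally show ?thesis using True rhs by (simp add: a max_def)
    qed
  qed
  let ?m = "est (max h hs)"
  have a1: "(norm (est hs - ?m))\<^sup>2 \<le> ?C h + D hs" using comp[OF hs, of h] by simp
  have a2: "(norm (est h - ?m))\<^sup>2 \<le> ?C hs + D h" using comp[OF h, of hs] by (simp add: max.commute)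
  have "(norm (est h - \<theta>))\<^sup>2 \<le> (c * ?r + 2 * v h)\<^sup>2" by (intro power_mono err h) simp
  also have "\<dots> \<le> 2 * (c * ?r)\<^sup>2 + 2 * (2 * v h)\<^sup>2" by (rule sq2)
  also have "\<dots> \<le> 2 * c\<^sup>2 * ?r\<^sup>2 + 8/5 * D h" using v(2)[OF h] by (simp add: power_mult_distrib)
  finally have a3: "(norm (est h - \<theta>))\<^sup>2 \<le> 2 * c\<^sup>2 * ?r\<^sup>2 + 8/5 * D h" .
  have "norm (est hs - \<theta>) \<le> norm (est hs - ?m) + norm (est h - ?m) + norm (est h - \<theta>)"
  proof -
    have "est hs - \<theta> = (est hs - ?m) - (est h - ?m) + (est h - \<theta>)" by simp
    then show ?thesis
      using norm_triangle_ineq[of "(est hs - ?m) - (est h - ?m)" "est h - \<theta>"]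
        norm_triangle_ineq4[of "est hs - ?m" "est h - ?m"] by simp
  qed
  then have "(norm (est hs - \<theta>))\<^sup>2 \<le> (norm (est hs - ?m) + norm (est h - ?m) + norm (est h - \<theta>))\<^sup>2"
    by (rule power_mono) simp
  also have "\<dots> \<le> 3 * ((norm (est hs - ?m))\<^sup>2 + (norm (est h - ?m))\<^sup>2 + (norm (est h - \<theta>))\<^sup>2)"
    by (rule sq3)
  also have "\<dots> \<le> 3 * ((?C h + D hs) + (?C hs + D h) + (2 * c\<^sup>2 * ?r\<^sup>2 + 8/5 * D h))"
    by (intro mult_left_mono add_mono a1 a2 a3) simp
  also have "\<dots> \<le> 3 * (2 * (?C h + D h) + (2 * c\<^sup>2 * ?r\<^sup>2 + 8/5 * D h))"
    using min[OF h] by simp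
  \<comment> \<open>With the bound on \<open>C h\<close>, the constants are
    \<open>3 * (2 * 40 + 2) = 246\<close> and \<open>3 * (2 * 9 + 8/5) = 58.8\<close>, rounded up to
    60.\<close>
  also have "\<dots> \<le> 246 * c\<^sup>2 * ?r\<^sup>2 + 60 * D h"
    using Ch D0[OF h] by argo
  finally show ?thesis by (simp add: r2)
qed

section \<open>Kernel averages and the probability of the good event\<close>

lemma kernel_average_diff_const:
  assumes "kernel_mass K x xs n h \<noteq> 0"
  shows "kernel_average K x xs n h v - c = kernel_average K x xs n h (\<lambda>i. v i - c)"
proof -
  have "(\<Sum>i=1..n. K (inverse h * dist x (xs i)) *\<^sub>R (v i - c))
      = (\<Sum>i=1..n. K (inverse h * dist x (xs i)) *\<^sub>R v i) - kernel_mass K x xs n h *\<^sub>R c"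
    unfolding kernel_mass_def by (simp add: scaleR_diff_right sum_subtractf scaleR_sum_left)
  then show ?thesis using assms by (simp add: kernel_average_def scaleR_diff_right)
qed

lemma norm_kernel_average_le:
  assumes K: "\<And>u. u \<ge> 0 \<Longrightarrow> K u \<ge> 0" and h: "h > 0" and mass: "kernel_mass K x xs n h > 0"
    and le: "\<And>i. i \<in> {1..n} \<Longrightarrow> K (inverse h * dist x (xs i)) \<noteq> 0 \<Longrightarrow> norm (v i) \<le> b"
  shows "norm (kernel_average K x xs n h v) \<le> b"
proof -
  let ?w = "\<lambda>i. K (inverse h * dist x (xs i))"
  have w: "0 \<le> ?w i" for i using h by (intro K) simp
  have "norm (\<Sum>i=1..n. ?w i *\<^sub>R v i) \<le> (\<Sum>i=1..n. norm (?w i *\<^sub>R v i))" by (rule norm_sum)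
  also have "\<dots> \<le> (\<Sum>i=1..n. ?w i * b)"
  proof (rule sum_mono)
    fix i assume "i \<in> {1..n}"
    then show "norm (?w i *\<^sub>R v i) \<le> ?w i * b"
      using le[of i] w[of i] by (cases "?w i = 0") (auto simp: mult_left_mono)
  qed
  also have "\<dots> = kernel_mass K x xs n h * b" by (simp add: kernel_mass_def sum_distrib_right)
  finally show ?thesis
    using mass by (simp add: kernel_average_def field_simps)
qed

context local_sample
begin

definition good :: "nat \<Rightarrow> real set \<Rightarrow> 'w \<Rightarrow> bool" where
  "good n H \<omega> \<longleftrightarrow> (\<forall>h\<in>H. n * phi h / 2 < hits n h \<omega> \<and>
     norm (score_sum n h \<omega>) < 8 * (L * \<sigma>) * sqrt (n * phi h * ln n))"

text \<open>The tail bound is used with \<open>lam L \<sigma> = 2 sqrt (ln n / (n phi h))\<close>; the three exponents are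
  \<open>-16 ln n\<close>, at most \<open>ln n\<close> from the mean of the norm, and at most \<open>10 ln n\<close> from the
  Bernstein term.\<close>
lemma score_sum_deviation:
  assumes n: "n \<ge> 1" and h: "0 < h" "h \<le> h0" and c0: "0 < c0"
    and mean: "expectation (\<lambda>\<omega>. norm (score_sum n h \<omega>)) \<le> L * \<sigma> * sqrt (c0 * (n * phi h))"
    and t: "400 \<le> ln (real n)" "4 * c0 \<le> ln (real n)" and m: "(ln (real n))\<^sup>2 \<le> n * phi h"
  shows "prob {\<omega> \<in> space M. norm (score_sum n h \<omega>) \<ge> 8 * (L * \<sigma>) * sqrt (n * phi h * ln n)}
    \<le> exp (- 5 * ln n)"
proof -
  define t where "t = ln (real n)"
  define m where "m = n * phi h"
  define a where "a = 2 * sqrt (t / m)"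
  have t0: "400 \<le> t" "4 * c0 \<le> t" and mt: "t\<^sup>2 \<le> m" using assms by (auto simp: t_def m_def)
  then have "0 < t" by linarith
  note t0 = t0 this
  have m0: "0 < m" using mt t0 by (smt (verit) zero_less_power)
  have Ls: "0 < L * \<sigma>" using L_pos \<sigma> by simp
  \<comment> \<open>The threshold 400 for \<open>ln n\<close> is chosen to get
    \<open>a \<le> 2/20\<close>, which keeps the Bernstein denominator \<open>1 - 2 * a\<close>
    above 4/5.\<close>
  have "t / m \<le> 1 / t"
    using mt m0 t0 by (simp add: field_simps power2_eq_square)
  also have "\<dots> \<le> (1/20)\<^sup>2" using t0 by (simp add: field_simps power2_eq_square)
  finally have "sqrt (t / m) \<le> 1/20" by (intro real_le_lsqrt) (use t0 m0 in auto)
  then have a: "0 < a" "a \<le> 1/10" using t0 m0 by (auto simp: a_def)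
  have am: "a * sqrt (m * t) = 2 * t"
    using t0 m0 by (simp add: a_def real_sqrt_mult real_sqrt_divide field_simps)
  have aa: "m * a\<^sup>2 = 4 * t" using t0 m0 by (simp add: a_def power_mult_distrib)
  \<comment> \<open>Here \<open>4 * c0 \<le> t\<close> is spent: it makes the mean of the norm cost
    no more than \<open>t\<close> in the exponent.\<close>
  have ac: "a * sqrt (c0 * m) \<le> t"
  proof -
    have "a * sqrt (c0 * m) = 2 * sqrt (t * c0)"
      using t0 m0 c0 by (simp add: a_def real_sqrt_mult real_sqrt_divide field_simps)
    also have "sqrt (t * c0) \<le> t / 2"
      using t0 by (intro real_le_lsqrt) (auto simp: power2_eq_square field_simps)
    finally show ?thesis by simp
  qed
  define lam where "lam = a / (L * \<sigma>)"
  have lam: "0 < lam" "lam * (L * \<sigma>) = a" using a Ls by (auto simp: lam_def)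
  let ?E = "expectation (\<lambda>\<omega>. norm (score_sum n h \<omega>))"
  define u where "u = 8 * (L * \<sigma>) * sqrt (m * t) - ?E"
  have "prob {\<omega> \<in> space M. norm (score_sum n h \<omega>) \<ge> ?E + u}
    \<le> exp (- lam * u + n * (2 * phi h * (lam * (L * \<sigma>))\<^sup>2 / (1 - 2 * lam * (L * \<sigma>))))"
    using a lam by (intro score_sum_tail n h) (simp_all add: mult.assoc)
  also have "\<dots> \<le> exp (- 5 * t)"
  proof (subst exp_le_cancel_iff)
    have "lam * u = 8 * (a * sqrt (m * t)) - lam * ?E"
      unfolding u_def using lam(2) by (simp add: algebra_simps)
    moreover have "lam * ?E \<le> lam * (L * \<sigma> * sqrt (c0 * m))"
      using mean lam(1) by (intro mult_left_mono) (auto simp: m_def)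
    moreover have "lam * (L * \<sigma> * sqrt (c0 * m)) = a * sqrt (c0 * m)"
      using lam(2) by (simp add: mult.assoc[symmetric])
    ultimately have 1: "lam * u \<ge> 15 * t" using am ac by linarith
    have "n * (2 * phi h * (lam * (L * \<sigma>))\<^sup>2 / (1 - 2 * lam * (L * \<sigma>))) = 2 * (m * a\<^sup>2) / (1 - 2 * a)"
      using lam(2) by (simp add: m_def mult.assoc)
    also have "\<dots> \<le> 2 * (m * a\<^sup>2) / (4/5)"
      using a m0 by (intro divide_left_mono) auto
    also have "\<dots> = 10 * t" by (simp add: aa)
    finally show "- lam * u + n * (2 * phi h * (lam * (L * \<sigma>))\<^sup>2 / (1 - 2 * lam * (L * \<sigma>))) \<le> - 5 * t"
      using 1 by linarith
  qed
  finally show ?thesis by (simp add: u_def t_def m_def)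
qed

lemma good_meas:
  assumes "finite H" "H \<subseteq> {0<..}"
  shows "{\<omega> \<in> space M. \<not> good n H \<omega>} \<in> sets M"
proof -
  have "{\<omega> \<in> space M. \<not> good n H \<omega>} =
     (\<Union>h\<in>H. {\<omega> \<in> space M. \<not> (n * phi h / 2 < hits n h \<omega> \<and>
        norm (score_sum n h \<omega>) < 8 * (L * \<sigma>) * sqrt (n * phi h * ln n))})"
    by (auto simp: good_def)
  also have "\<dots> \<in> sets M"
  proof (rule sets.finite_UN[OF assms(1)])
    fix h assume "h \<in> H"
    then have "score_sum n h \<in> borel_measurable M" using assms by (intro score_sum_meas) auto
    then show "{\<omega> \<in> space M. \<not> (n * phi h / 2 < hits n h \<omega> \<and>
        norm (score_sum n h \<omega>) < 8 * (L * \<sigma>) * sqrt (n * phi h * ln n))} \<in> sets M"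
      by measurable
  qed
  finally show ?thesis .
qed

text \<open>A union bound over at most \<open>n\<close> bandwidths, each failing with probability at
  most \<open>2 / n ^ 5\<close>. For the counts,
  \<open>n \<phi> \<ge> (ln n)\<^sup>2 \<ge> 400 ln n\<close> gives
  \<open>n \<phi> / 48 \<ge> 5 ln n\<close>.\<close>

lemma prob_not_good:
  assumes n: "n \<ge> 1" and H: "finite H" "H \<subseteq> {0<..}" "card H \<le> n" and Hh0: "\<And>h. h \<in> H \<Longrightarrow> h \<le> h0"
    and c0: "0 < c0"
    and mean: "\<And>h. h \<in> H \<Longrightarrow> expectation (\<lambda>\<omega>. norm (score_sum n h \<omega>)) \<le> L * \<sigma> * sqrt (c0 * (n * phi h))"
    and t: "400 \<le> ln (real n)" "4 * c0 \<le> ln (real n)"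
    and m: "\<And>h. h \<in> H \<Longrightarrow> (ln (real n))\<^sup>2 \<le> n * phi h"
  shows "prob {\<omega> \<in> space M. \<not> good n H \<omega>} \<le> 2 / real n ^ 4"
proof -
  let ?A = "\<lambda>h. {\<omega> \<in> space M. hits n h \<omega> \<le> n * phi h / 2}"
  let ?B = "\<lambda>h. {\<omega> \<in> space M. norm (score_sum n h \<omega>) \<ge> 8 * (L * \<sigma>) * sqrt (n * phi h * ln n)}"
  have meas: "?A h \<in> sets M" "?B h \<in> sets M" if "h \<in> H" for h
  proof -
    have "score_sum n h \<in> borel_measurable M" using that H by (intro score_sum_meas) auto
    then show "?A h \<in> sets M" "?B h \<in> sets M" by measurable
  qed
  have e5: "exp (- 5 * ln n) = 1 / real n ^ 5"
  proof -
    have "exp (5 * ln (real n)) = real n ^ 5"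
      using n by (subst exp_of_nat_mult[of 5, simplified]) simp
    then show ?thesis by (simp add: exp_minus inverse_eq_divide)
  qed
  have each: "prob (?A h \<union> ?B h) \<le> 2 / real n ^ 5" if h: "h \<in> H" for h
  proof -
    have "prob (?A h) \<le> exp (- (n * phi h / 48))" by (rule hits_tail[OF n])
    also have "\<dots> \<le> exp (- 5 * ln n)"
    proof (subst exp_le_cancel_iff)
      have "400 * ln (real n) \<le> (ln (real n))\<^sup>2" using t(1) by (simp add: power2_eq_square)
      then show "- (n * phi h / 48) \<le> - 5 * ln n" using m[OF h] t by argo
    qed
    finally have "prob (?A h) \<le> 1 / real n ^ 5" by (simp only: e5)
    moreover have "prob (?B h) \<le> 1 / real n ^ 5"
      unfolding e5[symmetric] using H h by (intro score_sum_deviation[OF n _ Hh0 c0 mean t m]) auto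
    ultimately show ?thesis
      using measure_Un_le[OF meas[OF h]] by linarith
  qed
  have "prob {\<omega> \<in> space M. \<not> good n H \<omega>} \<le> prob (\<Union>h\<in>H. ?A h \<union> ?B h)"
  proof (rule finite_measure_mono)
    show "{\<omega> \<in> space M. \<not> good n H \<omega>} \<subseteq> (\<Union>h\<in>H. ?A h \<union> ?B h)"
      unfolding good_def not_less[symmetric] by blast
    show "(\<Union>h\<in>H. ?A h \<union> ?B h) \<in> sets M"
      by (intro sets.finite_UN sets.Un meas H(1))
  qed
  also have "\<dots> \<le> (\<Sum>h\<in>H. prob (?A h \<union> ?B h))"
    by (rule measure_UNION_le[OF H(1)]) (intro sets.Un meas)
  also have "\<dots> \<le> (\<Sum>h\<in>H. 2 / real n ^ 5)" by (intro sum_mono each)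
  also have "\<dots> = card H * (2 / real n ^ 5)" by simp
  also have "\<dots> \<le> n * (2 / real n ^ 5)" using H(3) by (intro mult_right_mono) auto
  also have "\<dots> = 2 / real n ^ 4" using n by (simp add: field_simps eval_nat_numeral)
  finally show ?thesis .
qed

section \<open>Consequences of the good event for the selected estimate\<close>

abbreviation "mass n h \<omega> \<equiv> kernel_mass K x (\<lambda>i. Xs i \<omega>) n h"
abbreviation "stoch n h \<omega> \<equiv> stochastic_term K \<kappa> \<L> G x (\<lambda>i. Xs i \<omega>) (\<lambda>i. Ys i \<omega>) n h"
abbreviation "pen \<zeta> n h \<omega> \<equiv> penalty \<sigma> \<zeta> x (\<lambda>i. Xs i \<omega>) n h"

lemma mass_ge_hits:
  assumes "h > 0"
  shows "l * hits n h \<omega> \<le> mass n h \<omega>"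
  unfolding hits_def kernel_mass_def sum_distrib_left
proof (rule sum_mono)
  fix i
  show "l * of_bool (dist x (Xs i \<omega>) \<le> h) \<le> K (inverse h * dist x (Xs i \<omega>))"
    using weight_bounds[OF assms, of "Xs i \<omega>"] weight_nonneg[OF assms, of "Xs i \<omega>"]
    by (auto simp: weight_def)
qed

lemma stoch_eq: "stoch n h \<omega> = score_sum n h \<omega> /\<^sub>R mass n h \<omega>"
proof -
  interpret lin: bounded_linear \<L> by (rule lin)
  show ?thesis
    unfolding stochastic_term_def kernel_average_def score_sum_def score_def weight_def noise_def
    by (simp add: lin.scaleR lin.sum)
qed

text \<open>The stochastic term is a weighted average of the noise of the observations in the ball.
  This crude bound serves on the bad event, where concentration fails.\<close>

lemma norm_stoch_le:
  assumes "h > 0" and mass: "mass n h \<omega> > 0" 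
    and b: "\<And>i. i \<in> {1..n} \<Longrightarrow> dist x (Xs i \<omega>) \<le> h \<Longrightarrow> norm (noise (Xs i \<omega>) (Ys i \<omega>)) \<le> b"
  shows "norm (stoch n h \<omega>) \<le> b"
proof -
  have "stoch n h \<omega> = kernel_average K x (\<lambda>i. Xs i \<omega>) n h (\<lambda>i. noise (Xs i \<omega>) (Ys i \<omega>))"
    by (simp add: stoch_eq kernel_average_def score_sum_def score_def weight_def)
  also have "norm \<dots> \<le> b"
  proof (rule norm_kernel_average_le[OF K_nonneg assms(1) mass])
    fix i assume i: "i \<in> {1..n}" and w: "K (inverse h * dist x (Xs i \<omega>)) \<noteq> 0"
    have "dist x (Xs i \<omega>) \<le> h" using weight_zero[OF assms(1), of "Xs i \<omega>"] w by (force simp: weight_def)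
    then show "norm (noise (Xs i \<omega>) (Ys i \<omega>)) \<le> b" by (rule b[OF i])
  qed auto
  finally show ?thesis .
qed

lemma pen_eq:
  assumes "n \<ge> 1" "hits n h \<omega> > 0"
  shows "pen \<zeta> n h \<omega> = \<sigma>\<^sup>2 * \<zeta> n * (ln n / hits n h \<omega>)"
proof -
  have "empirical_small_ball x (\<lambda>i. Xs i \<omega>) n h = hits n h \<omega> / n"
    by (simp add: empirical_small_ball_def hits_def)
  then show ?thesis using assms by (simp add: penalty_def)
qed

text \<open>Write \<open>m = n \<phi>(h)\<close> and \<open>N\<close> for the count. The mass is at
  least \<open>l N\<close>, so \<open>\<parallel>V\<parallel>\<^sup>2\<close> is at most
  \<open>64 L\<^sup>2 / l\<^sup>2\<close> times \<open>\<sigma>\<^sup>2 (ln n / N) (m / N)\<close>,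
  and \<open>m / N \<le> 2\<close>. A fifth of the penalty covers this as soon as
  \<open>\<zeta> n\<close> reaches \<open>5 * 128 = 640\<close> times
  \<open>L\<^sup>2 / l\<^sup>2\<close>. The same lower bound on \<open>N\<close> makes the random
  penalty at most twice its deterministic counterpart.\<close>

lemma good_bounds:
  assumes good: "good n H \<omega>" and h: "h \<in> H" "h > 0" and n: "n \<ge> 2" and \<phi>: "phi h > 0"
    and \<zeta>: "\<zeta> n \<ge> 640 * (L\<^sup>2 / l\<^sup>2)"
  shows "mass n h \<omega> > 0" and "(norm (stoch n h \<omega>))\<^sup>2 \<le> pen \<zeta> n h \<omega> / 5"
    and "pen \<zeta> n h \<omega> \<le> 2 * \<sigma>\<^sup>2 * \<zeta> n * (ln n / (n * phi h))"
proof -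
  define m where "m = n * phi h"
  define N where "N = hits n h \<omega>"
  define t where "t = ln (real n)"
  have N: "m / 2 < N" and S: "norm (score_sum n h \<omega>) < 8 * (L * \<sigma>) * sqrt (m * t)"
    using good h by (auto simp: good_def m_def N_def t_def)
  have m0: "0 < m" and t0: "0 < t" using n \<phi> by (auto simp: m_def t_def)
  have N0: "0 < N" using N m0 by simp
  have D: "pen \<zeta> n h \<omega> = \<sigma>\<^sup>2 * \<zeta> n * (t / N)"
    using N0 n by (simp add: pen_eq N_def t_def)
  have mass: "l * N \<le> mass n h \<omega>" using mass_ge_hits[OF h(2)] by (simp add: N_def)
  then show pos: "mass n h \<omega> > 0" using lL(1) N0 by (smt (verit) mult_pos_pos)
  have "0 \<le> 640 * (L\<^sup>2 / l\<^sup>2)" by simp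
  then have \<zeta>0: "0 \<le> \<zeta> n" using \<zeta> by linarith
  show "pen \<zeta> n h \<omega> \<le> 2 * \<sigma>\<^sup>2 * \<zeta> n * (ln n / (n * phi h))"
  proof -
    have "t / N \<le> t / (m / 2)" using N N0 m0 t0 by (intro divide_left_mono) auto
    then have "\<sigma>\<^sup>2 * \<zeta> n * (t / N) \<le> \<sigma>\<^sup>2 * \<zeta> n * (t / (m / 2))"
      using \<zeta>0 by (intro mult_left_mono) auto
    then show ?thesis by (simp add: D m_def t_def algebra_simps)
  qed
  have "norm (stoch n h \<omega>) = norm (score_sum n h \<omega>) / mass n h \<omega>"
    using pos by (simp add: stoch_eq divide_inverse mult.commute)
  also have "\<dots> \<le> 8 * (L * \<sigma>) * sqrt (m * t) / (l * N)"
    using S mass lL(1) N0 L_pos \<sigma> m0 t0 by (intro frac_le) auto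
  finally have "(norm (stoch n h \<omega>))\<^sup>2 \<le> (8 * (L * \<sigma>) * sqrt (m * t) / (l * N))\<^sup>2"
    by (rule power_mono) simp
  also have "\<dots> = 64 * (L\<^sup>2 / l\<^sup>2) * \<sigma>\<^sup>2 * (t / N) * (m / N)"
    using m0 t0 by (simp add: power_divide power_mult_distrib) (simp add: power2_eq_square field_simps)
  also have "\<dots> \<le> 64 * (L\<^sup>2 / l\<^sup>2) * \<sigma>\<^sup>2 * (t / N) * 2"
    using N N0 t0 by (intro mult_left_mono) (auto simp: field_simps)
  also have "\<dots> = \<sigma>\<^sup>2 * (640 * (L\<^sup>2 / l\<^sup>2)) * (t / N) / 5" by (simp add: algebra_simps)
  also have "\<dots> \<le> \<sigma>\<^sup>2 * \<zeta> n * (t / N) / 5"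
    using \<zeta> t0 N0 by (intro divide_right_mono mult_right_mono mult_left_mono) auto
  finally show "(norm (stoch n h \<omega>))\<^sup>2 \<le> pen \<zeta> n h \<omega> / 5" by (simp add: D)
qed

text \<open>The oracle inequality holds at every \<open>h\<close> of the grid, so it may be applied
  at the bandwidth that attains the minimum in \<open>oracle_rate\<close>; there the penalty is
  replaced by its deterministic bound.\<close>

lemma good_rate:
  fixes est :: "real \<Rightarrow> 'b"
  assumes good: "good n H \<omega>" and H: "finite H" "H \<noteq> {}" "H \<subseteq> {0<..}" and n: "n \<ge> 2"
    and \<phi>: "\<And>h. h > 0 \<Longrightarrow> phi h > 0" and \<beta>: "0 < \<beta>" and c: "0 \<le> c"
    and \<zeta>: "\<zeta> n \<ge> 640 * (L\<^sup>2 / l\<^sup>2)" "\<zeta> n \<le> Z"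
    and sel: "is_selected_bandwidth H est (\<lambda>h. pen \<zeta> n h \<omega>) hs"
    and err: "\<And>h. h \<in> H \<Longrightarrow> norm (est h - \<theta>) \<le> c * h powr \<beta> + 2 * norm (stoch n h \<omega>)"
  shows "(norm (est hs - \<theta>))\<^sup>2 \<le> (246 * c\<^sup>2 + 120 * \<sigma>\<^sup>2 * Z) * oracle_rate H phi \<beta> n"
proof -
  obtain h where h: "h \<in> H" and rate: "oracle_rate H phi \<beta> n = h powr (2 * \<beta>) + ln n / (n * phi h)"
  proof -
    have "oracle_rate H phi \<beta> n \<in> (\<lambda>h. h powr (2 * \<beta>) + ln n / (n * phi h)) ` H"
      unfolding oracle_rate_def using H by (intro Min_in) auto
    then show ?thesis using that by auto
  qed
  have h0: "h > 0" using h H by auto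
  note b = good_bounds[where \<zeta> = \<zeta>, OF good _ _ n \<phi> \<zeta>(1)]
  have "(norm (est hs - \<theta>))\<^sup>2 \<le> 246 * c\<^sup>2 * h powr (2 * \<beta>) + 60 * pen \<zeta> n h \<omega>"
    using H by (intro selected_bandwidth_oracle[OF H(1,3) sel h c \<beta> _ _ err] b(2)) auto
  also have "60 * pen \<zeta> n h \<omega> \<le> 60 * (2 * \<sigma>\<^sup>2 * \<zeta> n * (ln n / (n * phi h)))"
    using h h0 by (intro mult_left_mono b(3)) auto
  also have "\<dots> = 120 * \<sigma>\<^sup>2 * \<zeta> n * (ln n / (n * phi h))" by simp
  also have "\<dots> \<le> 120 * \<sigma>\<^sup>2 * Z * (ln n / (n * phi h))"
    using \<zeta>(2) n \<phi>[OF h0] by (intro mult_right_mono mult_left_mono) auto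
  also have "246 * c\<^sup>2 * h powr (2 * \<beta>) + 120 * \<sigma>\<^sup>2 * Z * (ln n / (n * phi h))
      \<le> (246 * c\<^sup>2 + 120 * \<sigma>\<^sup>2 * Z) * oracle_rate H phi \<beta> n"
  proof -
    have "0 \<le> Z" using \<zeta> order_trans[of 0 "640 * (L\<^sup>2 / l\<^sup>2)" "\<zeta> n"] by simp
    then have "0 \<le> 120 * \<sigma>\<^sup>2 * Z * h powr (2 * \<beta>)" "0 \<le> 246 * c\<^sup>2 * (ln n / (n * phi h))"
      using n \<phi>[OF h0] by auto
    then show ?thesis unfolding rate by (simp add: algebra_simps)
  qed
  finally show ?thesis by simp
qed

end

section \<open>Asymptotics\<close>

locale adaptive_sample = local_sample M R X Y Xs Ys \<kappa> x K l L \<sigma> h0 \<L> G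
  for M :: "'w measure" and R :: "'r measure"
    and X :: "'w \<Rightarrow> 'c::polish_space" and Y :: "'w \<Rightarrow> 'r"
    and Xs :: "nat \<Rightarrow> 'w \<Rightarrow> 'c" and Ys :: "nat \<Rightarrow> 'w \<Rightarrow> 'r"
    and \<kappa> :: "'c \<Rightarrow> 'r measure" and x :: 'c
    and K :: "real \<Rightarrow> real" and l L \<sigma> h0 :: real
    and \<L> :: "'g::{banach,second_countable_topology} \<Rightarrow> 'b::{banach,second_countable_topology}"
    and G :: "'r \<Rightarrow> 'g" +
  fixes \<beta> \<zeta>0 :: real and \<zeta> :: "nat \<Rightarrow> real" and H :: "nat \<Rightarrow> real set"
  assumes \<phi>_pos: "\<And>h. h > 0 \<Longrightarrow> small_ball_prob M X x h > 0"
    and type2: "type_two TYPE('b)"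
    and \<beta>: "\<beta> > 0"
    and \<zeta>: "\<zeta> \<longlonglongrightarrow> \<zeta>0" "768 * (L\<^sup>2 / l\<^sup>2) \<le> \<zeta>0"
    and H: "\<And>n. n \<ge> 2 \<Longrightarrow> finite (H n) \<and> H n \<noteq> {} \<and> card (H n) \<le> n \<and> H n \<subseteq> {0<..}"
    and H_\<phi>: "\<And>n h. n \<ge> 2 \<Longrightarrow> h \<in> H n \<Longrightarrow>
       (ln (real n))\<^sup>2 / real n \<le> small_ball_prob M X x h \<and> small_ball_prob M X x h \<le> 2 / ln (real n)"
begin

abbreviation "rate n \<equiv> oracle_rate (H n) phi \<beta> n"

lemma phi_pos: "h > 0 \<Longrightarrow> phi h > 0" by (simp add: phi_def \<phi>_pos)

lemma phi_mono: "h \<le> h' \<Longrightarrow> phi h \<le> phi h'"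
  unfolding phi_def small_ball_prob_def by (intro finite_measure_mono) auto

lemma eventually_ln_ge: "\<forall>\<^sub>F n in sequentially. c \<le> ln (real n)"
  using filterlim_compose[OF ln_at_top filterlim_real_sequentially]
  by (simp add: filterlim_at_top)

text \<open>A bandwidth above \<open>r\<close> would have small ball probability at least
  \<open>phi r\<close>, a fixed positive number, while the grid allows at most
  \<open>2 / ln n\<close>. This brings the whole grid within reach of the local hypotheses.\<close>

lemma eventually_bandwidth_le:
  assumes "r > 0"
  shows "\<forall>\<^sub>F n in sequentially. \<forall>h\<in>H n. h \<le> r"
  \<comment> \<open>Taking 3 where 2 is the bound makes \<open>2 / ln n < phi r\<close>
    strict.\<close>
  using eventually_ge_at_top[of 2] eventually_ln_ge[of "3 / phi r"]
proof eventually_elim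
  case (elim n)
  show ?case
  proof
    fix h assume h: "h \<in> H n"
    have pr: "phi r > 0" by (rule phi_pos[OF assms])
    then have ln: "0 < ln (real n)" using elim(2) by (smt (verit) divide_pos_pos)
    have "phi h \<le> 2 / ln (real n)" using H_\<phi>[OF elim(1) h] by (simp add: phi_def)
    also have "\<dots> < phi r" using elim(2) pr ln by (simp add: field_simps)
    finally show "h \<le> r" using phi_mono[of r h] by linarith
  qed
qed

text \<open>The gap between 640, which the good event requires, and 768, a lower bound for the
  limit, leaves room for convergence from below. The upper bound makes the final constant
  independent of \<open>n\<close>.\<close>

lemma eventually_\<zeta>: "\<forall>\<^sub>F n in sequentially. 640 * (L\<^sup>2 / l\<^sup>2) \<le> \<zeta> n \<and> \<zeta> n \<le> \<zeta>0 + 1"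
proof -
  have "640 * (L\<^sup>2 / l\<^sup>2) < 768 * (L\<^sup>2 / l\<^sup>2)"
    using lL by (intro mult_strict_right_mono) auto
  then have "640 * (L\<^sup>2 / l\<^sup>2) < \<zeta>0" using \<zeta>(2) by linarith
  from order_tendstoD(1)[OF \<zeta>(1) this] order_tendstoD(2)[OF \<zeta>(1), of "\<zeta>0 + 1"]
  show ?thesis by (auto elim: eventually_elim2)
qed

lemma ln_sq_le_phi: "n \<ge> 2 \<Longrightarrow> h \<in> H n \<Longrightarrow> (ln (real n))\<^sup>2 \<le> n * phi h"
  using H_\<phi>[of n h] by (simp add: phi_def field_simps)

lemma eventually_prob_not_good:
  "\<forall>\<^sub>F n in sequentially. prob {\<omega> \<in> space M. \<not> good n (H n) \<omega>} \<le> 2 / real n ^ 4"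
proof -
  obtain c0 where c0: "c0 > 0"
    and T: "\<And>(M :: 'w measure) (Z :: nat \<Rightarrow> 'w \<Rightarrow> 'b) n. prob_space M \<Longrightarrow>
      prob_space.indep_vars M (\<lambda>_. borel) Z {1..n} \<Longrightarrow>
      (\<And>i. i \<in> {1..n} \<Longrightarrow> integrable M (\<lambda>\<omega>. (norm (Z i \<omega>))\<^sup>2)) \<Longrightarrow>
      (\<And>i. i \<in> {1..n} \<Longrightarrow> (\<integral>\<omega>. Z i \<omega> \<partial>M) = 0) \<Longrightarrow>
      (\<integral>\<omega>. (norm (\<Sum>i=1..n. Z i \<omega>))\<^sup>2 \<partial>M) \<le> c0 * (\<Sum>i=1..n. (\<integral>\<omega>. (norm (Z i \<omega>))\<^sup>2 \<partial>M))"
    using type_two_sum[OF type2] by blast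
  show ?thesis
    using eventually_ge_at_top[of 2] eventually_ln_ge[of 400] eventually_ln_ge[of "4 * c0"]
      eventually_bandwidth_le[OF h0]
  proof eventually_elim
    case (elim n)
    note Hn = H[OF elim(1)]
    have mean: "expectation (\<lambda>\<omega>. norm (score_sum n h \<omega>)) \<le> L * \<sigma> * sqrt (c0 * (n * phi h))"
      if "h \<in> H n" for h
      using that Hn elim(4)
      by (intro expectation_norm_score_sum[OF _ _ c0 T[OF prob_space_axioms]]) auto
    show ?case
      using elim Hn mean ln_sq_le_phi[OF elim(1)] by (intro prob_not_good[OF _ _ _ _ _ c0]) auto
  qed
qed

text \<open>Small ball probabilities are at most 1. From \<open>ln n \<ge> 1\<close> on,
  contributions of order \<open>1 / n\<close> to the risk are thereby absorbed into the
  rate.\<close>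

lemma rate_ge:
  assumes "n \<ge> 2"
  shows "ln (real n) / n \<le> rate n"
proof -
  have "rate n \<in> (\<lambda>h. h powr (2 * \<beta>) + ln n / (n * phi h)) ` H n"
    unfolding oracle_rate_def using H[OF assms] by (intro Min_in) auto
  then obtain h where h: "h \<in> H n" and r: "rate n = h powr (2 * \<beta>) + ln n / (n * phi h)" by auto
  have "0 < phi h" using h H[OF assms] by (intro phi_pos) auto
  then have "ln (real n) / n \<le> ln n / (n * phi h)"
    using phi_le_1[of h] assms by (intro divide_left_mono) (auto simp: mult_le_cancel_left1)
  then show ?thesis unfolding r by (smt (verit) powr_ge_zero)
qed

lemma rate_pos: "n \<ge> 2 \<Longrightarrow> 0 < rate n"
  by (rule less_le_trans[OF _ rate_ge]) auto

text \<open>The remainder hypothesis applies only where the stochastic term is below a fixed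
  threshold. As \<open>n \<phi> \<ge> (ln n)\<^sup>2\<close>, the penalty is of order
  \<open>1 / ln n\<close> on the good event, uniformly over the grid.\<close>

lemma eventually_stoch_small:
  assumes "\<epsilon> > 0"
  shows "\<forall>\<^sub>F n in sequentially. \<forall>\<omega>. good n (H n) \<omega> \<longrightarrow> (\<forall>h\<in>H n. norm (stoch n h \<omega>) \<le> \<epsilon>)"
proof -
  define c where "c = 2 * \<sigma>\<^sup>2 * (\<zeta>0 + 1) / 5"
  show ?thesis
    using eventually_ge_at_top[of 2] eventually_\<zeta> eventually_ln_ge[of "c / \<epsilon>\<^sup>2"]
  proof eventually_elim
    case (elim n)
    show ?case
    proof (intro allI impI ballI)
      fix \<omega> h assume g: "good n (H n) \<omega>" and h: "h \<in> H n"
      have hp: "h > 0" using h H[OF elim(1)] by auto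
      have t: "0 < ln (real n)" using elim(1) by simp
      have pp: "0 < phi h" by (rule phi_pos[OF hp])
      have z0: "0 \<le> \<zeta> n" using elim(2) order_trans[of 0 "640 * (L\<^sup>2 / l\<^sup>2)" "\<zeta> n"] by simp
      note b = good_bounds[where \<zeta> = \<zeta>, OF g h hp elim(1) pp elim(2)[THEN conjunct1]]
      have "ln n / (n * phi h) \<le> ln n / (ln (real n))\<^sup>2"
        using ln_sq_le_phi[OF elim(1) h] t elim(1) pp by (intro divide_left_mono) auto
      also have "\<dots> = 1 / ln n" using t by (simp add: power2_eq_square)
      finally have q: "ln n / (n * phi h) \<le> 1 / ln n" .
      have "(norm (stoch n h \<omega>))\<^sup>2 \<le> (2 * \<sigma>\<^sup>2 * \<zeta> n * (ln n / (n * phi h))) / 5"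
        using b(2,3) by argo
      also have "\<dots> \<le> (2 * \<sigma>\<^sup>2 * (\<zeta>0 + 1) * (1 / ln n)) / 5"
        using q elim(2) z0 t pp by (intro divide_right_mono mult_mono mult_left_mono) auto
      also have "\<dots> = c / ln n" by (simp add: c_def)
      also have "\<dots> \<le> \<epsilon>\<^sup>2" using elim(3) t assms by (simp add: field_simps)
      finally show "norm (stoch n h \<omega>) \<le> \<epsilon>"
        using assms by (rule power2_le_imp_le[OF _ less_imp_le])
    qed
  qed
qed

text \<open>The bound is stated almost surely because the remainder hypothesis controls the
  remainder up to null sets only.\<close>

lemma eventually_good_rate:
  fixes est :: "nat \<Rightarrow> 'w \<Rightarrow> real \<Rightarrow> 'b"
  assumes c: "0 \<le> c"
    and sel: "\<And>n \<omega>. n \<ge> 2 \<Longrightarrow> \<omega> \<in> space M \<Longrightarrow>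
      is_selected_bandwidth (H n) (est n \<omega>) (\<lambda>h. pen \<zeta> n h \<omega>) (hs n \<omega>)"
    and err: "\<forall>\<^sub>F n in sequentially. AE \<omega> in M. good n (H n) \<omega> \<longrightarrow>
      (\<forall>h\<in>H n. norm (est n \<omega> h - \<theta>) \<le> c * h powr \<beta> + 2 * norm (stoch n h \<omega>))"
  obtains C where "C > 0"
    "\<forall>\<^sub>F n in sequentially. AE \<omega> in M. good n (H n) \<omega> \<longrightarrow>
      (norm (est n \<omega> (hs n \<omega>) - \<theta>))\<^sup>2 \<le> C * rate n"
proof -
  have z: "0 < \<zeta>0" using \<zeta>(2) lL by (smt (verit) divide_pos_pos zero_less_power)
  let ?C = "246 * c\<^sup>2 + 120 * \<sigma>\<^sup>2 * (\<zeta>0 + 1)"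
  have "?C > 0" using z \<sigma> by (intro add_nonneg_pos) auto
  moreover have "\<forall>\<^sub>F n in sequentially. AE \<omega> in M. good n (H n) \<omega> \<longrightarrow>
      (norm (est n \<omega> (hs n \<omega>) - \<theta>))\<^sup>2 \<le> ?C * rate n"
    using eventually_ge_at_top[of 2] eventually_\<zeta> err
  proof eventually_elim
    case (elim n)
    show ?case
      using elim(3) AE_space
    proof eventually_elim
      case (elim \<omega>)
      then show ?case
        using H[OF \<open>2 \<le> n\<close>] \<open>640 * (L\<^sup>2 / l\<^sup>2) \<le> \<zeta> n \<and> \<zeta> n \<le> \<zeta>0 + 1\<close> sel[OF \<open>2 \<le> n\<close> elim(2)] \<open>2 \<le> n\<close>
        by (intro impI good_rate[OF _ _ _ _ _ phi_pos \<beta> c]) auto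
    qed
  qed
  ultimately show thesis by (rule that)
qed

text \<open>One constant serves every \<epsilon>: apart from a null set, exceeding
  \<open>C * rate n\<close> forces the bad event, whose probability tends to zero.\<close>

lemma rate_in_prob:
  fixes est :: "nat \<Rightarrow> 'w \<Rightarrow> real \<Rightarrow> 'b"
  assumes "C > 0"
    and ev: "\<forall>\<^sub>F n in sequentially. AE \<omega> in M. good n (H n) \<omega> \<longrightarrow>
      (norm (est n \<omega> (hs n \<omega>) - \<theta>))\<^sup>2 \<le> C * rate n"
  shows "bigO_in_prob M (\<lambda>n \<omega>. (norm (est n \<omega> (hs n \<omega>) - \<theta>))\<^sup>2) rate"
  unfolding bigO_in_prob_def
proof (intro allI impI exI conjI)
  fix \<epsilon> :: real assume "\<epsilon> > 0"
  have "(\<lambda>n. 2 / real n ^ 4) \<longlonglongrightarrow> 0" by real_asymp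
  from order_tendstoD(2)[OF this \<open>\<epsilon> > 0\<close>]
  have small: "\<forall>\<^sub>F n in sequentially. 2 / real n ^ 4 < \<epsilon>" .
  show "\<forall>\<^sub>F n in sequentially.
    prob {\<omega> \<in> space M. \<bar>(norm (est n \<omega> (hs n \<omega>) - \<theta>))\<^sup>2\<bar> > C * \<bar>rate n\<bar>} \<le> \<epsilon>"
    using small ev eventually_prob_not_good eventually_ge_at_top[of 2]
  proof eventually_elim
    case (elim n)
    have "prob {\<omega> \<in> space M. \<bar>(norm (est n \<omega> (hs n \<omega>) - \<theta>))\<^sup>2\<bar> > C * \<bar>rate n\<bar>}
        \<le> prob {\<omega> \<in> space M. \<not> good n (H n) \<omega>}"
    proof (rule finite_measure_mono_AE)
      show "AE \<omega> in M. \<omega> \<in> {\<omega> \<in> space M. \<bar>(norm (est n \<omega> (hs n \<omega>) - \<theta>))\<^sup>2\<bar> > C * \<bar>rate n\<bar>} \<longrightarrow>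
          \<omega> \<in> {\<omega> \<in> space M. \<not> good n (H n) \<omega>}"
        using elim(2) by eventually_elim (use rate_pos[OF elim(4)] in auto)
      show "{\<omega> \<in> space M. \<not> good n (H n) \<omega>} \<in> sets M"
        using H[OF elim(4)] by (intro good_meas) auto
    qed
    with elim(1,3) show ?case by linarith
  qed
qed (rule assms(1))

text \<open>Cut off at \<open>h0\<close> since noise moments are controlled only there; every
  observation that counts for a bandwidth \<open>h \<le> h0\<close> lies inside. The quantity does
  not involve \<open>h\<close>, so bounds by it survive the insertion of a random bandwidth.\<close>

definition noise_sq :: "nat \<Rightarrow> 'w \<Rightarrow> real" where
  "noise_sq i \<omega> = (if dist x (Xs i \<omega>) \<le> h0 then (norm (noise (Xs i \<omega>) (Ys i \<omega>)))\<^sup>2 else 0)"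

lemma noise_sq_nonneg: "0 \<le> noise_sq i \<omega>" by (simp add: noise_sq_def)

text \<open>The moment hypothesis of order 4, where \<open>fact 4 / 2 = 12\<close>, together with
  \<open>phi h0 \<le> 1\<close>.\<close>

lemma noise_sq_moment:
  assumes i: "i \<ge> 1"
  shows "noise_sq i \<in> borel_measurable M" "integrable M (\<lambda>\<omega>. (noise_sq i \<omega>)\<^sup>2)"
    "expectation (\<lambda>\<omega>. (noise_sq i \<omega>)\<^sup>2) \<le> 12 * \<sigma> ^ 4"
proof -
  let ?u = "\<lambda>p. if dist x (fst p) \<le> h0 then (norm (noise (fst p) (snd p)))\<^sup>2 else 0"
  have u[measurable]: "?u \<in> borel_measurable (borel \<Otimes>\<^sub>M R)" by measurable
  have eq: "noise_sq i \<omega> = ?u (Xs i \<omega>, Ys i \<omega>)" for \<omega> by (simp add: noise_sq_def)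
  have m: "(\<lambda>\<omega>. ?u (Xs i \<omega>, Ys i \<omega>)) \<in> borel_measurable M"
    by (rule measurable_compose[OF sample_meas[OF i] u])
  show m': "noise_sq i \<in> borel_measurable M"
    using m unfolding eq[symmetric] by simp
  have "(\<integral>\<^sup>+\<omega>. ennreal ((noise_sq i \<omega>)\<^sup>2) \<partial>M) = (\<integral>\<^sup>+p. ennreal ((?u p)\<^sup>2) \<partial>obs_law)"
    unfolding eq by (rule nn_integral_sample[OF i]) measurable
  also have "\<dots> \<le> ennreal (phi h0 * (1 * (fact 4 / 2 * \<sigma> ^ 4)))"
    by (rule moment_bound[OF h0 order_refl]) (auto simp: power_mult[symmetric])
  also have "\<dots> \<le> ennreal (12 * \<sigma> ^ 4)"
    using phi_le_1[of h0] \<sigma> phi_nonneg[of h0] by (intro ennreal_leI) (simp add: fact_numeral mult_le_cancel_right1)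
  finally have bd: "(\<integral>\<^sup>+\<omega>. ennreal ((noise_sq i \<omega>)\<^sup>2) \<partial>M) \<le> ennreal (12 * \<sigma> ^ 4)" .
  show int: "integrable M (\<lambda>\<omega>. (noise_sq i \<omega>)\<^sup>2)"
    using m' by (intro integrableI_nonneg le_less_trans[OF bd]) simp_all
  show "expectation (\<lambda>\<omega>. (noise_sq i \<omega>)\<^sup>2) \<le> 12 * \<sigma> ^ 4"
    using bd \<sigma> by (subst (asm) nn_integral_eq_integral[OF int]) simp_all
qed

text \<open>A weighted average is at most the largest noise involved, and its square is at most the
  sum of all squares.\<close>

lemma stoch_le_noise_sq:
  assumes h: "0 < h" "h \<le> h0" and mass: "mass n h \<omega> > 0"
  shows "norm (stoch n h \<omega>) \<le> sqrt (\<Sum>i=1..n. noise_sq i \<omega>)"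
proof (rule norm_stoch_le[OF h(1) mass])
  fix i assume i: "i \<in> {1..n}" and d: "dist x (Xs i \<omega>) \<le> h"
  have "(norm (noise (Xs i \<omega>) (Ys i \<omega>)))\<^sup>2 = noise_sq i \<omega>" using d h by (simp add: noise_sq_def)
  also have "\<dots> \<le> (\<Sum>i=1..n. noise_sq i \<omega>)"
    using i noise_sq_nonneg by (intro member_le_sum) auto
  finally show "norm (noise (Xs i \<omega>) (Ys i \<omega>)) \<le> sqrt (\<Sum>i=1..n. noise_sq i \<omega>)"
    by (rule real_le_rsqrt)
qed

text \<open>The estimates are measurable in \<omega> for each fixed bandwidth. A bandwidth with
  finitely many values is inserted by summing over these values with indicators.\<close>

lemma selected_measurable:
  fixes est :: "'w \<Rightarrow> real \<Rightarrow> 'b"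
  assumes A: "finite A" and hs: "hs \<in> borel_measurable M" and hsA: "\<And>\<omega>. \<omega> \<in> space M \<Longrightarrow> hs \<omega> \<in> A"
    and est: "\<And>h. h \<in> A \<Longrightarrow> (\<lambda>\<omega>. est \<omega> h) \<in> borel_measurable M"
  shows "(\<lambda>\<omega>. est \<omega> (hs \<omega>)) \<in> borel_measurable M"
proof -
  have "(\<lambda>\<omega>. \<Sum>h\<in>A. indicator {\<omega> \<in> space M. hs \<omega> = h} \<omega> *\<^sub>R est \<omega> h) \<in> borel_measurable M"
    using hs est by (intro borel_measurable_sum borel_measurable_scaleR) auto
  also have "?this \<longleftrightarrow> ?thesis"
  proof (rule measurable_cong)
    fix \<omega> assume \<omega>: "\<omega> \<in> space M"
    have "(\<Sum>h\<in>A. indicator {\<omega> \<in> space M. hs \<omega> = h} \<omega> *\<^sub>R est \<omega> h) = (\<Sum>h\<in>A. if h = hs \<omega> then est \<omega> h else 0)"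
      using \<omega> by (intro sum.cong) (auto simp: indicator_def)
    then show "(\<Sum>h\<in>A. indicator {\<omega> \<in> space M. hs \<omega> = h} \<omega> *\<^sub>R est \<omega> h) = est \<omega> (hs \<omega>)"
      using A hsA[OF \<omega>] by simp
  qed
  finally show ?thesis .
qed

lemma bias_le:
  fixes F :: "'c \<Rightarrow> 'v::real_normed_vector"
  assumes h: "h > 0" and mass: "mass n h \<omega> > 0" and b: "0 \<le> b"
    and F: "\<And>z. dist x z \<le> h \<Longrightarrow> norm (F z - F x) \<le> b * dist x z powr \<beta>"
  shows "norm (kernel_average K x (\<lambda>i. Xs i \<omega>) n h (\<lambda>i. F (Xs i \<omega>)) - F x) \<le> b * h powr \<beta>"
proof -
  have "norm (kernel_average K x (\<lambda>i. Xs i \<omega>) n h (\<lambda>i. F (Xs i \<omega>) - F x)) \<le> b * h powr \<beta>"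
  proof (rule norm_kernel_average_le[OF K_nonneg h mass])
    fix i assume "K (inverse h * dist x (Xs i \<omega>)) \<noteq> 0"
    then have d: "dist x (Xs i \<omega>) \<le> h"
      using weight_zero[OF h, of "Xs i \<omega>"] by (force simp: weight_def)
    have "norm (F (Xs i \<omega>) - F x) \<le> b * dist x (Xs i \<omega>) powr \<beta>" by (rule F[OF d])
    also have "\<dots> \<le> b * h powr \<beta>"
      using d b \<beta> by (intro mult_left_mono powr_mono2) auto
    finally show "norm (F (Xs i \<omega>) - F x) \<le> b * h powr \<beta>" .
  qed auto
  then show ?thesis using mass by (simp add: kernel_average_diff_const)
qed

lemma kernel_average_meas:
  fixes f :: "'r \<Rightarrow> 'v::{banach,second_countable_topology}"
  assumes h: "h > 0" and f: "f \<in> borel_measurable R"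
  shows "(\<lambda>\<omega>. kernel_average K x (\<lambda>i. Xs i \<omega>) n h (\<lambda>i. f (Ys i \<omega>))) \<in> borel_measurable M"
proof -
  have w: "(\<lambda>\<omega>. K (inverse h * dist x (Xs i \<omega>))) \<in> borel_measurable M" if "i \<in> {1..n}" for i
    using measurable_compose[OF Xs_meas weight_meas[OF h], of i] that by (simp add: weight_def)
  have y: "(\<lambda>\<omega>. f (Ys i \<omega>)) \<in> borel_measurable M" if "i \<in> {1..n}" for i
    using measurable_compose[OF Ys_meas f, of i] that by simp
  show ?thesis
    unfolding kernel_average_def kernel_mass_def
    using w y by (intro borel_measurable_scaleR borel_measurable_inverse borel_measurable_sum) auto
qed

text \<open>The squared error is split over the good event, where \<open>ev\<close> applies, and the
  bad one, where \<open>crude\<close> does. The constant \<open>B\<close> collects what is not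
  stochastic in the error, and the noise sum is free of the bandwidth.\<close>

lemma rate_in_mean:
  fixes est :: "nat \<Rightarrow> 'w \<Rightarrow> real \<Rightarrow> 'b"
  assumes C: "C > 0"
    and ev: "\<forall>\<^sub>F n in sequentially. AE \<omega> in M. good n (H n) \<omega> \<longrightarrow>
      (norm (est n \<omega> (hs n \<omega>) - \<theta>))\<^sup>2 \<le> C * rate n"
    and crude: "\<forall>\<^sub>F n in sequentially. \<forall>\<omega>\<in>space M.
      norm (est n \<omega> (hs n \<omega>) - \<theta>) \<le> B + sqrt (\<Sum>i=1..n. noise_sq i \<omega>)"
    and meas: "\<And>n. n \<ge> 2 \<Longrightarrow> (\<lambda>\<omega>. est n \<omega> (hs n \<omega>)) \<in> borel_measurable M"
  shows "\<forall>\<^sub>F n in sequentially. integrable M (\<lambda>\<omega>. (norm (est n \<omega> (hs n \<omega>) - \<theta>))\<^sup>2)"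
    and "(\<lambda>n. expectation (\<lambda>\<omega>. (norm (est n \<omega> (hs n \<omega>) - \<theta>))\<^sup>2)) \<in> O(rate)"
proof -
  let ?e = "\<lambda>n \<omega>. (norm (est n \<omega> (hs n \<omega>) - \<theta>))\<^sup>2"
  \<comment> \<open>The bad event contributes at most \<open>(2 * B\<^sup>2 + 2 * n ^ 3) * (2 / n ^
    4) \<le> (4 * B\<^sup>2 + 4) / n\<close>, the fourth moments \<open>2 / n\<^sup>2 * (n * 12 *
    \<sigma> ^ 4) = 24 * \<sigma> ^ 4 / n\<close>.\<close>
  define C' where "C' = C + 4 * B\<^sup>2 + 4 + 24 * \<sigma> ^ 4"
  have "\<forall>\<^sub>F n in sequentially. integrable M (?e n) \<and> expectation (?e n) \<le> C' * rate n"
    using ev crude eventually_prob_not_good eventually_ge_at_top[of 2] eventually_ln_ge[of 1]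
  proof eventually_elim
    case (elim n)
    let ?bad = "{\<omega> \<in> space M. \<not> good n (H n) \<omega>}"
    have bad[measurable]: "?bad \<in> sets M" using H[OF elim(4)] by (intro good_meas) auto
    let ?U = "\<lambda>\<omega>. \<Sum>i=1..n. noise_sq i \<omega>"
    \<comment> \<open>The last summand of the majorant carries no indicator. Noise and bad event are
      dependent, so it is integrated over the whole space, where the factor
      \<open>2 / n\<^sup>2\<close> already makes it of order \<open>1 / n\<close>.\<close>
    let ?g = "\<lambda>\<omega>. C * rate n + (2 * B\<^sup>2 + 2 * real n ^ 3) * indicator ?bad \<omega>
        + 2 / (real n)\<^sup>2 * (\<Sum>i=1..n. (noise_sq i \<omega>)\<^sup>2)"
    have n0: "real n > 0" using elim(4) by simp
    have r0: "0 < rate n" by (rule rate_pos[OF elim(4)])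
    have int_sum: "integrable M (\<lambda>\<omega>. \<Sum>i=1..n. (noise_sq i \<omega>)\<^sup>2)"
      using noise_sq_moment(2) by (intro Bochner_Integration.integrable_sum) auto
    have int_ind: "integrable M (indicator ?bad :: 'w \<Rightarrow> real)"
      by (rule integrable_real_indicator) (auto simp: emeasure_eq_measure)
    have int_g: "integrable M ?g"
      using int_sum int_ind by (intro Bochner_Integration.integrable_add integrable_mult_right) auto
    have le: "AE \<omega> in M. ?e n \<omega> \<le> ?g \<omega>"
      using elim(1) AE_space
    proof eventually_elim
      case w: (elim \<omega>)
      have S0: "0 \<le> 2 / (real n)\<^sup>2 * (\<Sum>i=1..n. (noise_sq i \<omega>)\<^sup>2)"
        by (intro mult_nonneg_nonneg sum_nonneg) auto
      show ?case
      proof (cases "good n (H n) \<omega>")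
        case True
        then show ?thesis using w S0 by (simp add: indicator_def)
      next
        case False
        have U0: "0 \<le> ?U \<omega>" by (intro sum_nonneg noise_sq_nonneg)
        have "?e n \<omega> \<le> (B + sqrt (?U \<omega>))\<^sup>2" using elim(2) w by (intro power_mono) auto
        also have "\<dots> \<le> 2 * B\<^sup>2 + 2 * (sqrt (?U \<omega>))\<^sup>2"
          using zero_le_power2[of "B - sqrt (?U \<omega>)"] by (simp add: power2_eq_square algebra_simps)
        also have "(sqrt (?U \<omega>))\<^sup>2 = ?U \<omega>" using U0 by simp
        \<comment> \<open>AM-GM: \<open>2 u \<le> n\<^sup>2 + u\<^sup>2 / n\<^sup>2\<close>, balanced against a bad event of probability \<open>2 / n ^ 4\<close>.\<close>
        also have "?U \<omega> \<le> (\<Sum>i=1..n. (real n)\<^sup>2 + (noise_sq i \<omega>)\<^sup>2 / (real n)\<^sup>2)"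
        proof (rule sum_mono)
          fix i
          have "0 \<le> (real n - noise_sq i \<omega> / n)\<^sup>2" by simp
          also have "\<dots> = (real n)\<^sup>2 + (noise_sq i \<omega>)\<^sup>2 / (real n)\<^sup>2 - 2 * noise_sq i \<omega>"
            using n0 by (simp add: power2_diff power_divide)
          finally show "noise_sq i \<omega> \<le> (real n)\<^sup>2 + (noise_sq i \<omega>)\<^sup>2 / (real n)\<^sup>2"
            using noise_sq_nonneg[of i \<omega>] by linarith
        qed
        also have "\<dots> = real n ^ 3 + 1 / (real n)\<^sup>2 * (\<Sum>i=1..n. (noise_sq i \<omega>)\<^sup>2)"
          by (simp add: sum.distrib sum_divide_distrib power3_eq_cube power2_eq_square)
        finally have "?e n \<omega> \<le> 2 * B\<^sup>2 + 2 * real n ^ 3 + 2 / (real n)\<^sup>2 * (\<Sum>i=1..n. (noise_sq i \<omega>)\<^sup>2)"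
          by simp
        moreover have "0 \<le> C * rate n" using C r0 by simp
        ultimately show ?thesis using False w by (simp add: indicator_def)
      qed
    qed
    have meas_e: "?e n \<in> borel_measurable M" using meas[OF elim(4)] by simp
    have int_e: "integrable M (?e n)"
      by (rule Bochner_Integration.integrable_bound[OF int_g meas_e])
        (use le in \<open>eventually_elim, simp\<close>)
    have "expectation (?e n) \<le> expectation ?g"
      by (rule integral_mono_AE[OF int_e int_g le])
    also have "\<dots> = C * rate n + (2 * B\<^sup>2 + 2 * real n ^ 3) * prob ?bad
        + 2 / (real n)\<^sup>2 * (\<Sum>i=1..n. expectation (\<lambda>\<omega>. (noise_sq i \<omega>)\<^sup>2))"
    proof -
      have "expectation (\<lambda>\<omega>. \<Sum>i=1..n. (noise_sq i \<omega>)\<^sup>2) = (\<Sum>i=1..n. expectation (\<lambda>\<omega>. (noise_sq i \<omega>)\<^sup>2))"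
        using noise_sq_moment(2) by (intro Bochner_Integration.integral_sum) auto
      moreover have "expectation ?g = expectation (\<lambda>_. C * rate n)
          + expectation (\<lambda>\<omega>. (2 * B\<^sup>2 + 2 * real n ^ 3) * indicator ?bad \<omega>)
          + expectation (\<lambda>\<omega>. 2 / (real n)\<^sup>2 * (\<Sum>i=1..n. (noise_sq i \<omega>)\<^sup>2))"
        using int_sum int_ind
        by (subst Bochner_Integration.integral_add
            | intro Bochner_Integration.integrable_add integrable_mult_right | simp)+
      ultimately show ?thesis
        using sets.sets_into_space[OF bad] by (simp add: prob_space Int_absorb2)
    qed
    also have "\<dots> \<le> C * rate n + (2 * B\<^sup>2 + 2 * real n ^ 3) * (2 / real n ^ 4)
        + 2 / (real n)\<^sup>2 * (\<Sum>i=1..n. 12 * \<sigma> ^ 4)"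
      using noise_sq_moment(3) elim(3)
      by (intro add_mono mult_left_mono sum_mono order_refl) auto
    also have "\<dots> = C * rate n + (4 * B\<^sup>2 / real n ^ 3 + 4 + 24 * \<sigma> ^ 4) * (1 / n)"
      using n0 by (simp add: field_simps eval_nat_numeral)
    also have "\<dots> \<le> C * rate n + (4 * B\<^sup>2 + 4 + 24 * \<sigma> ^ 4) * rate n"
    proof (intro add_left_mono add_right_mono mult_mono)
      have "1 \<le> real n ^ 3" using elim(4) by (intro one_le_power) auto
      then show "4 * B\<^sup>2 / real n ^ 3 \<le> 4 * B\<^sup>2"
        using n0 by (simp add: divide_le_eq mult_le_cancel_left1)
      have "1 / real n \<le> ln n / n" using elim(5) n0 by (intro divide_right_mono) auto
      then show "1 / real n \<le> rate n" using rate_ge[OF elim(4)] by linarith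
    qed (use \<sigma> in auto)
    also have "\<dots> = C' * rate n" by (simp add: C'_def algebra_simps)
    finally show ?case using int_e by simp
  qed note fin = this
  show "\<forall>\<^sub>F n in sequentially. integrable M (?e n)"
    using fin by eventually_elim simp
  show "(\<lambda>n. expectation (?e n)) \<in> O(rate)"
  proof (rule bigoI[of _ C'])
    show "\<forall>\<^sub>F n in sequentially. norm (expectation (?e n)) \<le> C' * norm (rate n)"
      using fin eventually_ge_at_top[of 2]
    proof eventually_elim
      case (elim n)
      then show ?case using rate_pos[OF elim(2)] by simp
    qed
  qed
qed

end

section \<open>Radii for the local hypotheses, and the proof of the two claims\<close>

lemma conditional_moment_boundE:
  assumes "conditional_moment_bound \<kappa> \<L> G (x::'c::metric_space) \<sigma>"
  obtains h0 where "h0 > 0" "\<And>z. dist x z \<le> h0 \<Longrightarrow> integrable (\<kappa> z) G"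
    "\<And>z k. dist x z \<le> h0 \<Longrightarrow> k \<ge> 2 \<Longrightarrow>
      (\<integral>\<^sup>+ y. ennreal (norm (\<L> (G y - (\<integral>y'. G y' \<partial>\<kappa> z))) ^ k) \<partial>\<kappa> z) \<le> ennreal (fact k / 2 * \<sigma> ^ k)"
proof -
  obtain d where d: "d > 0" and D: "\<And>z. dist z x < d \<Longrightarrow> integrable (\<kappa> z) G \<and>
       (\<forall>k\<ge>2. (\<integral>\<^sup>+ y. ennreal (norm (\<L> (G y - (\<integral>y'. G y' \<partial>\<kappa> z))) ^ k) \<partial>\<kappa> z)
                \<le> ennreal (fact k / 2 * \<sigma> ^ k))"
    using assms unfolding conditional_moment_bound_def eventually_nhds_metric by blast
  \<comment> \<open>Half the radius, so that the closed ball lies in the open one.\<close>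
  have D': "integrable (\<kappa> z) G \<and>
       (\<forall>k\<ge>2. (\<integral>\<^sup>+ y. ennreal (norm (\<L> (G y - (\<integral>y'. G y' \<partial>\<kappa> z))) ^ k) \<partial>\<kappa> z)
                \<le> ennreal (fact k / 2 * \<sigma> ^ k))" if "dist x z \<le> d / 2" for z
    using that d by (intro D) (simp add: dist_commute)
  show thesis
    by (rule that[of "d / 2"]) (use d D' in auto)
qed

lemma holder_atE:
  assumes "holder_at F x \<beta>"
  obtains b r where "b > 0" "r > 0" "\<And>z. dist x z \<le> r \<Longrightarrow> norm (F z - F x) \<le> b * dist x z powr \<beta>"
proof -
  obtain b d where b: "b > 0" and d: "d > 0" and D: "\<And>z. dist z x < d \<Longrightarrow> norm (F z - F x) \<le> b * dist x z powr \<beta>"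
    using assms unfolding holder_at_def eventually_nhds_metric by blast
  have "norm (F z - F x) \<le> b * dist x z powr \<beta>" if "dist x z \<le> d / 2" for z
    using that d by (intro D) (simp add: dist_commute)
  then show thesis using that[of b "d / 2"] b d by simp
qed

theorem theorem10:
  fixes M :: "'w measure" and R :: "'r measure"
    and X :: "'w \<Rightarrow> 'c::polish_space" and Y :: "'w \<Rightarrow> 'r"
    and Xs :: "nat \<Rightarrow> 'w \<Rightarrow> 'c" and Ys :: "nat \<Rightarrow> 'w \<Rightarrow> 'r"
    and \<kappa> :: "'c \<Rightarrow> 'r measure" and x :: 'c
    and K :: "real \<Rightarrow> real" and l L \<beta> \<sigma> \<zeta>0 \<epsilon>0 :: real
    and \<zeta> :: "nat \<Rightarrow> real" and H :: "nat \<Rightarrow> real set"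
    and F :: "'c \<Rightarrow> 'g::{banach,second_countable_topology}" and G :: "'r \<Rightarrow> 'g"
    and \<L> :: "'g \<Rightarrow> 'b::{banach,second_countable_topology}"
    and T :: "'r measure \<Rightarrow> 'b" and \<Psi> :: "'r \<Rightarrow> 'b"
    and hstar hstar' :: "nat \<Rightarrow> 'w \<Rightarrow> real"
  defines "\<phi> \<equiv> small_ball_prob M X x"
    and "Theta_hat \<equiv> \<lambda>n \<omega> h. T (weighted_empirical R K x (\<lambda>i. Xs i \<omega>) (\<lambda>i. Ys i \<omega>) n h)"
    and "Mean_hat \<equiv> \<lambda>n \<omega> h. kernel_average K x (\<lambda>i. Xs i \<omega>) n h (\<lambda>i. \<Psi> (Ys i \<omega>))"
    and "V \<equiv> \<lambda>n \<omega> h. stochastic_term K \<kappa> \<L> G x (\<lambda>i. Xs i \<omega>) (\<lambda>i. Ys i \<omega>) n h"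
    and "Rem \<equiv> \<lambda>n \<omega> h. remainder_term R K \<kappa> T \<L> F G x (\<lambda>i. Xs i \<omega>) (\<lambda>i. Ys i \<omega>) n h"
    and "D \<equiv> \<lambda>n \<omega> h. penalty \<sigma> \<zeta> x (\<lambda>i. Xs i \<omega>) n h"
    and "lam \<equiv> \<lambda>n. oracle_rate (H n) (small_ball_prob M X x) \<beta> n"
  assumes "prob_space M"
    and XY: "(\<lambda>\<omega>. (X \<omega>, Y \<omega>)) \<in> M \<rightarrow>\<^sub>M borel \<Otimes>\<^sub>M R"
    and indep: "prob_space.indep_vars M (\<lambda>_. borel \<Otimes>\<^sub>M R) (\<lambda>i \<omega>. (Xs i \<omega>, Ys i \<omega>)) {1..}"
    and copies: "\<And>i. i \<ge> 1 \<Longrightarrow> distr M (borel \<Otimes>\<^sub>M R) (\<lambda>\<omega>. (Xs i \<omega>, Ys i \<omega>)) =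
                                    distr M (borel \<Otimes>\<^sub>M R) (\<lambda>\<omega>. (X \<omega>, Y \<omega>))"
    and \<kappa>: "regular_cond_distr M X R Y \<kappa>"
    and \<phi>_pos: "\<And>h. h > 0 \<Longrightarrow> \<phi> h > 0"
    and type2: "type_two TYPE('b)"
    and basis: "has_schauder_basis TYPE('b)"
    and K_meas: "K \<in> borel_measurable (restrict_space borel {0..})"
    and K_nonneg: "\<And>u. u \<ge> 0 \<Longrightarrow> K u \<ge> 0"
    and lL: "0 < l" "l \<le> L"
    and K_bounds: "\<And>u. 0 \<le> u \<Longrightarrow> u \<le> 1 \<Longrightarrow> l \<le> K u \<and> K u \<le> L"
    and K_zero: "\<And>u. u > 1 \<Longrightarrow> K u = 0"
    and \<beta>: "\<beta> > 0" and \<sigma>: "\<sigma> > 0"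
    and \<epsilon>0: "0 < \<epsilon>0" "\<epsilon>0 < 0.5"
    and \<zeta>: "\<And>n. \<zeta> n > 0" "\<zeta> \<longlonglongrightarrow> \<zeta>0" "\<zeta>0 > 0"
            "\<zeta>0 \<ge> 768 * ((1 + \<epsilon>0)\<^sup>2 / (1 - \<epsilon>0) ^ 4) * (L\<^sup>2 / l\<^sup>2)"
    and H: "\<And>n. n \<ge> 2 \<Longrightarrow> finite (H n) \<and> H n \<noteq> {} \<and> card (H n) \<le> n \<and> H n \<subseteq> {0<..}"
    and H_\<phi>: "\<And>n h. n \<ge> 2 \<Longrightarrow> h \<in> H n \<Longrightarrow>
                 (ln (real n))\<^sup>2 / real n \<le> \<phi> h \<and> \<phi> h \<le> 2 / ln (real n)"
  shows
    "(F \<in> borel_measurable borel \<longrightarrow>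
      G \<in> borel_measurable R \<longrightarrow>
      bounded_linear \<L> \<longrightarrow>
      (\<forall>n\<ge>1. \<forall>h>0. (\<lambda>\<omega>. Theta_hat n \<omega> h) \<in> borel_measurable M) \<longrightarrow>
      holder_at F x \<beta> \<longrightarrow>
      conditional_moment_bound \<kappa> \<L> G x \<sigma> \<longrightarrow>
      (\<exists>\<epsilon>1>0. \<exists>\<epsilon>2>0. \<exists>M'>0. \<forall>n\<ge>1. \<forall>h. 0 < h \<longrightarrow> h \<le> \<epsilon>1 \<longrightarrow>
         (AE \<omega> in M. kernel_mass K x (\<lambda>i. Xs i \<omega>) n h > 0 \<longrightarrow> norm (V n \<omega> h) \<le> \<epsilon>2 \<longrightarrow>
            (norm (Rem n \<omega> h))\<^sup>2 \<le> M' * h powr (2 * \<beta>) + (norm (V n \<omega> h))\<^sup>2)) \<longrightarrow>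
      (\<forall>n\<ge>2. hstar n \<in> borel_measurable M \<and>
         (\<forall>\<omega>\<in>space M. is_selected_bandwidth (H n) (Theta_hat n \<omega>) (D n \<omega>) (hstar n \<omega>))) \<longrightarrow>
      bigO_in_prob M (\<lambda>n \<omega>. (norm (Theta_hat n \<omega> (hstar n \<omega>) - T (\<kappa> x)))\<^sup>2) lam)
     \<and>
     (\<Psi> \<in> borel_measurable R \<longrightarrow>
      holder_at (\<lambda>z. \<integral>y. \<Psi> y \<partial>\<kappa> z) x \<beta> \<longrightarrow>
      conditional_moment_bound \<kappa> (\<lambda>v. v) \<Psi> x \<sigma> \<longrightarrow>
      (\<forall>n\<ge>2. hstar' n \<in> borel_measurable M \<and>
         (\<forall>\<omega>\<in>space M. is_selected_bandwidth (H n) (Mean_hat n \<omega>) (D n \<omega>) (hstar' n \<omega>))) \<longrightarrow>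
      (\<forall>\<^sub>F n in sequentially.
         integrable M (\<lambda>\<omega>. (norm (Mean_hat n \<omega> (hstar' n \<omega>) - (\<integral>y. \<Psi> y \<partial>\<kappa> x)))\<^sup>2)) \<and>
      (\<lambda>n. \<integral>\<omega>. (norm (Mean_hat n \<omega> (hstar' n \<omega>) - (\<integral>y. \<Psi> y \<partial>\<kappa> x)))\<^sup>2 \<partial>M) \<in> O(lam))"
proof (intro conjI impI)
  interpret prob_space M by fact
  have \<zeta>_big: "768 * (L\<^sup>2 / l\<^sup>2) \<le> \<zeta>0"
  proof -
    have "(1 - \<epsilon>0) ^ 4 \<le> 1" using \<epsilon>0 by (intro power_le_one) auto
    moreover have "1 \<le> (1 + \<epsilon>0)\<^sup>2" using \<epsilon>0 by (intro one_le_power) auto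
    moreover have "0 < (1 - \<epsilon>0) ^ 4" using \<epsilon>0 by simp
    ultimately have "1 \<le> (1 + \<epsilon>0)\<^sup>2 / (1 - \<epsilon>0) ^ 4" by (simp add: le_divide_eq)
    then have "768 * 1 * (L\<^sup>2 / l\<^sup>2) \<le> 768 * ((1 + \<epsilon>0)\<^sup>2 / (1 - \<epsilon>0) ^ 4) * (L\<^sup>2 / l\<^sup>2)"
      by (intro mult_right_mono mult_left_mono) auto
    then show ?thesis using \<zeta>(4) by simp
  qed
  {
    assume F: "F \<in> borel_measurable borel" and G: "G \<in> borel_measurable R"
      and lin: "bounded_linear \<L>"
      and hol: "holder_at F x \<beta>" and mom: "conditional_moment_bound \<kappa> \<L> G x \<sigma>"
      and remainder: "\<exists>\<epsilon>1>0. \<exists>\<epsilon>2>0. \<exists>M'>0. \<forall>n\<ge>1. \<forall>h. 0 < h \<longrightarrow> h \<le> \<epsilon>1 \<longrightarrow>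
         (AE \<omega> in M. kernel_mass K x (\<lambda>i. Xs i \<omega>) n h > 0 \<longrightarrow> norm (V n \<omega> h) \<le> \<epsilon>2 \<longrightarrow>
            (norm (Rem n \<omega> h))\<^sup>2 \<le> M' * h powr (2 * \<beta>) + (norm (V n \<omega> h))\<^sup>2)"
      and sel: "\<forall>n\<ge>2. hstar n \<in> borel_measurable M \<and>
         (\<forall>\<omega>\<in>space M. is_selected_bandwidth (H n) (Theta_hat n \<omega>) (D n \<omega>) (hstar n \<omega>))"
    obtain h0 where h0: "h0 > 0"
      and ci: "\<And>z. dist x z \<le> h0 \<Longrightarrow> integrable (\<kappa> z) G"
      and cm: "\<And>z k. dist x z \<le> h0 \<Longrightarrow> k \<ge> 2 \<Longrightarrow>
        (\<integral>\<^sup>+ y. ennreal (norm (\<L> (G y - (\<integral>y'. G y' \<partial>\<kappa> z))) ^ k) \<partial>\<kappa> z) \<le> ennreal (fact k / 2 * \<sigma> ^ k)"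
      by (rule conditional_moment_boundE[OF mom]) blast
    obtain b r where b: "b > 0" and r: "r > 0"
      and Fb: "\<And>z. dist x z \<le> r \<Longrightarrow> norm (F z - F x) \<le> b * dist x z powr \<beta>"
      by (rule holder_atE[OF hol]) blast
    obtain \<epsilon>1 \<epsilon>2 M' where \<epsilon>: "\<epsilon>1 > 0" "\<epsilon>2 > 0" "M' > 0"
      and Rb: "\<And>n h. n \<ge> 1 \<Longrightarrow> 0 < h \<Longrightarrow> h \<le> \<epsilon>1 \<Longrightarrow>
         (AE \<omega> in M. kernel_mass K x (\<lambda>i. Xs i \<omega>) n h > 0 \<longrightarrow> norm (V n \<omega> h) \<le> \<epsilon>2 \<longrightarrow>
            (norm (Rem n \<omega> h))\<^sup>2 \<le> M' * h powr (2 * \<beta>) + (norm (V n \<omega> h))\<^sup>2)"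
      using remainder by blast
    interpret A: adaptive_sample M R X Y Xs Ys \<kappa> x K l L \<sigma> h0 \<L> G \<beta> \<zeta>0 \<zeta> H
      by (intro adaptive_sample.intro local_sample.intro local_sample_axioms.intro
          adaptive_sample_axioms.intro) (fact \<phi>_pos[unfolded \<phi>_def] H_\<phi>[unfolded \<phi>_def] \<zeta>(2) lL ci cm | fact)+
    obtain B where B: "B \<ge> 0" and LB: "\<And>v. norm (\<L> v) \<le> norm v * B"
      using bounded_linear.nonneg_bounded[OF lin] by blast
    \<comment> \<open>\<open>b * B\<close> bounds the bias through the operator bound
      \<open>B\<close> of \<L>; \<open>sqrt M'\<close> comes from taking the root of the remainder
      hypothesis, \<open>sqrt (M' h\<^sup>2 + v\<^sup>2) \<le> sqrt M' h + v\<close>, with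
      \<open>h powr \<beta>\<close> in place of \<open>h\<close>.\<close>
    define c where "c = b * B + sqrt M'"
    have c0: "0 \<le> c" using b B \<epsilon> by (simp add: c_def)
    have err: "\<forall>\<^sub>F n in sequentially. AE \<omega> in M. A.good n (H n) \<omega> \<longrightarrow>
      (\<forall>h\<in>H n. norm (Theta_hat n \<omega> h - T (\<kappa> x)) \<le> c * h powr \<beta> + 2 * norm (V n \<omega> h))"
      using eventually_ge_at_top[of 2] A.eventually_bandwidth_le[OF \<epsilon>(1)] A.eventually_bandwidth_le[OF r]
        A.eventually_stoch_small[OF \<epsilon>(2)] A.eventually_\<zeta>
    proof eventually_elim
      case (elim n)
      \<comment> \<open>Each bandwidth has its own exceptional null set. The grid is finite, so one
        null set serves all, and the bound may later be used at the random bandwidth.\<close>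
      have "AE \<omega> in M. \<forall>h\<in>H n. kernel_mass K x (\<lambda>i. Xs i \<omega>) n h > 0 \<longrightarrow> norm (V n \<omega> h) \<le> \<epsilon>2 \<longrightarrow>
            (norm (Rem n \<omega> h))\<^sup>2 \<le> M' * h powr (2 * \<beta>) + (norm (V n \<omega> h))\<^sup>2"
        using H[OF elim(1)] elim(1,2) by (intro AE_finite_allI Rb) auto
      then show ?case
      proof eventually_elim
        case w: (elim \<omega>)
        show ?case
        proof (intro impI ballI)
          fix h assume g: "A.good n (H n) \<omega>" and h: "h \<in> H n"
          have hp: "h > 0" using h H[OF elim(1)] by auto
          \<comment> \<open>On the good event the ball contains observations. Positive mass is the
            guard of the remainder hypothesis, and the bias bound relies on it as well.\<close>
          have mass: "kernel_mass K x (\<lambda>i. Xs i \<omega>) n h > 0"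
            by (rule A.good_bounds(1)[where \<zeta> = \<zeta>, OF g h hp elim(1) A.phi_pos[OF hp] elim(5)[THEN conjunct1]])
          have Vs: "norm (V n \<omega> h) \<le> \<epsilon>2" using elim(4) g h unfolding V_def by blast
          have "(norm (Rem n \<omega> h))\<^sup>2 \<le> M' * h powr (2 * \<beta>) + (norm (V n \<omega> h))\<^sup>2"
            using w h mass Vs by blast
          also have "\<dots> \<le> (sqrt M' * h powr \<beta> + norm (V n \<omega> h))\<^sup>2"
          proof -
            have "(sqrt M' * h powr \<beta>)\<^sup>2 = M' * h powr (2 * \<beta>)"
              using \<epsilon> by (simp add: power_mult_distrib power2_eq_square[of "h powr \<beta>"] powr_add[symmetric])
            moreover have "0 \<le> sqrt M' * h powr \<beta> * norm (V n \<omega> h)" using \<epsilon> by simp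
            ultimately show ?thesis by (simp add: power2_sum)
          qed
          finally have rem: "norm (Rem n \<omega> h) \<le> sqrt M' * h powr \<beta> + norm (V n \<omega> h)"
            by (rule power2_le_imp_le) (use \<epsilon> in simp)
          let ?B = "bias_term K \<L> F x (\<lambda>i. Xs i \<omega>) n h"
          have "norm ?B \<le> norm (kernel_average K x (\<lambda>i. Xs i \<omega>) n h (\<lambda>i. F (Xs i \<omega>)) - F x) * B"
            unfolding bias_term_def by (rule LB)
          also have "\<dots> \<le> b * h powr \<beta> * B"
            using B b elim(3) h hp mass by (intro mult_right_mono A.bias_le Fb) auto
          finally have bias: "norm ?B \<le> b * B * h powr \<beta>" by (simp add: algebra_simps)
          have "Theta_hat n \<omega> h - T (\<kappa> x) = ?B + V n \<omega> h + Rem n \<omega> h"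
            unfolding Theta_hat_def V_def Rem_def remainder_term_def by simp
          then have "norm (Theta_hat n \<omega> h - T (\<kappa> x)) \<le> norm ?B + norm (V n \<omega> h) + norm (Rem n \<omega> h)"
            using norm_triangle_ineq[of "?B + V n \<omega> h" "Rem n \<omega> h"] norm_triangle_ineq[of ?B "V n \<omega> h"]
            by simp
          also have "\<dots> \<le> c * h powr \<beta> + 2 * norm (V n \<omega> h)"
            using bias rem by (simp add: c_def distrib_right)
          finally show "norm (Theta_hat n \<omega> h - T (\<kappa> x)) \<le> c * h powr \<beta> + 2 * norm (V n \<omega> h)" .
        qed
      qed
    qed
    obtain C where C: "C > 0" and ev: "\<forall>\<^sub>F n in sequentially. AE \<omega> in M. A.good n (H n) \<omega> \<longrightarrow>
      (norm (Theta_hat n \<omega> (hstar n \<omega>) - T (\<kappa> x)))\<^sup>2 \<le> C * A.rate n"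
    proof (rule A.eventually_good_rate[OF c0 _ err[unfolded V_def]])
      show "is_selected_bandwidth (H n) (Theta_hat n \<omega>) (\<lambda>h. A.pen \<zeta> n h \<omega>) (hstar n \<omega>)"
        if "2 \<le> n" "\<omega> \<in> space M" for n \<omega>
        using sel that unfolding D_def by blast
    qed
    show "bigO_in_prob M (\<lambda>n \<omega>. (norm (Theta_hat n \<omega> (hstar n \<omega>) - T (\<kappa> x)))\<^sup>2) lam"
      using A.rate_in_prob[where est = Theta_hat and hs = hstar, OF C ev] unfolding lam_def A.phi_def .
  next
    assume \<Psi>: "\<Psi> \<in> borel_measurable R"
      and hol: "holder_at (\<lambda>z. \<integral>y. \<Psi> y \<partial>\<kappa> z) x \<beta>"
      and mom: "conditional_moment_bound \<kappa> (\<lambda>v. v) \<Psi> x \<sigma>"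
      and sel: "\<forall>n\<ge>2. hstar' n \<in> borel_measurable M \<and>
         (\<forall>\<omega>\<in>space M. is_selected_bandwidth (H n) (Mean_hat n \<omega>) (D n \<omega>) (hstar' n \<omega>))"
    let ?F = "\<lambda>z. \<integral>y. \<Psi> y \<partial>\<kappa> z"
    obtain h1 where h1: "h1 > 0"
      and ci: "\<And>z. dist x z \<le> h1 \<Longrightarrow> integrable (\<kappa> z) \<Psi>"
      and cm: "\<And>z k. dist x z \<le> h1 \<Longrightarrow> k \<ge> 2 \<Longrightarrow>
        (\<integral>\<^sup>+ y. ennreal (norm (\<Psi> y - (\<integral>y'. \<Psi> y' \<partial>\<kappa> z)) ^ k) \<partial>\<kappa> z) \<le> ennreal (fact k / 2 * \<sigma> ^ k)"
      by (rule conditional_moment_boundE[OF mom]) blast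
    obtain b r where b: "b > 0" and r: "r > 0"
      and Fb: "\<And>z. dist x z \<le> r \<Longrightarrow> norm (?F z - ?F x) \<le> b * dist x z powr \<beta>"
      by (rule holder_atE[OF hol]) blast
    \<comment> \<open>The two radii are merged because the crude bound needs the bias bound and the
      noise bound at the same bandwidth.\<close>
    define h0 where "h0 = min h1 r"
    have h0: "h0 > 0" using h1 r by (simp add: h0_def)
    interpret A: adaptive_sample M R X Y Xs Ys \<kappa> x K l L \<sigma> h0 "\<lambda>v. v" \<Psi> \<beta> \<zeta>0 \<zeta> H
    proof (intro adaptive_sample.intro local_sample.intro local_sample_axioms.intro
        adaptive_sample_axioms.intro)
      show "integrable (\<kappa> z) \<Psi>" if "dist x z \<le> h0" for z using that by (intro ci) (simp add: h0_def)
      show "(\<integral>\<^sup>+ y. ennreal (norm (\<Psi> y - (\<integral>y'. \<Psi> y' \<partial>\<kappa> z)) ^ k) \<partial>\<kappa> z) \<le> ennreal (fact k / 2 * \<sigma> ^ k)"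
        if "dist x z \<le> h0" "k \<ge> 2" for z k using that by (intro cm) (simp_all add: h0_def)
    qed (fact \<phi>_pos[unfolded \<phi>_def] H_\<phi>[unfolded \<phi>_def] \<zeta>(2) lL bounded_linear_ident | fact)+
    have decomp: "norm (Mean_hat n \<omega> h - ?F x) \<le> b * h powr \<beta> + norm (A.stoch n h \<omega>)"
      if hp: "h > 0" "h \<le> h0" and mass: "A.mass n h \<omega> > 0" for n h \<omega>
    proof -
      \<comment> \<open>Here \<open>F\<close> is exactly the conditional mean that
        \<open>stochastic_term\<close> subtracts, so bias and stochastic term add up to the error
        and no remainder is left.\<close>
      have eq: "Mean_hat n \<omega> h - ?F x
          = (kernel_average K x (\<lambda>i. Xs i \<omega>) n h (\<lambda>i. ?F (Xs i \<omega>)) - ?F x) + A.stoch n h \<omega>"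
        unfolding Mean_hat_def stochastic_term_def kernel_average_def
        by (simp add: scaleR_diff_right sum_subtractf)
      have "norm (kernel_average K x (\<lambda>i. Xs i \<omega>) n h (\<lambda>i. ?F (Xs i \<omega>)) - ?F x) \<le> b * h powr \<beta>"
        using b hp by (intro A.bias_le mass Fb) (auto simp: h0_def)
      then show ?thesis unfolding eq by (rule norm_triangle_mono) simp
    qed
    \<comment> \<open>The stochastic term occurs once in \<open>decomp\<close>; it is doubled to
      match the form shared with the general case.\<close>
    have err: "\<forall>\<^sub>F n in sequentially. AE \<omega> in M. A.good n (H n) \<omega> \<longrightarrow>
      (\<forall>h\<in>H n. norm (Mean_hat n \<omega> h - ?F x) \<le> b * h powr \<beta> + 2 * norm (A.stoch n h \<omega>))"
      using eventually_ge_at_top[of 2] A.eventually_bandwidth_le[OF h0] A.eventually_\<zeta>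
    proof eventually_elim
      case (elim n)
      show ?case
      proof (intro AE_I2 impI ballI)
        fix \<omega> h assume g: "A.good n (H n) \<omega>" and h: "h \<in> H n"
        have hp: "h > 0" "h \<le> h0" using h H[OF elim(1)] elim(2) by auto
        have "A.mass n h \<omega> > 0"
          by (rule A.good_bounds(1)[where \<zeta> = \<zeta>, OF g h hp(1) elim(1) A.phi_pos[OF hp(1)] elim(3)[THEN conjunct1]])
        then show "norm (Mean_hat n \<omega> h - ?F x) \<le> b * h powr \<beta> + 2 * norm (A.stoch n h \<omega>)"
          using decomp[OF hp, of \<omega> n] norm_ge_zero[of "A.stoch n h \<omega>"] by linarith
      qed
    qed
    obtain C where C: "C > 0" and ev: "\<forall>\<^sub>F n in sequentially. AE \<omega> in M. A.good n (H n) \<omega> \<longrightarrow>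
      (norm (Mean_hat n \<omega> (hstar' n \<omega>) - ?F x))\<^sup>2 \<le> C * A.rate n"
    proof (rule A.eventually_good_rate[OF less_imp_le[OF b] _ err])
      show "is_selected_bandwidth (H n) (Mean_hat n \<omega>) (\<lambda>h. A.pen \<zeta> n h \<omega>) (hstar' n \<omega>)"
        if "2 \<le> n" "\<omega> \<in> space M" for n \<omega>
        using sel that unfolding D_def by blast
    qed
    have hs: "hstar' n \<omega> \<in> H n" if "2 \<le> n" "\<omega> \<in> space M" for n \<omega>
      using sel that unfolding is_selected_bandwidth_def is_arg_min_def by blast
    \<comment> \<open>The first summand is the error when no observation has positive weight, as the
      estimate is then 0 by convention; the second bounds the bias for all
      \<open>h \<le> h0\<close>.\<close>
    define B where "B = norm (?F x) + b * h0 powr \<beta>"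
    have crude: "\<forall>\<^sub>F n in sequentially. \<forall>\<omega>\<in>space M.
      norm (Mean_hat n \<omega> (hstar' n \<omega>) - ?F x) \<le> B + sqrt (\<Sum>i=1..n. A.noise_sq i \<omega>)"
      using eventually_ge_at_top[of 2] A.eventually_bandwidth_le[OF h0]
    proof eventually_elim
      case (elim n)
      show ?case
      proof
        fix \<omega> assume \<omega>: "\<omega> \<in> space M"
        define h where "h = hstar' n \<omega>"
        have hp: "h > 0" "h \<le> h0" using hs[OF elim(1) \<omega>] H[OF elim(1)] elim(2) by (auto simp: h_def)
        have U0: "0 \<le> sqrt (\<Sum>i=1..n. A.noise_sq i \<omega>)" by (simp add: sum_nonneg A.noise_sq_nonneg)
        have hb: "0 \<le> b * h powr \<beta>" "b * h powr \<beta> \<le> b * h0 powr \<beta>"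
          using b hp \<beta> by (auto intro!: mult_left_mono powr_mono2)
        show "norm (Mean_hat n \<omega> (hstar' n \<omega>) - ?F x) \<le> B + sqrt (\<Sum>i=1..n. A.noise_sq i \<omega>)"
        proof (cases "A.mass n h \<omega> > 0")
          case True
          then show ?thesis
            using decomp[OF hp True] A.stoch_le_noise_sq[OF hp True] hb norm_ge_zero[of "?F x"]
            unfolding B_def h_def by linarith
        next
          case False
          have "0 \<le> A.mass n h \<omega>"
            unfolding kernel_mass_def using hp by (intro sum_nonneg K_nonneg) simp
          with False have "Mean_hat n \<omega> h = 0" by (simp add: Mean_hat_def kernel_average_def)
          then show ?thesis using U0 hb unfolding B_def h_def by simp
        qed
      qed
    qed
    have meas: "(\<lambda>\<omega>. Mean_hat n \<omega> (hstar' n \<omega>)) \<in> borel_measurable M" if n: "n \<ge> 2" for n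
    proof (rule A.selected_measurable[where A = "H n"])
      show "(\<lambda>\<omega>. Mean_hat n \<omega> h) \<in> borel_measurable M" if "h \<in> H n" for h
        unfolding Mean_hat_def using that H[OF n] by (intro A.kernel_average_meas \<Psi>) auto
    qed (use sel H[OF n] hs[OF n] n in auto)
    show "\<forall>\<^sub>F n in sequentially. integrable M (\<lambda>\<omega>. (norm (Mean_hat n \<omega> (hstar' n \<omega>) - ?F x))\<^sup>2)"
      by (rule A.rate_in_mean(1)[where est = Mean_hat and hs = hstar', OF C ev crude meas])
    show "(\<lambda>n. \<integral>\<omega>. (norm (Mean_hat n \<omega> (hstar' n \<omega>) - ?F x))\<^sup>2 \<partial>M) \<in> O(lam)"
      using A.rate_in_mean(2)[where est = Mean_hat and hs = hstar', OF C ev crude meas] unfolding lam_def A.phi_def .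
  }
qed

end
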